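(* Let $n\ge2$ be an integer, let $U(n)$ be the group of $n\times n$ unitary matrices with the Riemannian distance $D$ induced by the Hilbert–Schmidt inner product and Haar probability measure $\mathcal{H}$, and let $L$ be the Markov transition kernel on $U(n)$ given by $$L_x(S)=\frac{1}{\binom n2}\sum_{1\le i<j\le n}\int_{U(2)}\delta_{R_{ij}x}(S)\,dH(R),\qquad x\in U(n),\ S\subset U(n)\text{ Borel},$$ where $H$ is the Haar probability measure on $U(2)$ and $R_{ij}\in U(n)$ is the unitary acting as $R\in U(2)$ on the span of the $i$th and $j$th canonical basis vectors. Then the $L^2$ transportation-cost mixing time $$\tau_{D,2}(\varepsilon)=\inf\{t\in\mathbb{N}: W_{D,2}(\mu L^t,\mathcal{H})\le\varepsilon \text{ for all Borel probability measures } \mu \text{ on } U(n)\}$$ satisfies $$\tau_{D,2}(\varepsilon)\le\left\lceil n^2\ln\left(\frac{\pi\sqrt n}{\varepsilon}\right)\right\rceil,\qquad \varepsilon>0 .$$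
   Context: $\mathbb{N}=\{0,1,2,\dots\}$. $M(n,\mathbb{C})$ is the space of complex $n\times n$ matrices with the Hilbert–Schmidt inner product $\langle a,b\rangle_{\mathrm{hs}}=\mathrm{Tr}(ab^* )$, where $b^*$ is the conjugate transpose, and norm $\|a\|_{\mathrm{hs}}=\sqrt{\langle a,a\rangle_{\mathrm{hs}}}$. $U(n)=\{a\in M(n,\mathbb{C}):aa^*=a^*a=\mathrm{id}\}$. $D$ is the Riemannian distance on $U(n)$ induced by the Hilbert–Schmidt inner product of the ambient space (so $D(a,b)$ is the infimum over piecewise smooth curves $\gamma$ in $U(n)$ from $a$ to $b$ of $\int\|\gamma'(t)\|_{\mathrm{hs}}\,dt$). $\mathcal{H}$ is the bi-invariant Borel probability measure on $U(n)$. Let $e_1,\dots,e_n$ be the canonical basis of $\mathbb{C}^n$. For each $1\le i<j\le n$ a linear isometry $I_{ij}:\mathrm{span}\{e_i,e_j\}\to\mathbb{C}^2$ is fixed. For $u\in U(2)$, $u_{ij}\in U(n)$ is the unitary operator acting as $I_{ij}^{-1}\circ u\circ I_{ij}$ on $\mathrm{span}\{e_i,e_j\}$ and as the identity on $\mathrm{span}\{e_i,e_j\}^\perp$. For a kernel $P$ and a probability measure $\mu$, $\mu P(S)=\int P_x(S)\,d\mu(x)$, $\mu P^0=\mu$ and $\mu P^{t+1}=(\mu P^t)P$. For a metric space $(M,d)$ and Borel probability measures $\mu,\nu$ on $M$ with finite second moments, $W_{d,2}(\mu,\nu)=\inf\left(\int d(x,y)^2\,d\eta(x,y)\right)^{1/2}$,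 the infimum being over all couplings $\eta$ of $\mu$ and $\nu$ (probability measures on $M\times M$ with marginals $\mu,\nu$).
   Formalization: The bound is stated as max(0, ⌈n² ln(π√n/ε)⌉): for large ε the printed ceiling is a negative integer, which the mixing time, a natural number, cannot be at most; elsewhere it is the printed bound. *)

theory Defs
  imports "HOL-Probability.Probability"
begin

definition conj_transpose :: "complex^'n^'m \<Rightarrow> complex^'m^'n" where
  "conj_transpose a = (\<chi> i j. cnj (a $ j $ i))"

definition hs_inner :: "complex^'n^'n \<Rightarrow> complex^'n^'n \<Rightarrow> complex" where
  "hs_inner a b = trace (a ** conj_transpose b)"

definition hs_norm :: "complex^'n^'n \<Rightarrow> real" where
  "hs_norm a = sqrt (Re (hs_inner a a))"

definition unitary_group :: "(complex^'n^'n) set" where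
  "unitary_group = {a. a ** conj_transpose a = mat 1 \<and> conj_transpose a ** a = mat 1}"

text \<open>Infinitely differentiable on \<open>S\<close> (for a closed interval: with one-sided derivatives of
  all orders at the end points); \<open>F k\<close> is the \<open>k\<close>-th derivative.\<close>

definition smooth_curve_on :: "(real \<Rightarrow> 'a::real_normed_vector) \<Rightarrow> real set \<Rightarrow> bool" where
  "smooth_curve_on \<gamma> S \<longleftrightarrow>
     (\<exists>F :: nat \<Rightarrow> real \<Rightarrow> 'a. (\<forall>t\<in>S. F 0 t = \<gamma> t) \<and>
        (\<forall>k. \<forall>t\<in>S. (F k has_vector_derivative F (Suc k) t) (at t within S)))"

text \<open>The pieces are closed intervals, so continuity of the curve and boundedness of its
  derivative are part of the definition; in particular the speed is integrable.\<close>

definition piecewise_smooth_curve :: "(real \<Rightarrow> 'a::real_normed_vector) \<Rightarrow> bool" where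
  "piecewise_smooth_curve \<gamma> \<longleftrightarrow>
     (\<exists>(m::nat) p. p 0 = 0 \<and> p m = 1 \<and>
        (\<forall>k<m. p k < p (Suc k) \<and> smooth_curve_on \<gamma> {p k..p (Suc k)}))"

definition hs_length :: "(real \<Rightarrow> complex^'n^'n) \<Rightarrow> real" where
  "hs_length \<gamma> = integral {0..1} (\<lambda>t. hs_norm (vector_derivative \<gamma> (at t)))"

definition riemann_dist :: "complex^'n^'n \<Rightarrow> complex^'n^'n \<Rightarrow> real" where
  "riemann_dist a b = Inf {hs_length \<gamma> |\<gamma>. piecewise_smooth_curve \<gamma> \<and>
     \<gamma> ` {0..1} \<subseteq> unitary_group \<and> \<gamma> 0 = a \<and> \<gamma> 1 = b}"

abbreviation unitary_borel :: "(complex^'n^'n) measure" where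
  "unitary_borel \<equiv> restrict_space borel unitary_group"

definition borel_prob_on_unitary :: "(complex^'n^'n) measure \<Rightarrow> bool" where
  "borel_prob_on_unitary \<mu> \<longleftrightarrow> prob_space \<mu> \<and> sets \<mu> = sets unitary_borel"

definition haar_prob :: "(complex^'n^'n) measure \<Rightarrow> bool" where
  "haar_prob \<mu> \<longleftrightarrow> borel_prob_on_unitary \<mu> \<and>
     (\<forall>g\<in>unitary_group. distr \<mu> \<mu> (\<lambda>x. g ** x) = \<mu> \<and> distr \<mu> \<mu> (\<lambda>x. x ** g) = \<mu>)"

definition coord_span :: "'n \<Rightarrow> 'n \<Rightarrow> (complex^'n) set" where
  "coord_span i j = vec.span {axis i 1, axis j 1}"

definition complex_linear_isometry_on :: "(complex^'n) set \<Rightarrow> (complex^'n \<Rightarrow> complex^'m) \<Rightarrow> bool" where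
  "complex_linear_isometry_on V f \<longleftrightarrow>
     (\<forall>x\<in>V. \<forall>y\<in>V. f (x + y) = f x + f y) \<and>
     (\<forall>c. \<forall>x\<in>V. f (c *s x) = c *s f x) \<and>
     (\<forall>x\<in>V. norm (f x) = norm x)"

definition hermitian_complement :: "(complex^'n) set \<Rightarrow> (complex^'n) set" where
  "hermitian_complement V = {x. \<forall>y\<in>V. (\<Sum>k\<in>UNIV. x $ k * cnj (y $ k)) = 0}"

text \<open>\<open>embed_unitary J i j u\<close> is $u_{ij}$, where \<open>J\<close> plays the role of $I_{ij}$. Such a matrix
  exists and is unique whenever \<open>J\<close> is a linear isometry on \<open>coord_span i j\<close> and \<open>i \<noteq> j\<close>.\<close>

definition embed_unitary ::
    "(complex^'n \<Rightarrow> complex^2) \<Rightarrow> 'n \<Rightarrow> 'n \<Rightarrow> complex^2^2 \<Rightarrow> complex^'n^'n" where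
  "embed_unitary J i j u = (THE a.
     (\<forall>v\<in>coord_span i j. a *v v = inv_into (coord_span i j) J (u *v J v)) \<and>
     (\<forall>v\<in>hermitian_complement (coord_span i j). a *v v = v))"

definition kac_kernel ::
    "('n::{finite,linorder} \<Rightarrow> 'n \<Rightarrow> complex^'n::{finite,linorder} \<Rightarrow> complex^2) \<Rightarrow> (complex^2^2) measure
      \<Rightarrow> complex^'n::{finite,linorder}^'n::{finite,linorder} \<Rightarrow> (complex^'n::{finite,linorder}^'n::{finite,linorder}) measure" where
  "kac_kernel I H x = measure_of unitary_group (sets unitary_borel)
     (\<lambda>S. (\<Sum>(i, j)\<in>{(i, j). i < j}.
             \<integral>\<^sup>+R. emeasure (return unitary_borel (embed_unitary (I i j) i j R ** x)) S \<partial>H)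
          / of_nat (CARD('n) choose 2))"

text \<open>The Giry bind satisfies \<open>emeasure (\<mu> \<bind> P) S = (\<integral>\<^sup>+x. emeasure (P x) S \<partial>\<mu>)\<close>.\<close>

definition kernel_iterate :: "'a measure \<Rightarrow> ('a \<Rightarrow> 'a measure) \<Rightarrow> nat \<Rightarrow> 'a measure" where
  "kernel_iterate \<mu> P t = ((\<lambda>\<nu>. \<nu> \<bind> P) ^^ t) \<mu>"

definition couplings :: "'a measure \<Rightarrow> 'a measure \<Rightarrow> ('a \<times> 'a) measure set" where
  "couplings \<mu> \<nu> = {\<eta>. prob_space \<eta> \<and> sets \<eta> = sets (\<mu> \<Otimes>\<^sub>M \<nu>) \<and>
     distr \<eta> \<mu> fst = \<mu> \<and> distr \<eta> \<nu> snd = \<nu>}"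

text \<open>The Bochner integral of a non-integrable function is 0, so couplings of infinite cost have
  to be excluded. For a continuous metric on a separable space and measures with finite second
  moments, every coupling satisfies the integrability condition.\<close>

definition wasserstein2 :: "('a \<Rightarrow> 'a \<Rightarrow> real) \<Rightarrow> 'a measure \<Rightarrow> 'a measure \<Rightarrow> real" where
  "wasserstein2 d \<mu> \<nu> = Inf {sqrt (\<integral>z. (d (fst z) (snd z))\<^sup>2 \<partial>\<eta>) |\<eta>.
     \<eta> \<in> couplings \<mu> \<nu> \<and> integrable \<eta> (\<lambda>z. (d (fst z) (snd z))\<^sup>2)}"

text \<open>Valued in \<^typ>\<open>enat\<close>, where \<open>Inf {} = \<infinity>\<close>; on \<^typ>\<open>nat\<close> one would have \<open>Inf {} = 0\<close>.\<close>

definition mixing_time ::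
    "('n::{finite,linorder} \<Rightarrow> 'n \<Rightarrow> complex^'n::{finite,linorder} \<Rightarrow> complex^2) \<Rightarrow> (complex^2^2) measure
      \<Rightarrow> (complex^'n::{finite,linorder}^'n::{finite,linorder}) measure \<Rightarrow> real \<Rightarrow> enat" where
  "mixing_time I H \<H> \<epsilon> = Inf {enat t |t. \<forall>\<mu>. borel_prob_on_unitary \<mu> \<longrightarrow>
     wasserstein2 riemann_dist (kernel_iterate \<mu> (kac_kernel I H) t) \<H> \<le> \<epsilon>}"

end

theory Submission
  imports Defs "HOL-Computational_Algebra.Fundamental_Theorem_Algebra"
begin

text \<open>
  Given a curve \<open>\<gamma>\<close> from \<open>x\<close> to \<open>y\<close> with velocity \<open>\<gamma>' = A \<gamma>\<close>, multiply it on the left by the curve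
  \<open>W\<close> in the copy of \<open>U(2)\<close> at \<open>(i, j)\<close> that cancels the \<open>(i, j)\<close>-block of \<open>A\<close>. This gives a curve
  from \<open>x\<close> to \<open>V y\<close> with velocity of norm \<open>\<parallel>A - A\<^bsub>ij\<^esub>\<parallel>\<close>. The sum over all \<open>N\<close> pairs of
  \<open>\<parallel>A - A\<^bsub>ij\<^esub>\<parallel>\<^sup>2\<close> is at most \<open>(N - 1) \<parallel>A\<parallel>\<^sup>2\<close>, since the blocks cover all entries of \<open>A\<close>.
  Approximating \<open>\<gamma>\<close> by a broken geodesic makes \<open>W\<close> a product of exponentials. Hence, if both copies
  of the chain use the same pair \<open>(i, j)\<close> and the Haar rotations \<open>R\<close> and \<open>R V\<close>, the expected
  squared distance shrinks by the factor \<open>1 - 1/N\<close> in each step. It starts below the squared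
  diameter \<open>\<pi>\<^sup>2 n\<close>, and \<open>(1 - 1/N)\<^sup>t \<le> exp (- 2 t / n\<^sup>2)\<close>.
\<close>

text \<open>For a general curve W solves W' = - W A_ij with a time-dependent coefficient; where A is
  constant this is an exponential, and derivatives of all orders are explicit. The chain also
  multiplies on the left, so D(R x, R V y) = D(x, V y) by left invariance, while R V is again Haar
  distributed because V depends on x, y and the pair but not on R: this is the use of right
  invariance on U(2). Two things resist an exact argument: a shortest curve would have to be
  produced, and V must depend measurably on (x, y). Both are met by an arbitrarily small additive
  error in the squared cost of each step, which an infimum over couplings forgives. On the
  constants: a pair removes the share |A_ij|^2 of |A|^2, and over all pairs an off-diagonal entry is
  removed once, a diagonal one n - 1 times, so at least |A|^2 / N goes on average. The diameter
  bound pi sqrt n comes from n eigenvalue angles of size at most pi, and the rate 2 / n^2 from N = n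
  (n - 1) / 2 <= n^2 / 2.\<close>

section \<open>Matrices, the Hilbert-Schmidt norm and the unitary group\<close>

lemma conj_transpose_nth [simp]: "conj_transpose a $ i $ j = cnj (a $ j $ i)"
  by (simp add: conj_transpose_def)

lemma conj_transpose_mult: "conj_transpose (a ** b) = conj_transpose b ** conj_transpose a"
  by (simp add: vec_eq_iff matrix_matrix_mult_def mult.commute)

lemma conj_transpose_conj_transpose [simp]: "conj_transpose (conj_transpose a) = a"
  by (simp add: vec_eq_iff)

lemma conj_transpose_minus: "conj_transpose (- a) = - conj_transpose a"
  by (simp add: vec_eq_iff)

lemma conj_transpose_mat_1 [simp]: "conj_transpose (mat 1) = mat 1"
  by (simp add: vec_eq_iff mat_def)

text \<open>The Euclidean norm of nested vectors is the Frobenius norm, so lengths measured by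
  \<open>hs_norm\<close> become lengths in a library normed space.\<close>

lemma hs_norm_eq_norm: "hs_norm a = norm a"
proof -
  have "Re (hs_inner a a) = (\<Sum>i\<in>UNIV. \<Sum>k\<in>UNIV. (norm (a $ i $ k))\<^sup>2)"
    by (simp add: hs_inner_def trace_def matrix_matrix_mult_def complex_norm_square[symmetric]
        del: of_real_power)
  then show ?thesis
    by (simp add: hs_norm_def norm_vec_def L2_set_def sum_nonneg)
qed

lemma unitary_group_iff: "a \<in> unitary_group \<longleftrightarrow> conj_transpose a ** a = mat 1"
  by (auto simp: unitary_group_def matrix_left_right_inverse)

lemma unitary_group_mult: "a \<in> unitary_group \<Longrightarrow> b \<in> unitary_group \<Longrightarrow> a ** b \<in> unitary_group"
  unfolding unitary_group_iff conj_transpose_mult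
  by (metis matrix_mul_assoc matrix_mul_rid)

lemma unitary_group_conj_transpose:
  "a \<in> unitary_group \<Longrightarrow> conj_transpose a \<in> unitary_group"
  by (simp add: unitary_group_def)

lemma unitary_group_mat_1 [simp]: "mat 1 \<in> unitary_group"
  by (simp add: unitary_group_iff)

lemma unitary_cancel_left:
  "u \<in> unitary_group \<Longrightarrow> conj_transpose u ** (u ** a) = a"
  "u \<in> unitary_group \<Longrightarrow> u ** (conj_transpose u ** a) = a"
  by (simp_all add: matrix_mul_assoc unitary_group_def)

lemma unitary_cancel_right:
  "u \<in> unitary_group \<Longrightarrow> (a ** u) ** conj_transpose u = a"
  "u \<in> unitary_group \<Longrightarrow> (a ** conj_transpose u) ** u = a"
  by (simp_all add: matrix_mul_assoc[symmetric] unitary_group_def)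

lemma norm_unitary_mult_left:
  fixes a :: "complex^'n^'n"
  assumes "u \<in> unitary_group" shows "norm (u ** a) = norm a"
proof -
  have "hs_inner (u ** a) (u ** a) = trace (u ** (a ** conj_transpose a ** conj_transpose u))"
    by (simp add: hs_inner_def conj_transpose_mult matrix_mul_assoc)
  also have "\<dots> = trace ((a ** conj_transpose a ** conj_transpose u) ** u)"
    by (rule trace_mul_sym)
  also have "\<dots> = hs_inner a a"
    by (simp add: unitary_cancel_right assms hs_inner_def)
  finally show ?thesis
    by (simp add: hs_norm_eq_norm[symmetric] hs_norm_def)
qed

lemma norm_unitary_mult_right:
  fixes a :: "complex^'n^'n"
  assumes "u \<in> unitary_group" shows "norm (a ** u) = norm a"
proof -
  have "hs_inner (a ** u) (a ** u) = hs_inner a a"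
    using assms by (simp add: hs_inner_def conj_transpose_mult matrix_mul_assoc unitary_cancel_right)
  then show ?thesis
    by (simp add: hs_norm_eq_norm[symmetric] hs_norm_def)
qed

lemma bilinear_matrix_mult:
  "bilinear ((**) :: complex^'n^'m \<Rightarrow> complex^'k^'n \<Rightarrow> complex^'k^'m)"
  unfolding bilinear_def linear_iff
  by (simp add: vec_eq_iff matrix_matrix_mult_def algebra_simps sum.distrib scaleR_sum_right)

lemma bounded_bilinear_matrix_mult:
  "bounded_bilinear ((**) :: complex^'n^'m \<Rightarrow> complex^'k^'n \<Rightarrow> complex^'k^'m)"
  using bilinear_matrix_mult bilinear_conv_bounded_bilinear by blast

lemma bounded_linear_conj_transpose: "bounded_linear (conj_transpose :: complex^'n^'m \<Rightarrow> _)"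
  unfolding linear_conv_bounded_linear[symmetric] linear_iff
  by (simp add: vec_eq_iff)

lemmas continuous_on_matrix_mult [continuous_intros] =
  bounded_bilinear.continuous_on[OF bounded_bilinear_matrix_mult]

lemmas continuous_on_conj_transpose [continuous_intros] =
  bounded_linear.continuous_on[OF bounded_linear_conj_transpose]

text \<open>All unitary matrices have the norm of the identity, and the defining equation is closed.
  Compactness yields the finite cover behind the measurable choice of blocks.\<close>

lemma compact_unitary_group: "compact (unitary_group :: (complex^'n^'n) set)"
proof -
  have "norm a = norm (mat 1 :: complex^'n^'n)" if "a \<in> unitary_group" for a :: "complex^'n^'n"
    using norm_unitary_mult_left[OF that, of "mat 1"] by simp
  then have "bounded (unitary_group :: (complex^'n^'n) set)"
    unfolding bounded_iff by (metis order_refl)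
  moreover have "closed (unitary_group :: (complex^'n^'n) set)"
  proof -
    have "closed ((\<lambda>a::complex^'n^'n. conj_transpose a ** a) -` {mat 1})"
      by (intro closed_vimage closed_singleton continuous_on_matrix_mult
          continuous_on_conj_transpose continuous_on_id)
    moreover have "(\<lambda>a::complex^'n^'n. conj_transpose a ** a) -` {mat 1} = unitary_group"
      by (auto simp: unitary_group_iff)
    ultimately show ?thesis by simp
  qed
  ultimately show ?thesis by (simp add: compact_eq_bounded_closed)
qed

subsection \<open>Diagonalisation of normal matrices\<close>

text \<open>Complex-valued, because complex orthogonality and the adjoint identity need more than
  the real part, which is what \<open>inner\<close> computes.\<close>

definition herm :: "complex^'n \<Rightarrow> complex^'n \<Rightarrow> complex" where
  "herm x y = (\<Sum>k\<in>UNIV. x $ k * cnj (y $ k))"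

lemma herm_add_left: "herm (x + y) z = herm x z + herm y z"
  by (simp add: herm_def sum.distrib algebra_simps)

lemma herm_diff_left: "herm (x - y) z = herm x z - herm y z"
  by (simp add: herm_def sum_subtractf algebra_simps)

lemma herm_scale_left: "herm (c *s x) z = c * herm x z"
  by (simp add: herm_def sum_distrib_left algebra_simps)

lemma herm_scale_right: "herm x (c *s z) = cnj c * herm x z"
  by (simp add: herm_def sum_distrib_left algebra_simps)

lemma herm_sum_left: "herm (\<Sum>b\<in>B. f b) z = (\<Sum>b\<in>B. herm (f b) z)"
  by (induction B rule: infinite_finite_induct)
    (simp_all add: herm_add_left, simp_all add: herm_def)

lemma herm_commute: "herm x y = cnj (herm y x)"
  by (simp add: herm_def mult.commute)

lemma herm_self: "herm x x = of_real ((norm x)\<^sup>2)"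
proof -
  have "herm x x = of_real (\<Sum>k\<in>UNIV. (norm (x $ k))\<^sup>2)"
    by (simp only: herm_def of_real_sum complex_norm_square)
  then show ?thesis by (simp add: norm_vec_def L2_set_def sum_nonneg)
qed

lemma herm_adjoint: "herm (a *v x) y = herm x (conj_transpose a *v y)"
proof -
  have "herm (a *v x) y = (\<Sum>i\<in>UNIV. \<Sum>k\<in>UNIV. a $ i $ k * x $ k * cnj (y $ i))"
    by (simp add: herm_def matrix_vector_mult_def sum_distrib_right)
  also have "\<dots> = (\<Sum>k\<in>UNIV. \<Sum>i\<in>UNIV. a $ i $ k * x $ k * cnj (y $ i))"
    by (rule sum.swap)
  also have "\<dots> = herm x (conj_transpose a *v y)"
    by (simp add: herm_def matrix_vector_mult_def sum_distrib_left mult.assoc mult.left_commute)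
  finally show ?thesis .
qed

text \<open>\<open>poly_act a p x\<close> is \<open>p(a) x\<close>.\<close>

definition poly_act :: "complex^'n^'n \<Rightarrow> complex poly \<Rightarrow> complex^'n \<Rightarrow> complex^'n" where
  "poly_act a p x = fold_coeffs (\<lambda>c y. c *s x + a *v y) p 0"

lemma poly_act_0 [simp]: "poly_act a 0 x = 0"
  by (simp add: poly_act_def)

lemma poly_act_pCons [simp]: "poly_act a (pCons c p) x = c *s x + a *v poly_act a p x"
\<comment> \<open>\<open>pCons 0 0\<close> is the zero polynomial, on which
  \<open>fold_coeffs\<close> performs no step; in the other cases the fold peels off one
  coefficient.\<close>
proof (cases "c = 0 \<and> p = 0")
  case True
  then show ?thesis
    by (simp only: pCons_0_0 poly_act_0 vec.scale_zero_left matrix_vector_mult_0_right add_0)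
next
  case False
  then consider "c \<noteq> 0" | "p \<noteq> 0" by auto
  then show ?thesis
    by cases (simp_all only: poly_act_def o_apply fold_coeffs_pCons_coeff_not_0_eq
        fold_coeffs_pCons_not_0_0_eq not_False_eq_True)
qed

lemma poly_act_add: "poly_act a (p + q) x = poly_act a p x + poly_act a q x"
  by (induction p q rule: poly_induct2)
    (simp_all add: matrix_vector_right_distrib vec.scale_left_distrib add.assoc add.left_commute)

lemma poly_act_smult: "poly_act a (smult c p) x = c *s poly_act a p x"
  by (induction p)
    (simp_all add: vec.scale_right_distrib vector_scalar_commute)

lemma poly_act_monom: "poly_act a (monom c k) x = c *s ((\<lambda>y. a *v y) ^^ k) x"
  by (induction k) (simp_all add: monom_0 monom_Suc vector_scalar_commute)

lemma poly_act_sum: "poly_act a (\<Sum>k\<in>K. f k) x = (\<Sum>k\<in>K. poly_act a (f k) x)"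
  by (induction K rule: infinite_finite_induct) (simp_all add: poly_act_add)

lemma poly_act_mem:
  assumes "vec.subspace V" "\<And>x. x \<in> V \<Longrightarrow> a *v x \<in> V" "x \<in> V"
  shows "poly_act a p x \<in> V"
  using assms
  by (induction p) (auto intro: vec.subspace_0 vec.subspace_add vec.subspace_scale)

text \<open>The n + 1 vectors x, a x, ..., a^n x are dependent in dimension n, and a dependence is
  such a polynomial. Dependence is a property of sets, in which coinciding iterates would merge;
  that case is settled by a difference of two monomials.\<close>

lemma annihilating_poly:
  fixes a :: "complex^'n^'n"
  obtains p where "p \<noteq> 0" "poly_act a p x = 0"
proof (cases "inj_on (\<lambda>k. ((\<lambda>y. a *v y) ^^ k) x) {..CARD('n)}")
  case False
  then obtain j k where jk: "j \<noteq> k" "((\<lambda>y. a *v y) ^^ j) x = ((\<lambda>y. a *v y) ^^ k) x"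
    by (auto simp: inj_on_def)
  have "poly_act a (monom 1 j + monom (-1) k) x = 0"
    by (simp only: poly_act_add poly_act_monom jk) (simp add: vec_eq_iff)
  moreover have "coeff (monom 1 j + monom (-1) k :: complex poly) j \<noteq> 0"
    using jk by simp
  then have "monom 1 j + monom (-1) k \<noteq> (0 :: complex poly)" by (metis coeff_0)
  ultimately show ?thesis using that by blast
next
  case True
  let ?f = "\<lambda>k. ((\<lambda>y. a *v y) ^^ k) x"
  let ?S = "?f ` {..CARD('n)}"
  have "card ?S = Suc CARD('n)" using True by (simp add: card_image)
  then have "vec.dependent ?S"
    using vec.independent_bound_general[of ?S] vec.dim_subset[OF subset_UNIV, of ?S]
    unfolding vec_dim_card by (cases "vec.dependent ?S") simp_all
  then obtain u where u: "\<exists>v\<in>?S. u v \<noteq> 0" "(\<Sum>v\<in>?S. u v *s v) = 0"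
    using vec.dependent_finite[of ?S] by auto
  define p where "p = (\<Sum>k\<le>CARD('n). monom (u (?f k)) k)"
  have "poly_act a p x = (\<Sum>k\<le>CARD('n). u (?f k) *s ?f k)"
    by (simp add: p_def poly_act_sum poly_act_monom)
  also have "\<dots> = 0" using u(2) by (simp add: sum.reindex[OF True])
  finally have "poly_act a p x = 0" .
  moreover obtain k where k: "k \<le> CARD('n)" "u (?f k) \<noteq> 0" using u(1) by auto
  have "coeff p k = u (?f k)" using k(1) by (simp add: p_def coeff_sum)
  then have "p \<noteq> 0" using k(2) by auto
  ultimately show ?thesis using that by blast
qed

text \<open>Split off a root z, so p = (X - z) q. Either q annihilates x and has smaller degree, or
  q(a) x is an eigenvector for z that still lies in the invariant subspace.\<close>

lemma eigenvector_of_annihilating_poly: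
  assumes V: "vec.subspace V" "\<And>x. x \<in> V \<Longrightarrow> a *v x \<in> V"
    and "x \<in> V" "x \<noteq> 0" "p \<noteq> 0" "poly_act a p x = 0"
  shows "\<exists>v\<in>V. \<exists>c. v \<noteq> 0 \<and> a *v v = c *s v"
  using assms(3-)
proof (induction "degree p" arbitrary: p)
  case 0
  then obtain c where "p = [:c:]" "c \<noteq> 0"
    by (metis degree_eq_zeroE pCons_0_0)
  then show ?case using 0 by simp
next
  case (Suc m)
  obtain z where "poly p z = 0"
    using fundamental_theorem_of_algebra[of p] Suc.hyps(2)
    by (metis constant_degree nat.distinct(1))
  then obtain q where q: "p = [:- z, 1:] * q" by (metis dvdE poly_eq_0_iff_dvd)
  have "q \<noteq> 0" using Suc.prems q by auto
  have deg: "degree q = m"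
    using Suc.hyps(2) \<open>q \<noteq> 0\<close> unfolding q by (subst (asm) degree_mult_eq) auto
  let ?y = "poly_act a q x"
  have "poly_act a p x = a *v ?y - z *s ?y"
    unfolding q mult_pCons_left poly_act_add poly_act_smult by (simp add: vec_eq_iff)
  then have y: "a *v ?y = z *s ?y" using Suc.prems by simp
  show ?case
  proof (cases "?y = 0")
    case True
    then show ?thesis using Suc.hyps(1)[of q] Suc.prems \<open>q \<noteq> 0\<close> deg by simp
  next
    case False
    then show ?thesis using y poly_act_mem[OF V Suc.prems(1)] by blast
  qed
qed

text \<open>The matrix b = a - c is normal as well, so the adjoint of b sends v to a vector of the
  same norm as b v, which is 0.\<close>

lemma normal_eigenvector_adjoint:
  assumes n: "a ** conj_transpose a = conj_transpose a ** a" and v: "a *v v = c *s v"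
  shows "conj_transpose a *v v = cnj c *s v"
proof -
  define b where "b = a - mat c"
  have bt: "conj_transpose b = conj_transpose a - mat (cnj c)"
    by (simp add: b_def vec_eq_iff mat_def)
  have "b ** conj_transpose b = conj_transpose b ** b"
  proof -
    have comm: "mat c ** x = x ** mat c" for x :: "complex^'a^'a" and c
      by (simp add: vec_eq_iff matrix_matrix_mult_def mat_def if_distrib if_distribR sum.delta'
            sum.delta mult.commute cong: if_cong)
    have "(x - y) ** (z - w) = x ** z - x ** w - y ** z + y ** w" for x y z w :: "complex^'a^'a"
      by (simp add: bounded_bilinear.diff_left[OF bounded_bilinear_matrix_mult]
          bounded_bilinear.diff_right[OF bounded_bilinear_matrix_mult])
    then show ?thesis
      unfolding bt unfolding b_def by (simp add: n comm[of "cnj c" a] comm[of c "conj_transpose a"] comm[of c "mat (cnj c)"])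
  qed
  then have "herm (conj_transpose b *v v) (conj_transpose b *v v) = herm (b *v v) (b *v v)"
    by (simp add: herm_adjoint matrix_vector_mul_assoc)
  moreover have "b *v v = 0"
  proof -
    have "mat c *v v = c *s v"
      by (simp add: vec_eq_iff matrix_vector_mult_def mat_def if_distrib if_distribR cong: if_cong)
    then show ?thesis by (simp add: b_def v matrix_vector_mult_diff_rdistrib)
  qed
  ultimately have "conj_transpose b *v v = 0"
    unfolding herm_self by simp
  moreover have "mat (cnj c) *v v = cnj c *s v"
    by (simp add: vec_eq_iff matrix_vector_mult_def mat_def if_distrib if_distribR cong: if_cong)
  ultimately show ?thesis by (simp add: bt matrix_vector_mult_diff_rdistrib)
qed

text \<open>The orthogonal complement of the eigenvectors found so far is invariant under
  \<open>a\<close>, because by normality they are eigenvectors of the adjoint too; an eigenvector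
  inside the complement extends the family.\<close>

lemma normal_orthonormal_eigenvectors:
  fixes a :: "complex^'n^'n"
  assumes n: "a ** conj_transpose a = conj_transpose a ** a" and "k \<le> CARD('n)"
  shows "\<exists>B. finite B \<and> card B = k \<and> (\<forall>b\<in>B. \<exists>c. a *v b = c *s b) \<and>
    (\<forall>b\<in>B. \<forall>b'\<in>B. herm b b' = (if b = b' then 1 else 0))"
  using assms(2)
proof (induction k)
  case 0
  show ?case by (rule exI[of _ "{}"]) auto
next
  case (Suc k)
  then obtain B where B: "finite B" "card B = k" "\<forall>b\<in>B. \<exists>c. a *v b = c *s b"
    "\<forall>b\<in>B. \<forall>b'\<in>B. herm b b' = (if b = b' then 1 else 0)" by auto
  define V where "V = {x. \<forall>b\<in>B. herm x b = 0}"
  have sub: "vec.subspace V"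
    unfolding vec.subspace_def V_def by (auto simp: herm_add_left herm_scale_left) (simp add: herm_def)
  have inv: "a *v x \<in> V" if "x \<in> V" for x
    unfolding V_def
  proof safe
    fix b assume "b \<in> B"
    then obtain c where "a *v b = c *s b" using B(3) by blast
    then have "conj_transpose a *v b = cnj c *s b" by (rule normal_eigenvector_adjoint[OF n])
    then show "herm (a *v x) b = 0"
      using that \<open>b \<in> B\<close> by (simp add: herm_adjoint herm_scale_right V_def)
  qed
  \<comment> \<open>Fewer than n vectors do not span, and a vector outside the span minus its
    components along B is a nonzero element of the complement.\<close>
  have "vec.dim B < CARD('n)"
    using vec.dim_le_card'[OF B(1)] B(2) Suc.prems by linarith
  then have "vec.span B \<noteq> UNIV"
    using vec.dim_span[of B] by (metis less_irrefl vec_dim_card)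
  then obtain z where z: "z \<notin> vec.span B" by blast
  define x where "x = z - (\<Sum>b\<in>B. herm z b *s b)"
  have "x \<noteq> 0"
  proof
    assume "x = 0"
    then have "z = (\<Sum>b\<in>B. herm z b *s b)" by (simp add: x_def)
    also have "\<dots> \<in> vec.span B"
      by (intro vec.span_sum vec.span_scale vec.span_base)
    finally show False using z by simp
  qed
  moreover have "x \<in> V"
    unfolding V_def
  proof safe
    fix b assume b: "b \<in> B"
    have "herm (\<Sum>b\<in>B. herm z b *s b) b = (\<Sum>b'\<in>B. if b = b' then herm z b' else 0)"
      unfolding herm_sum_left by (rule sum.cong) (use B(4) b in \<open>auto simp: herm_scale_left\<close>)
    also have "\<dots> = herm z b" using B(1) b by simp
    finally show "herm x b = 0" by (simp add: x_def herm_diff_left)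
  qed
  moreover obtain p where "p \<noteq> 0" "poly_act a p x = 0" using annihilating_poly by blast
  ultimately obtain v c where v: "v \<in> V" "v \<noteq> 0" "a *v v = c *s v"
    using eigenvector_of_annihilating_poly[OF sub inv] by metis
  define w where "w = of_real (1 / norm v) *s v"
  have wV: "w \<in> V" unfolding w_def using v(1) sub by (rule vec.subspace_scale[rotated])
  have ww: "herm w w = 1"
    unfolding w_def herm_scale_left herm_scale_right
    using v(2) by (simp add: herm_self power2_eq_square)
  have "a *v w = c *s w" using v(3) by (simp add: w_def vector_scalar_commute mult.commute)
  have wB: "w \<notin> B" using wV ww by (auto simp: V_def)
  have perp: "herm w b = 0" "herm b w = 0" if "b \<in> B" for b
    using wV that herm_commute[of b w] by (auto simp: V_def)
  show ?case
  proof (rule exI[of _ "insert w B"], intro conjI)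
    show "\<forall>b\<in>insert w B. \<exists>c. a *v b = c *s b" using B(3) \<open>a *v w = c *s w\<close> by blast
    show "\<forall>b\<in>insert w B. \<forall>b'\<in>insert w B. herm b b' = (if b = b' then 1 else 0)"
      using B(4) perp wB ww by (auto)
  qed (use B wB in auto)
qed

definition diag :: "('n \<Rightarrow> complex) \<Rightarrow> complex^'n^'n" where
  "diag d = (\<chi> i j. if i = j then d i else 0)"

lemma diag_mult_left_nth: "(diag d ** a) $ i $ j = d i * a $ i $ j"
proof -
  have "(diag d ** a) $ i $ j = (\<Sum>k\<in>UNIV. if k = i then d i * a $ k $ j else 0)"
    unfolding matrix_matrix_mult_def diag_def vec_lambda_beta by (rule sum.cong) auto
  then show ?thesis by simp
qed

lemma diag_mult_right_nth: "(a ** diag d) $ i $ j = a $ i $ j * d j"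
proof -
  have "(a ** diag d) $ i $ j = (\<Sum>k\<in>UNIV. if k = j then a $ i $ k * d k else 0)"
    unfolding matrix_matrix_mult_def diag_def vec_lambda_beta by (rule sum.cong) auto
  then show ?thesis by simp
qed

lemma diag_mult: "diag d ** diag e = diag (\<lambda>i. d i * e i)"
  unfolding vec_eq_iff diag_mult_left_nth by (simp add: diag_def)

lemma conj_transpose_diag: "conj_transpose (diag d) = diag (\<lambda>i. cnj (d i))"
  by (auto simp: diag_def vec_eq_iff)

lemma mat_1_eq_diag: "mat 1 = diag (\<lambda>_. 1)"
  by (simp add: diag_def mat_def)

lemma diag_eq_iff: "diag d = diag e \<longleftrightarrow> (\<forall>i. d i = e i)"
  by (auto simp: diag_def vec_eq_iff)

lemma norm_diag: "norm (diag d) = sqrt (\<Sum>i\<in>UNIV. (norm (d i))\<^sup>2)"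
proof -
  have "(norm (diag d $ i $ j))\<^sup>2 = (if i = j then (norm (d i))\<^sup>2 else 0)" for i j
    by (simp add: diag_def)
  then show ?thesis by (simp add: norm_vec_def L2_set_def sum_nonneg)
qed

text \<open>The orthonormal eigenvectors form the columns of \<open>u\<close>; then
  \<open>a ** u = u ** diag d\<close> is the eigenvalue equation column by column.\<close>

lemma normal_matrix_diagonalisable:
  fixes a :: "complex^'n^'n"
  assumes n: "a ** conj_transpose a = conj_transpose a ** a"
  obtains u d where "u \<in> unitary_group" "a = u ** diag d ** conj_transpose u"
proof -
  obtain B where B: "finite B" "card B = CARD('n)" "\<forall>b\<in>B. \<exists>c. a *v b = c *s b"
    "\<forall>b\<in>B. \<forall>b'\<in>B. herm b b' = (if b = b' then 1 else 0)"
    using normal_orthonormal_eigenvectors[OF n order_refl] by blast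
  obtain f where f: "bij_betw f (UNIV :: 'n set) B"
    using B(1,2) finite_same_card_bij[of "UNIV :: 'n set" B] by auto
  have fB: "f k \<in> B" for k using f by (auto simp: bij_betw_def)
  define u where "u = (\<chi> r k. f k $ r)"
  have "(conj_transpose u ** u) $ i $ j = (mat 1 :: complex^'n^'n) $ i $ j" for i j
  proof -
    have "(conj_transpose u ** u) $ i $ j = herm (f j) (f i)"
      by (simp add: matrix_matrix_mult_def u_def herm_def mult.commute)
    also have "\<dots> = (if f j = f i then 1 else 0)" using B(4) fB by blast
    also have "f j = f i \<longleftrightarrow> i = j" using f by (auto simp: bij_betw_def inj_on_def)
    finally show ?thesis by (simp add: mat_def)
  qed
  then have u: "u \<in> unitary_group" by (simp add: unitary_group_iff vec_eq_iff)
  have "\<forall>k. \<exists>c. a *v f k = c *s f k" using B(3) fB by blast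
  then obtain d where d: "\<forall>k. a *v f k = d k *s f k" by (rule choice[THEN exE])
  have "a ** u = u ** diag d"
  proof -
    have "(a ** u) $ r $ k = (a *v f k) $ r" for r k
      by (simp add: matrix_matrix_mult_def matrix_vector_mult_def u_def)
    moreover have "(u ** diag d) $ r $ k = (d k *s f k) $ r" for r k
      by (simp add: diag_mult_right_nth u_def)
    ultimately show ?thesis by (simp add: vec_eq_iff d)
  qed
  then have "a = u ** diag d ** conj_transpose u"
    using unitary_cancel_right(1)[OF u, of a] by simp
  then show ?thesis using u that by blast
qed

subsection \<open>One-parameter groups and logarithms\<close>

lemmas matrix_mult_add_left = bounded_bilinear.add_left[OF bounded_bilinear_matrix_mult]
lemmas matrix_mult_add_right = bounded_bilinear.add_right[OF bounded_bilinear_matrix_mult]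
lemmas matrix_mult_diff_left = bounded_bilinear.diff_left[OF bounded_bilinear_matrix_mult]
lemmas matrix_mult_diff_right = bounded_bilinear.diff_right[OF bounded_bilinear_matrix_mult]
lemmas matrix_mult_scaleR_left = bounded_bilinear.scaleR_left[OF bounded_bilinear_matrix_mult]
lemmas matrix_mult_scaleR_right = bounded_bilinear.scaleR_right[OF bounded_bilinear_matrix_mult]

lemma has_vector_derivative_matrix_mult:
  fixes f :: "real \<Rightarrow> complex^'n^'m" and g :: "real \<Rightarrow> complex^'k^'n"
  assumes "(f has_vector_derivative f') (at t within S)" "(g has_vector_derivative g') (at t within S)"
  shows "((\<lambda>t. f t ** g t) has_vector_derivative (f t ** g' + f' ** g t)) (at t within S)"
  using bounded_bilinear.FDERIV[OF bounded_bilinear_matrix_mult assms[unfolded has_vector_derivative_def]]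
  unfolding has_vector_derivative_def
  by (simp add: matrix_mult_scaleR_left matrix_mult_scaleR_right scaleR_add_right)

text \<open>A diagonal matrix is a finite sum of bounded linear images of its entries, which reduces
  the derivative to scalar ones.\<close>

lemma has_vector_derivative_diag:
  assumes "\<And>k. ((\<lambda>t. f t k) has_vector_derivative f' k) (at t within S)"
  shows "((\<lambda>t. diag (f t) :: complex^'n^'n) has_vector_derivative diag f') (at t within S)"
proof -
  define e where "e k z = (diag (\<lambda>i. if i = k then z else 0) :: complex^'n^'n)" for k z
  have lin: "bounded_linear (e k)" for k
    unfolding linear_conv_bounded_linear[symmetric] linear_iff e_def
    by (auto simp: vec_eq_iff diag_def)
  have sum: "diag d = (\<Sum>k\<in>UNIV. e k (d k))" for d
  proof -
    have "(\<Sum>k\<in>UNIV. e k (d k)) $ i $ j = (\<Sum>k\<in>UNIV. if k = i then if i = j then d k else 0 else 0)"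
      for i j unfolding sum_component e_def diag_def vec_lambda_beta by (rule sum.cong) auto
    then have "(\<Sum>k\<in>UNIV. e k (d k)) $ i $ j = diag d $ i $ j" for i j
      by (simp add: diag_def)
    then show ?thesis by (simp add: vec_eq_iff)
  qed
  show ?thesis
    unfolding sum
    by (intro has_vector_derivative_sum bounded_linear.has_vector_derivative[OF lin] assms)
qed

text \<open>Stands for s |-> exp (s A) with A skew-Hermitian, given by the properties in use: a
  unitary solution of E' = A E from the identity that commutes with A.\<close>

definition one_param :: "complex^'n^'n \<Rightarrow> (real \<Rightarrow> complex^'n^'n) \<Rightarrow> bool" where
  "one_param A E \<longleftrightarrow> E 0 = mat 1 \<and> (\<forall>s. E s \<in> unitary_group) \<and>
     (\<forall>s. A ** E s = E s ** A) \<and> (\<forall>s. (E has_vector_derivative A ** E s) (at s))"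

text \<open>The trivial group turns the two-factor estimate \<open>riemann_dist_exp_le\<close> into
  the bound for a single exponential.\<close>

lemma one_param_0: "one_param 0 (\<lambda>_. mat 1)"
  by (simp add: one_param_def)

text \<open>In an eigenbasis the group acts by the scalars exp (i s \<theta>), which have modulus 1;
  conjugation by \<open>u\<close> respects products and adjoints.\<close>

lemma one_param_diag:
  fixes u :: "complex^'n^'n"
  assumes u: "u \<in> unitary_group"
  shows "one_param (u ** diag (\<lambda>k. \<i> * of_real (\<theta> k)) ** conj_transpose u)
    (\<lambda>s. u ** diag (\<lambda>k. exp (s *\<^sub>R (\<i> * of_real (\<theta> k)))) ** conj_transpose u)"
    (is "one_param ?A ?E")
proof -
  have prod: "(u ** diag d ** conj_transpose u) ** (u ** diag e ** conj_transpose u)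
      = u ** diag (\<lambda>k. d k * e k) ** conj_transpose u" for d e
  proof -
    have "(u ** diag d ** conj_transpose u) ** (u ** diag e ** conj_transpose u)
        = u ** (diag d ** (conj_transpose u ** (u ** (diag e ** conj_transpose u))))"
      by (simp add: matrix_mul_assoc)
    then show ?thesis
      unfolding unitary_cancel_left(1)[OF u] by (simp add: matrix_mul_assoc flip: diag_mult)
  qed
  have one: "u ** diag (\<lambda>k. 1) ** conj_transpose u = mat 1"
    using u by (simp add: unitary_group_def flip: mat_1_eq_diag)
  have ct: "conj_transpose (u ** diag d ** conj_transpose u) =
      u ** diag (\<lambda>k. cnj (d k)) ** conj_transpose u" for d
    by (simp add: conj_transpose_mult conj_transpose_diag matrix_mul_assoc)
  have "?E s \<in> unitary_group" for s
  proof -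
    have "cnj (exp (s *\<^sub>R (\<i> * of_real (\<theta> k)))) * exp (s *\<^sub>R (\<i> * of_real (\<theta> k))) = 1" for k
      by (simp add: exp_cnj flip: exp_add)
    then show ?thesis unfolding unitary_group_iff ct prod by (simp add: one)
  qed
  moreover have "?A ** ?E s = ?E s ** ?A" for s
    unfolding prod by (simp add: mult.commute)
  moreover have "(?E has_vector_derivative ?A ** ?E s) (at s)" for s
  proof -
    have c: "bounded_linear (\<lambda>a. u ** a ** conj_transpose u)"
      by (intro bounded_linear_compose[OF bounded_bilinear.bounded_linear_left[OF bounded_bilinear_matrix_mult]]
         bounded_bilinear.bounded_linear_right[OF bounded_bilinear_matrix_mult])
    have "((\<lambda>s. diag (\<lambda>k. exp (s *\<^sub>R (\<i> * of_real (\<theta> k)))) :: complex^'n^'n) has_vector_derivative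
       diag (\<lambda>k. exp (s *\<^sub>R (\<i> * of_real (\<theta> k))) * (\<i> * of_real (\<theta> k)))) (at s)"
      by (intro has_vector_derivative_diag exp_scaleR_has_vector_derivative_right)
    from bounded_linear.has_vector_derivative[OF c this] show ?thesis
      unfolding prod by (simp add: mult.commute)
  qed
  ultimately show ?thesis unfolding one_param_def by (simp add: one)
qed

text \<open>A skew-Hermitian matrix is normal, and its diagonal form is skew-Hermitian too, so the
  eigenvalues are purely imaginary and \<open>one_param_diag\<close> applies.\<close>

lemma skew_one_param:
  assumes "conj_transpose A = - A"
  obtains E where "one_param A E"
proof -
  have "A ** conj_transpose A = conj_transpose A ** A"
    by (simp add: assms bounded_bilinear.minus_left[OF bounded_bilinear_matrix_mult]
        bounded_bilinear.minus_right[OF bounded_bilinear_matrix_mult])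
  then obtain u d where u: "u \<in> unitary_group" and A: "A = u ** diag d ** conj_transpose u"
    using normal_matrix_diagonalisable by blast
  have "diag d = conj_transpose u ** A ** u"
    using u by (simp add: A unitary_cancel_left unitary_cancel_right flip: matrix_mul_assoc)
      (simp add: unitary_group_def)
  then have "conj_transpose (diag d) = - diag d"
    by (simp add: conj_transpose_mult assms matrix_mul_assoc
        bounded_bilinear.minus_left[OF bounded_bilinear_matrix_mult]
        bounded_bilinear.minus_right[OF bounded_bilinear_matrix_mult])
  moreover have "- diag d = (diag (\<lambda>k. - d k) :: complex^'a^'a)"
    by (simp add: vec_eq_iff diag_def)
  ultimately have "cnj (d k) = - d k" for k
    by (simp add: conj_transpose_diag diag_eq_iff)
  then have "d k = \<i> * of_real (Im (d k))" for k
    by (simp add: complex_eq_iff)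
  then have "d = (\<lambda>k. \<i> * of_real (Im (d k)))" by blast
  then show ?thesis
    using one_param_diag[OF u, of "\<lambda>k. Im (d k)"] A that by metis
qed

text \<open>Arc against chord on the unit circle. The factor tends to 1 with the chord, which is
  what makes logarithms on a fine subdivision asymptotically as short as the chords.\<close>

lemma abs_angle_le_chord:
  assumes "\<bar>\<theta>\<bar> \<le> pi"
  shows "\<bar>\<theta>\<bar> \<le> norm (exp (\<i> * of_real \<theta>) - 1) * (1 + (norm (exp (\<i> * of_real \<theta>) - 1))\<^sup>2)"
proof -
  define x where "x = \<bar>\<theta>\<bar> / 2"
  have x: "0 \<le> x" "x \<le> pi / 2" using assms by (auto simp: x_def)
  define s where "s = sin x"
  have s0: "0 \<le> s" unfolding s_def using x by (intro sin_ge_zero) auto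
  have chord: "norm (exp (\<i> * of_real \<theta>) - 1) = 2 * s"
  proof -
    have "norm (exp (\<i> * of_real \<theta>) - 1) = 2 * \<bar>sin (\<theta> / 2)\<bar>"
      using dist_exp_i_1[of \<theta>] by simp
    also have "\<bar>sin (\<theta> / 2)\<bar> = s"
      using s0 unfolding s_def x_def by (cases "\<theta> \<ge> 0") auto
    finally show ?thesis .
  qed
  \<comment> \<open>With x half the angle and 2 s the chord, the cubic remainder first gives x <= 2
    s; reused with x^3 <= 8 s^3 it gives x <= s + 4 s^3, which is half of the claim.\<close>
  have "\<bar>sin x - (\<Sum>m<3. sin_coeff m * x ^ m)\<bar> \<le> inverse (fact 3) * \<bar>x\<bar> ^ 3"
    by (rule Maclaurin_sin_bound)
  then have "\<bar>s - x\<bar> \<le> x ^ 3 / 6"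
    using x by (simp add: sin_coeff_def numeral_eq_Suc s_def field_simps)
  then have b: "x - s \<le> x ^ 3 / 6" by linarith
  \<comment> \<open>1.6 exceeds pi / 2 and its square 2.56 is below 3, so the remainder x^3 / 6 is
    at most x / 2.\<close>
  have "x \<le> 1.6" using x pi_approx by simp
  then have "x\<^sup>2 \<le> 3"
    using x power_mono[of x "1.6" 2] by (simp add: power2_eq_square)
  then have "x ^ 3 \<le> 3 * x"
    using x mult_right_mono[of "x\<^sup>2" 3 x] by (simp add: power3_eq_cube power2_eq_square)
  then have "x \<le> 2 * s" using b by simp
  then have "x ^ 3 \<le> (2 * s) ^ 3" using x by (intro power_mono)
  also have "\<dots> = 8 * s ^ 3" by (simp add: power_mult_distrib)
  finally have "x ^ 3 \<le> 8 * s ^ 3" .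
  then have "x \<le> s + 4 * s ^ 3" using b zero_le_power[OF s0, of 3] by linarith
  moreover have "\<bar>\<theta>\<bar> = 2 * x" by (simp add: x_def)
  ultimately show ?thesis
    unfolding chord by (simp add: power2_eq_square power3_eq_cube algebra_simps)
qed

text \<open>Principal logarithm: the angles are the principal arguments of the eigenvalues. The
  three bounds serve, in this order, the diameter, the fine subdivision of a curve, and the
  comparison of the distance with the ambient norm.\<close>

lemma unitary_log:
  fixes u :: "complex^'n^'n"
  assumes "u \<in> unitary_group"
  obtains A E where "conj_transpose A = - A" "one_param A E" "E 1 = u"
    "norm A \<le> pi * sqrt (real CARD('n))"
    "norm A \<le> norm (u - mat 1) * (1 + (norm (u - mat 1))\<^sup>2)"
    "norm A \<le> 5 * norm (u - mat 1)"
proof -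
  have "u ** conj_transpose u = conj_transpose u ** u"
    using assms by (simp add: unitary_group_def)
  then obtain v d where v: "v \<in> unitary_group" and u: "u = v ** diag d ** conj_transpose v"
    using normal_matrix_diagonalisable by blast
  have "diag d = conj_transpose v ** u ** v"
    using v by (simp add: u unitary_cancel_left unitary_cancel_right flip: matrix_mul_assoc)
      (simp add: unitary_group_def)
  then have "diag d \<in> (unitary_group :: (complex^'n^'n) set)"
    using assms v by (simp add: unitary_group_mult unitary_group_conj_transpose)
  then have "diag (\<lambda>k. cnj (d k) * d k) = (diag (\<lambda>_. 1) :: complex^'n^'n)"
    by (simp add: unitary_group_iff conj_transpose_diag diag_mult mat_1_eq_diag)
  then have "cnj (d k) * d k = 1" for k unfolding diag_eq_iff by simp
  then have "(norm (d k))\<^sup>2 = 1" for k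
    using complex_norm_square[of "d k"] by (simp add: mult.commute flip: of_real_power)
  then have nd: "norm (d k) = 1" for k
    using power2_eq_iff_nonneg[of "norm (d k)" 1] by simp
  define \<theta> where "\<theta> k = Arg (d k)" for k
  have d: "d k = exp (\<i> * of_real (\<theta> k))" for k
    using Arg_eq[of "d k"] nd[of k] unfolding \<theta>_def by fastforce
  have \<theta>: "\<bar>\<theta> k\<bar> \<le> pi" for k unfolding \<theta>_def using Arg_bounded[of "d k"] by linarith
  define A where "A = v ** diag (\<lambda>k. \<i> * of_real (\<theta> k)) ** conj_transpose v"
  define E where "E s = v ** diag (\<lambda>k. exp (s *\<^sub>R (\<i> * of_real (\<theta> k)))) ** conj_transpose v" for s
  have op: "one_param A E"
    unfolding A_def E_def by (rule one_param_diag[OF v])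
  have skew: "conj_transpose A = - A"
  proof -
    have "diag (\<lambda>k. - (\<i> * of_real (\<theta> k))) = - (diag (\<lambda>k. \<i> * of_real (\<theta> k)) :: complex^'n^'n)"
      by (simp add: diag_def vec_eq_iff)
    then show ?thesis
      by (simp add: A_def conj_transpose_mult conj_transpose_diag matrix_mul_assoc
        bounded_bilinear.minus_left[OF bounded_bilinear_matrix_mult]
        bounded_bilinear.minus_right[OF bounded_bilinear_matrix_mult])
  qed
  have E1: "E 1 = u" by (simp add: E_def u flip: d)
  have nA: "norm A = L2_set (\<lambda>k. \<bar>\<theta> k\<bar>) UNIV"
    unfolding A_def norm_unitary_mult_right[OF unitary_group_conj_transpose[OF v]]
      norm_unitary_mult_left[OF v] norm_diag by (simp add: L2_set_def norm_mult)
  define N where "N = norm (u - mat 1)"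
  define s where "s k = norm (exp (\<i> * of_real (\<theta> k)) - 1)" for k
  have "u - mat 1 = v ** diag (\<lambda>k. d k - 1) ** conj_transpose v"
  proof -
    have "diag (\<lambda>k. d k - 1) = diag d - (mat 1 :: complex^'n^'n)"
      by (simp add: mat_1_eq_diag diag_def vec_eq_iff)
    moreover have "v ** conj_transpose v = mat 1" using v by (simp add: unitary_group_def)
    ultimately show ?thesis by (simp add: u matrix_mult_diff_left matrix_mult_diff_right)
  qed
  then have N: "N = L2_set s UNIV"
    unfolding N_def
    by (simp add: norm_unitary_mult_right[OF unitary_group_conj_transpose[OF v]]
      norm_unitary_mult_left[OF v] norm_diag L2_set_def d s_def)
  have s0: "0 \<le> s k" for k by (simp add: s_def)
  have sN: "s k \<le> N" for k unfolding N by (rule member_le_L2_set) auto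
  have s2: "s k \<le> 2" for k
    unfolding s_def using norm_triangle_ineq4[of "exp (\<i> * of_real (\<theta> k))" 1] by simp
  \<comment> \<open>\<open>norm A\<close> and \<open>N\<close> are the l2 norms of the angles and of
    the chords, so a uniform bound on the ratio angle to chord passes to the norms.\<close>
  have key: "norm A \<le> N * c" if "0 \<le> c" "\<And>k. 1 + (s k)\<^sup>2 \<le> c" for c
  proof -
    have "norm A \<le> L2_set (\<lambda>k. s k * c) UNIV"
      unfolding nA
    proof (rule L2_set_mono)
      fix k
      have "\<bar>\<theta> k\<bar> \<le> s k * (1 + (s k)\<^sup>2)"
        using abs_angle_le_chord[OF \<theta>[of k]] by (simp add: s_def)
      also have "\<dots> \<le> s k * c" using that(2) s0 by (intro mult_left_mono)
      finally show "\<bar>\<theta> k\<bar> \<le> s k * c" .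
    qed simp
    also have "\<dots> = N * c" using that(1) by (simp add: N L2_set_left_distrib)
    finally show ?thesis .
  qed
  have "norm A \<le> N * (1 + N\<^sup>2)"
    using sN s0 by (intro key) (auto intro: power_mono)
  moreover have "norm A \<le> 5 * N"
  proof -
    \<comment> \<open>No chord of the unit circle exceeds 2, whence 5 = 1 + 2^2.\<close>
    have "(s k)\<^sup>2 \<le> 2\<^sup>2" for k using s2 s0 by (intro power_mono)
    then show ?thesis using key[of 5] by (simp add: mult.commute)
  qed
  moreover have "norm A \<le> pi * sqrt (real CARD('n))"
  proof -
    have "norm A \<le> L2_set (\<lambda>k::'n. pi) UNIV" unfolding nA using \<theta> by (intro L2_set_mono) auto
    also have "\<dots> = pi * sqrt (real CARD('n))" by (simp add: L2_set_def real_sqrt_mult)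
    finally show ?thesis .
  qed
  ultimately show ?thesis using that skew op E1 by (simp add: N_def)
qed

subsection \<open>Lengths of piecewise smooth curves\<close>

text \<open>What length estimates use of a curve. At a corner \<open>vector_derivative\<close> is
  unspecified, hence the finite exceptional set; the notion is stable under restriction and
  concatenation.\<close>

definition has_speed :: "(real \<Rightarrow> 'a::real_normed_vector) \<Rightarrow> (real \<Rightarrow> 'a) \<Rightarrow> real \<Rightarrow> real \<Rightarrow> bool" where
  "has_speed \<gamma> G a b \<longleftrightarrow> continuous_on {a..b} \<gamma> \<and> (\<lambda>t. norm (G t)) integrable_on {a..b} \<and>
     (\<exists>S. finite S \<and> (\<forall>t\<in>{a..b} - S. (\<gamma> has_vector_derivative G t) (at t)))"

text \<open>Only one-sided derivatives are given at the end points, so these become exceptional;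
  continuity of the derivative \<open>F 1\<close> on the closed interval gives
  integrability.\<close>

lemma smooth_curve_on_has_speed:
  fixes \<gamma> :: "real \<Rightarrow> 'a::banach"
  assumes "smooth_curve_on \<gamma> {a..b}"
  shows "has_speed \<gamma> (\<lambda>t. vector_derivative \<gamma> (at t)) a b"
proof -
  obtain F where F: "\<forall>t\<in>{a..b}. F 0 t = \<gamma> t"
    "\<forall>k. \<forall>t\<in>{a..b}. (F k has_vector_derivative F (Suc k) t) (at t within {a..b})"
    using assms unfolding smooth_curve_on_def by blast
  have cont: "continuous_on {a..b} (F k)" for k
    using F(2) by (meson continuous_on_eq_continuous_within has_vector_derivative_continuous)
  have der: "(\<gamma> has_vector_derivative F 1 t) (at t)" if "t \<in> {a..b} - {a, b}" for t
  proof -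
    have t: "t \<in> {a<..<b}" using that by auto
    have "(F 0 has_vector_derivative F 1 t) (at t within {a<..<b})"
      by (rule has_vector_derivative_within_subset[of _ _ _ "{a..b}"])
        (use F(2)[rule_format, of t 0] t in auto)
    then have "(F 0 has_vector_derivative F 1 t) (at t)"
      by (rule has_vector_derivative_within_open[THEN iffD1, OF t open_greaterThanLessThan])
    then show ?thesis
      by (rule has_vector_derivative_transform_within_open[OF _ _ t]) (use F(1) in auto)
  qed
  have "continuous_on {a..b} \<gamma>"
    using continuous_on_eq[OF cont[of 0]] F(1) by blast
  moreover have "(\<lambda>t. norm (vector_derivative \<gamma> (at t))) integrable_on {a..b}"
  proof (rule integrable_spike_finite)
    show "finite {a, b}" by simp
    show "norm (vector_derivative \<gamma> (at t)) = norm (F 1 t)" if "t \<in> {a..b} - {a, b}" for t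
      using vector_derivative_at[OF der[OF that]] by simp
    show "(\<lambda>t. norm (F 1 t)) integrable_on {a..b}"
      by (intro integrable_continuous_interval continuous_on_norm cont)
  qed
  moreover have "(\<gamma> has_vector_derivative vector_derivative \<gamma> (at t)) (at t)"
    if "t \<in> {a..b} - {a, b}" for t
    using vector_derivative_at[OF der[OF that]] der[OF that] by simp
  ultimately show ?thesis unfolding has_speed_def by (meson finite.emptyI finite.insertI)
qed

lemma has_speed_combine:
  assumes "has_speed \<gamma> G a c" "has_speed \<gamma> G c b" "a \<le> c" "c \<le> b"
  shows "has_speed \<gamma> G a b"
proof -
  obtain S T where S: "finite S" "\<forall>t\<in>{a..c} - S. (\<gamma> has_vector_derivative G t) (at t)"
    and T: "finite T" "\<forall>t\<in>{c..b} - T. (\<gamma> has_vector_derivative G t) (at t)"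
    using assms unfolding has_speed_def by blast
  have u: "{a..b} = {a..c} \<union> {c..b}" using assms by auto
  have "continuous_on {a..b} \<gamma>"
    unfolding u using assms by (intro continuous_on_closed_Un) (auto simp: has_speed_def)
  moreover have "(\<lambda>t. norm (G t)) integrable_on {a..b}"
    using assms by (auto simp: has_speed_def intro: Henstock_Kurzweil_Integration.integrable_combine[of a c b])
  moreover have "\<forall>t\<in>{a..b} - (S \<union> T). (\<gamma> has_vector_derivative G t) (at t)"
    using S T unfolding u by blast
  ultimately show ?thesis using S(1) T(1) unfolding has_speed_def by (meson finite_UnI)
qed

lemma has_speed_refl: "has_speed \<gamma> G a a"
  using integrable_on_refl[of "\<lambda>t. norm (G t)" a]
  unfolding has_speed_def by (auto intro!: exI[of _ "{a}"])

lemma piecewise_smooth_curve_has_speed: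
  fixes \<gamma> :: "real \<Rightarrow> 'a::banach"
  assumes "piecewise_smooth_curve \<gamma>"
  shows "has_speed \<gamma> (\<lambda>t. vector_derivative \<gamma> (at t)) 0 1"
proof -
  obtain m :: nat and p where p: "p 0 = 0" "p m = 1"
    "\<forall>k<m. p k < p (Suc k) \<and> smooth_curve_on \<gamma> {p k..p (Suc k)}"
    using assms unfolding piecewise_smooth_curve_def by blast
  have "0 \<le> p k \<and> has_speed \<gamma> (\<lambda>t. vector_derivative \<gamma> (at t)) 0 (p k)" if "k \<le> m" for k
    using that
  proof (induction k)
    case 0
    show ?case by (simp add: p has_speed_refl)
  next
    case (Suc k)
    then have "0 \<le> p k" "has_speed \<gamma> (\<lambda>t. vector_derivative \<gamma> (at t)) 0 (p k)"
      "p k < p (Suc k)" "has_speed \<gamma> (\<lambda>t. vector_derivative \<gamma> (at t)) (p k) (p (Suc k))"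
      using p(3) by (auto intro: smooth_curve_on_has_speed)
    then show ?case by (auto intro: has_speed_combine[of _ _ 0 "p k"])
  qed
  from this[of m] show ?thesis by (simp add: p)
qed

text \<open>Finite sets are negligible, so any velocity field that is correct off such a set
  computes the length.\<close>

lemma has_speed_hs_length:
  assumes "has_speed \<gamma> G 0 1"
  shows "hs_length \<gamma> = integral {0..1} (\<lambda>t. norm (G t))"
proof -
  obtain S where S: "finite S" "\<forall>t\<in>{0..1} - S. (\<gamma> has_vector_derivative G t) (at t)"
    using assms unfolding has_speed_def by blast
  have "integral {0..1} (\<lambda>t. norm (G t)) = hs_length \<gamma>"
    unfolding hs_length_def hs_norm_eq_norm
  proof (rule integral_spike[of S])
    show "norm (vector_derivative \<gamma> (at t)) = norm (G t)" if "t \<in> {0..1} - S" for t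
      using S(2) that by (metis vector_derivative_at)
  qed (simp add: S(1) negligible_finite)
  then show ?thesis by simp
qed

lemma has_speed_subinterval:
  assumes "has_speed \<gamma> G a b" "a \<le> c" "d \<le> b"
  shows "has_speed \<gamma> G c d"
proof -
  have "{c..d} \<subseteq> {a..b}" using assms by auto
  then show ?thesis
    using assms(1) unfolding has_speed_def
    by (auto intro: continuous_on_subset integrable_subinterval_real)
qed

text \<open>Fundamental theorem of calculus with finitely many exceptional points.\<close>

lemma chord_le_length:
  fixes \<gamma> :: "real \<Rightarrow> 'a::euclidean_space"
  assumes "has_speed \<gamma> G a b" "a \<le> b"
  shows "norm (\<gamma> b - \<gamma> a) \<le> integral {a..b} (\<lambda>t. norm (G t))"
proof -
  obtain S where S: "finite S" "\<forall>t\<in>{a..b} - S. (\<gamma> has_vector_derivative G t) (at t)"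
    using assms unfolding has_speed_def by blast
  have "(G has_integral (\<gamma> b - \<gamma> a)) {a..b}"
    using assms S by (intro fundamental_theorem_of_calculus_strong[of S]) (auto simp: has_speed_def)
  moreover have "norm (integral {a..b} G) \<le> integral {a..b} (\<lambda>t. norm (G t))"
    using calculation assms(1)
    by (intro Henstock_Kurzweil_Integration.integral_norm_bound_integral)
      (auto simp: has_speed_def)
  ultimately show ?thesis by (simp add: integral_unique)
qed

lemma smooth_curve_on_affine:
  assumes "smooth_curve_on \<gamma> {a..b}" and "m > 0"
    and "\<And>t. t \<in> {c..d} \<Longrightarrow> m * t + q \<in> {a..b}"
    and "\<And>t. t \<in> {c..d} \<Longrightarrow> \<delta> t = \<gamma> (m * t + q)"
  shows "smooth_curve_on \<delta> {c..d}"
proof -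
  obtain F where F: "\<forall>t\<in>{a..b}. F 0 t = \<gamma> t"
    "\<forall>k. \<forall>t\<in>{a..b}. (F k has_vector_derivative F (Suc k) t) (at t within {a..b})"
    using assms(1) unfolding smooth_curve_on_def by blast
  \<comment> \<open>Each differentiation contributes one chain-rule factor m.\<close>
  have "((\<lambda>t. m ^ k *\<^sub>R F k (m * t + q)) has_vector_derivative
      m ^ Suc k *\<^sub>R F (Suc k) (m * t + q)) (at t within {c..d})" if t: "t \<in> {c..d}" for k t
  proof -
    have "((\<lambda>t. m * t + q) has_vector_derivative m) (at t within {c..d})"
      by (auto intro!: derivative_eq_intros simp: has_real_derivative_iff_has_vector_derivative[symmetric])
    moreover have "(F k has_vector_derivative F (Suc k) (m * t + q))
        (at (m * t + q) within (\<lambda>t. m * t + q) ` {c..d})"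
      using F(2) assms(3) t by (blast intro: has_vector_derivative_within_subset)
    ultimately have "((F k \<circ> (\<lambda>t. m * t + q)) has_vector_derivative m *\<^sub>R F (Suc k) (m * t + q))
        (at t within {c..d})" by (rule vector_diff_chain_within)
    from has_vector_derivative_scaleR[OF has_real_derivative_iff_has_vector_derivative[THEN iffD2, OF has_vector_derivative_const] this, of "m ^ k"]
    show ?thesis by (simp add: o_def mult.commute)
  qed
  then show ?thesis
    unfolding smooth_curve_on_def
    by (intro exI[of _ "\<lambda>k t. m ^ k *\<^sub>R F k (m * t + q)"]) (use F(1) assms(3,4) in auto)
qed

lemma piecewise_smooth_curve_joinpaths:
  assumes "piecewise_smooth_curve \<gamma>1" "piecewise_smooth_curve \<gamma>2" "\<gamma>1 1 = \<gamma>2 0"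
  shows "piecewise_smooth_curve (\<gamma>1 +++ \<gamma>2)"
proof -
  obtain m :: nat and p where p: "p 0 = 0" "p m = 1"
    "\<forall>k<m. p k < p (Suc k) \<and> smooth_curve_on \<gamma>1 {p k..p (Suc k)}"
    using assms(1) unfolding piecewise_smooth_curve_def by blast
  obtain n :: nat and q where q: "q 0 = 0" "q n = 1"
    "\<forall>k<n. q k < q (Suc k) \<and> smooth_curve_on \<gamma>2 {q k..q (Suc k)}"
    using assms(2) unfolding piecewise_smooth_curve_def by blast
  have ple: "p k \<le> 1" if "k \<le> m" for k
  proof -
    have "p k \<le> p (k + j)" if "k + j \<le> m" for j
      using that by (induction j) (use p(3) in \<open>auto simp: less_imp_le intro: order_trans\<close>)
    from this[of "m - k"] that show ?thesis by (simp add: p)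
  qed
  have qge: "0 \<le> q k" if "k \<le> n" for k
    using that by (induction k) (use q in \<open>auto simp: less_imp_le intro: order_trans\<close>)
  \<comment> \<open>Both formulas give 1/2 at index m, so the two subdivisions share the junction
    instead of repeating it.\<close>
  define r where "r k = (if k \<le> m then p k / 2 else (1 + q (k - m)) / 2)" for k
  show ?thesis
    unfolding piecewise_smooth_curve_def
  proof (intro exI conjI allI impI)
    show "r 0 = 0" by (simp add: r_def p)
    show "r (m + n) = 1" by (cases "n = 0") (use p q in \<open>auto simp: r_def\<close>)
    fix k assume k: "k < m + n"
    show "r k < r (Suc k)"
    proof (cases "k < m")
      case True
      then show ?thesis using p(3) by (simp add: r_def)
    next
      case False
      then have "q (k - m) < q (Suc (k - m))" using k q(3) by simp
      then show ?thesis using False p q by (auto simp: r_def Suc_diff_le le_less)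
    qed
    show "smooth_curve_on (\<gamma>1 +++ \<gamma>2) {r k..r (Suc k)}"
    proof (cases "k < m")
      case True
      then have "smooth_curve_on \<gamma>1 {p k..p (Suc k)}" using p(3) by simp
      then show ?thesis
      proof (rule smooth_curve_on_affine[where m = 2 and q = 0])
        fix t assume t: "t \<in> {r k..r (Suc k)}"
        then show "2 * t + 0 \<in> {p k..p (Suc k)}" using True by (auto simp: r_def)
        then show "(\<gamma>1 +++ \<gamma>2) t = \<gamma>1 (2 * t + 0)"
          using ple[of "Suc k"] True by (auto simp: joinpaths_def)
      qed simp
    next
      case False
      define l where "l = k - m"
      have l: "k = m + l" "l < n" using False k by (auto simp: l_def)
      have rl: "r (m + i) = (1 + q i) / 2" for i
        using p q by (cases i) (auto simp: r_def)
      have r: "r k = (1 + q l) / 2" "r (Suc k) = (1 + q (Suc l)) / 2"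
        using rl[of l] rl[of "Suc l"] by (simp_all add: l(1))
      have "smooth_curve_on \<gamma>2 {q l..q (Suc l)}" using q(3) l by simp
      then show ?thesis
      proof (rule smooth_curve_on_affine[where m = 2 and q = "-1"])
        fix t assume t: "t \<in> {r k..r (Suc k)}"
        then show *: "2 * t + - 1 \<in> {q l..q (Suc l)}" by (auto simp: r field_simps)
        \<comment> \<open>At t = 1/2 \<open>joinpaths\<close> still follows the first path; the
          matching condition identifies the two values there.\<close>
        then show "(\<gamma>1 +++ \<gamma>2) t = \<gamma>2 (2 * t + - 1)"
          using qge[of l] l assms(3) by (auto simp: joinpaths_def) (smt (verit))
      qed simp
    qed
  qed
qed

text \<open>On either half the doubled speed cancels against the halved interval.\<close>

lemma hs_length_joinpaths:
  fixes \<gamma>1 \<gamma>2 :: "real \<Rightarrow> complex^'n^'n"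
  assumes "piecewise_smooth_curve \<gamma>1" "piecewise_smooth_curve \<gamma>2" "\<gamma>1 1 = \<gamma>2 0"
  shows "hs_length (\<gamma>1 +++ \<gamma>2) = hs_length \<gamma>1 + hs_length \<gamma>2"
proof -
  define G where "G = (\<lambda>t. vector_derivative (\<gamma>1 +++ \<gamma>2) (at t))"
  define G1 where "G1 = (\<lambda>t. vector_derivative \<gamma>1 (at t))"
  define G2 where "G2 = (\<lambda>t. vector_derivative \<gamma>2 (at t))"
  have sp: "has_speed (\<gamma>1 +++ \<gamma>2) G 0 1"
    using assms unfolding G_def by (intro piecewise_smooth_curve_has_speed piecewise_smooth_curve_joinpaths)
  have sp1: "has_speed \<gamma>1 G1 0 1" and sp2: "has_speed \<gamma>2 G2 0 1"
    using assms unfolding G1_def G2_def by (auto intro: piecewise_smooth_curve_has_speed)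
  obtain S where S: "finite S" "\<forall>t\<in>{0..1} - S. (\<gamma>1 has_vector_derivative G1 t) (at t)"
    using sp1 unfolding has_speed_def by blast
  obtain T where T: "finite T" "\<forall>t\<in>{0..1} - T. (\<gamma>2 has_vector_derivative G2 t) (at t)"
    using sp2 unfolding has_speed_def by blast
  have aff: "((\<lambda>t. m * t + q) has_vector_derivative m) (at t)" for m q t :: real
    by (auto intro!: derivative_eq_intros simp: has_real_derivative_iff_has_vector_derivative[symmetric])
  have 1: "((\<lambda>t. norm (G t)) has_integral hs_length \<gamma>1) {0..1/2}"
  proof (rule has_integral_spike_finite)
    \<comment> \<open>Excluded are the junction, where the path may have a corner, and the rescaled
      exceptional points of the first path.\<close>
    show "finite (insert (1/2) ((\<lambda>t. t / 2) ` S))" using S by simp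
    show "norm (G t) = 2 * norm (G1 (2 * t + 0))" if "t \<in> {0..1/2} - insert (1/2) ((\<lambda>t. t / 2) ` S)" for t
    proof -
      have "2 * t \<in> S \<Longrightarrow> t \<in> (\<lambda>t. t / 2) ` S" by (rule image_eqI[of _ _ "2 * t"]) auto
      then have "2 * t + 0 \<in> {0..1} - S" using that by auto
      from vector_diff_chain_at[OF aff S(2)[rule_format, OF this]]
      have "((\<gamma>1 +++ \<gamma>2) has_vector_derivative 2 *\<^sub>R G1 (2 * t + 0)) (at t)"
        by (rule has_vector_derivative_transform_within_open[of _ _ _ "{..<1/2}"])
          (use that in \<open>auto simp: joinpaths_def\<close>)
      then show ?thesis unfolding G_def by (simp add: vector_derivative_at)
    qed
    have "((\<lambda>t. norm (G1 t)) has_integral hs_length \<gamma>1) (cbox 0 1)"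
      using sp1 has_speed_hs_length[OF sp1] by (auto simp: has_speed_def has_integral_iff)
    note h = has_integral_mult_right[OF has_integral_affinity'[OF this, of 2 0], of 2]
    have "2 * (hs_length \<gamma>1 /\<^sub>R 2 ^ DIM(real)) = hs_length \<gamma>1"
      "cbox ((0 - 0) /\<^sub>R 2) ((1 - 0) /\<^sub>R 2) = {0..1/2::real}" by auto
    with h show "((\<lambda>t. 2 * norm (G1 (2 * t + 0))) has_integral hs_length \<gamma>1) {0..1/2}"
      by (simp only: real_scaleR_def)
  qed
  have 2: "((\<lambda>t. norm (G t)) has_integral hs_length \<gamma>2) {1/2..1}"
  proof (rule has_integral_spike_finite)
    show "finite (insert (1/2) ((\<lambda>t. (t + 1) / 2) ` T))" using T by simp
    show "norm (G t) = 2 * norm (G2 (2 * t + - 1))"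
      if "t \<in> {1/2..1} - insert (1/2) ((\<lambda>t. (t + 1) / 2) ` T)" for t
    proof -
      have "2 * t + - 1 \<in> T \<Longrightarrow> t \<in> (\<lambda>t. (t + 1) / 2) ` T"
        by (rule image_eqI[of _ _ "2 * t + - 1"]) auto
      then have "2 * t + - 1 \<in> {0..1} - T" using that by auto
      from vector_diff_chain_at[OF aff T(2)[rule_format, OF this]]
      have "((\<gamma>1 +++ \<gamma>2) has_vector_derivative 2 *\<^sub>R G2 (2 * t + - 1)) (at t)"
        by (rule has_vector_derivative_transform_within_open[of _ _ _ "{1/2<..}"])
          (use that in \<open>auto simp: joinpaths_def\<close>)
      then show ?thesis unfolding G_def by (simp add: vector_derivative_at)
    qed
    have "((\<lambda>t. norm (G2 t)) has_integral hs_length \<gamma>2) (cbox 0 1)"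
      using sp2 has_speed_hs_length[OF sp2] by (auto simp: has_speed_def has_integral_iff)
    note h = has_integral_mult_right[OF has_integral_affinity'[OF this, of 2 "- 1"], of 2]
    have "2 * (hs_length \<gamma>2 /\<^sub>R 2 ^ DIM(real)) = hs_length \<gamma>2"
      "cbox ((0 - - 1) /\<^sub>R 2) ((1 - - 1) /\<^sub>R 2) = {1/2..1::real}" by auto
    with h show "((\<lambda>t. 2 * norm (G2 (2 * t + - 1))) has_integral hs_length \<gamma>2) {1/2..1}"
      by (simp only: real_scaleR_def)
  qed
  have "((\<lambda>t. norm (G t)) has_integral hs_length \<gamma>1 + hs_length \<gamma>2) {0..1}"
    by (rule has_integral_combine[OF _ _ 1 2]) auto
  then show ?thesis by (simp add: has_speed_hs_length[OF sp] integral_unique)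
qed

subsection \<open>The Riemannian distance\<close>

lemma hs_length_nonneg:
  assumes "piecewise_smooth_curve \<gamma>"
  shows "0 \<le> hs_length \<gamma>"
proof -
  note sp = piecewise_smooth_curve_has_speed[OF assms]
  then show ?thesis
    unfolding has_speed_hs_length[OF sp] has_speed_def
    by (intro Henstock_Kurzweil_Integration.integral_nonneg) auto
qed

lemma riemann_dist_le_hs_length:
  assumes "piecewise_smooth_curve \<gamma>" "\<gamma> ` {0..1} \<subseteq> unitary_group" "\<gamma> 0 = a" "\<gamma> 1 = b"
  shows "riemann_dist a b \<le> hs_length \<gamma>"
  unfolding riemann_dist_def
  by (rule cInf_lower) (use assms in \<open>auto intro!: bdd_belowI[of _ 0] hs_length_nonneg\<close>)

text \<open>The curve exp (s B) exp (s A) x has velocity exp (s B) (A + B) exp (s A) x, of constant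
  norm |A + B| even for non-commuting A and B. Taking for B the negative of a block of A gives the
  gain on one piece of a broken geodesic.\<close>

lemma riemann_dist_exp_le:
  fixes A B x :: "complex^'n^'n"
  assumes A: "one_param A E" and B: "one_param B F" and x: "x \<in> unitary_group"
  shows "riemann_dist x (F 1 ** E 1 ** x) \<le> norm (A + B)"
proof -
  define \<gamma> where "\<gamma> s = F s ** E s ** x" for s
  \<comment> \<open>Smoothness asks for derivatives of every order. The one of order k is F(s) M_k
    E(s) x, and as F commutes with B, one more derivative turns M_k into B M_k + M_k A.\<close>
  define M where "M = rec_nat (mat 1) (\<lambda>_ m. B ** m + m ** A)"
  have M0: "M 0 = mat 1" and MS: "M (Suc k) = B ** M k + M k ** A" for k
    by (simp_all add: M_def)
  have E: "(E has_vector_derivative A ** E s) (at s within S)" "E s \<in> unitary_group" "E 0 = mat 1" for s S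
    using A by (auto simp: one_param_def intro: has_vector_derivative_at_within)
  have F: "(F has_vector_derivative B ** F s) (at s within S)" "F s \<in> unitary_group" "F 0 = mat 1"
    "B ** F s = F s ** B" for s S
    using B by (auto simp: one_param_def intro: has_vector_derivative_at_within)
  have der: "((\<lambda>s. F s ** M k ** E s ** x) has_vector_derivative F s ** M (Suc k) ** E s ** x)
      (at s within S)" for k s S
  proof -
    have "((\<lambda>s. F s ** M k ** E s ** x) has_vector_derivative
        (F s ** M k ** E s) ** 0 + (F s ** M k ** (A ** E s) + (F s ** 0 + (B ** F s) ** M k) ** E s) ** x)
        (at s within S)"
      by (intro has_vector_derivative_matrix_mult E F has_vector_derivative_const)
    also have "(F s ** M k ** E s) ** 0 + (F s ** M k ** (A ** E s) + (F s ** 0 + (B ** F s) ** M k) ** E s) ** x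
        = F s ** M (Suc k) ** E s ** x"
      unfolding F(4) MS
      by (simp add: matrix_mult_add_left matrix_mult_add_right matrix_mul_assoc)
    finally show ?thesis .
  qed
  have pw: "piecewise_smooth_curve \<gamma>"
    unfolding piecewise_smooth_curve_def smooth_curve_on_def
    by (rule exI[of _ 1], rule exI[of _ real])
      (auto simp: \<gamma>_def M0 intro!: der exI[of _ "\<lambda>k s. F s ** M k ** E s ** x"])
  have "\<gamma> ` {0..1} \<subseteq> unitary_group"
    using E(2) F(2) x by (auto simp: \<gamma>_def intro: unitary_group_mult)
  moreover have "\<gamma> 0 = x" by (simp add: \<gamma>_def E(3) F(3))
  ultimately have "riemann_dist x (F 1 ** E 1 ** x) \<le> hs_length \<gamma>"
    by (intro riemann_dist_le_hs_length pw) (simp_all add: \<gamma>_def)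
  also have "hs_length \<gamma> = norm (A + B)"
  proof -
    have "vector_derivative \<gamma> (at s) = F s ** (B + A) ** E s ** x" for s
      using der[of 0 s UNIV] by (intro vector_derivative_at) (simp add: \<gamma>_def[abs_def] M0 MS)
    then show ?thesis
      by (simp add: hs_length_def hs_norm_eq_norm norm_unitary_mult_left[OF F(2)]
          norm_unitary_mult_right[OF E(2)] norm_unitary_mult_right[OF x] add.commute)
  qed
  finally show ?thesis .
qed

text \<open>Right translation by \<open>x\<close> preserves the norm, so the logarithm of
  \<open>y ** conj_transpose x\<close> is bounded in terms of y - x.\<close>

lemma unitary_log_between:
  fixes x y :: "complex^'n^'n"
  assumes x: "x \<in> unitary_group" and y: "y \<in> unitary_group"
  obtains A E where "conj_transpose A = - A" "one_param A E" "E 1 ** x = y"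
    "norm A \<le> pi * sqrt (real CARD('n))" "norm A \<le> norm (y - x) * (1 + (norm (y - x))\<^sup>2)"
    "norm A \<le> 5 * norm (y - x)"
proof -
  have "norm ((y ** conj_transpose x - mat 1) ** x) = norm (y ** conj_transpose x - mat 1)"
    by (rule norm_unitary_mult_right[OF x])
  then have *: "norm (y ** conj_transpose x - mat 1) = norm (y - x)"
    by (simp add: matrix_mult_diff_left unitary_cancel_right x)
  have "y ** conj_transpose x \<in> unitary_group"
    using x y by (simp add: unitary_group_mult unitary_group_conj_transpose)
  from unitary_log[OF this, unfolded *] obtain A E where
    "conj_transpose A = - A" "one_param A E" "E 1 = y ** conj_transpose x"
    "norm A \<le> pi * sqrt (real CARD('n))" "norm A \<le> norm (y - x) * (1 + (norm (y - x))\<^sup>2)"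
    "norm A \<le> 5 * norm (y - x)" by blast
  then show ?thesis using that x by (simp add: unitary_cancel_right)
qed

lemma riemann_dist_log_le:
  assumes "one_param A E" "x \<in> unitary_group"
  shows "riemann_dist x (E 1 ** x) \<le> norm A"
  using riemann_dist_exp_le[OF assms(1) one_param_0 assms(2)] by simp

lemma riemann_dist_le_diameter:
  fixes x y :: "complex^'n^'n"
  assumes "x \<in> unitary_group" "y \<in> unitary_group"
  shows "riemann_dist x y \<le> pi * sqrt (real CARD('n))"
proof -
  obtain A E where A: "one_param A E" "E 1 ** x = y" "norm A \<le> pi * sqrt (real CARD('n))"
    using unitary_log_between[OF assms] by metis
  show ?thesis using riemann_dist_log_le[OF A(1) assms(1)] A by simp
qed

text \<open>With the triangle inequality this makes the distance Lipschitz for the ambient norm,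
  whence continuity and Borel measurability of the cost.\<close>

lemma riemann_dist_le_norm:
  fixes x y :: "complex^'n^'n"
  assumes "x \<in> unitary_group" "y \<in> unitary_group"
  shows "riemann_dist x y \<le> 5 * norm (y - x)"
proof -
  obtain A E where A: "one_param A E" "E 1 ** x = y" "norm A \<le> 5 * norm (y - x)"
    using unitary_log_between[OF assms] by metis
  show ?thesis using riemann_dist_log_le[OF A(1) assms(1)] A by simp
qed

text \<open>The infimum in \<open>riemann_dist\<close> is over a nonempty set; on the reals
  \<open>Inf\<close> of the empty set would carry no information.\<close>

lemma admissible_curve_exists:
  fixes x y :: "complex^'n^'n"
  assumes x: "x \<in> unitary_group" and y: "y \<in> unitary_group"
  shows "\<exists>\<gamma>. piecewise_smooth_curve \<gamma> \<and> \<gamma> ` {0..1} \<subseteq> unitary_group \<and> \<gamma> 0 = x \<and> \<gamma> 1 = y"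
proof -
  obtain A E where A: "one_param A E" "E 1 ** x = y" using unitary_log_between[OF x y] by metis
  define M where "M = rec_nat (mat 1) (\<lambda>_ m. m ** A)"
  have der: "((\<lambda>s. M k ** E s ** x) has_vector_derivative M (Suc k) ** E s ** x) (at s within S)" for k s S
  proof -
    have "(E has_vector_derivative A ** E s) (at s within S)"
      using A by (auto simp: one_param_def intro: has_vector_derivative_at_within)
    then have "((\<lambda>s. M k ** E s ** x) has_vector_derivative
        (M k ** E s) ** 0 + (M k ** (A ** E s) + 0 ** E s) ** x) (at s within S)"
      by (intro has_vector_derivative_matrix_mult has_vector_derivative_const)
    then show ?thesis by (simp add: M_def matrix_mul_assoc)
  qed
  have "piecewise_smooth_curve (\<lambda>s. E s ** x)"
    unfolding piecewise_smooth_curve_def smooth_curve_on_def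
    by (rule exI[of _ 1], rule exI[of _ real])
      (auto simp: M_def intro!: der exI[of _ "\<lambda>k s. M k ** E s ** x"])
  then show ?thesis
    using A x by (intro exI[of _ "\<lambda>s. E s ** x"]) (auto simp: one_param_def intro: unitary_group_mult)
qed

lemma riemann_dist_approx:
  fixes x y :: "complex^'n^'n"
  assumes "x \<in> unitary_group" "y \<in> unitary_group" "e > 0"
  obtains \<gamma> where "piecewise_smooth_curve \<gamma>" "\<gamma> ` {0..1} \<subseteq> unitary_group" "\<gamma> 0 = x" "\<gamma> 1 = y"
    "hs_length \<gamma> < riemann_dist x y + e"
proof -
  let ?S = "{hs_length \<gamma> |\<gamma>. piecewise_smooth_curve \<gamma> \<and> \<gamma> ` {0..1} \<subseteq> unitary_group \<and> \<gamma> 0 = x \<and> \<gamma> 1 = y}"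
  have "?S \<noteq> {}" using admissible_curve_exists[OF assms(1,2)] by blast
  moreover have "Inf ?S < riemann_dist x y + e" using assms(3) by (simp add: riemann_dist_def)
  ultimately have "\<exists>l\<in>?S. l < riemann_dist x y + e" by (rule cInf_lessD)
  then show ?thesis using that by blast
qed

lemma riemann_dist_nonneg:
  fixes x y :: "complex^'n^'n"
  assumes "x \<in> unitary_group" "y \<in> unitary_group"
  shows "0 \<le> riemann_dist x y"
  unfolding riemann_dist_def
  by (rule cInf_greatest) (use admissible_curve_exists[OF assms] in \<open>auto intro: hs_length_nonneg\<close>)

lemma riemann_dist_triangle:
  fixes x y z :: "complex^'n^'n"
  assumes x: "x \<in> unitary_group" and y: "y \<in> unitary_group" and z: "z \<in> unitary_group"
  shows "riemann_dist x z \<le> riemann_dist x y + riemann_dist y z"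
proof (rule field_le_epsilon)
  fix e :: real assume "0 < e"
  then have e: "e / 2 > 0" by simp
  obtain \<gamma> where \<gamma>: "piecewise_smooth_curve \<gamma>" "\<gamma> ` {0..1} \<subseteq> unitary_group" "\<gamma> 0 = x" "\<gamma> 1 = y"
    "hs_length \<gamma> < riemann_dist x y + e / 2" by (rule riemann_dist_approx[OF x y e])
  obtain \<delta> where \<delta>: "piecewise_smooth_curve \<delta>" "\<delta> ` {0..1} \<subseteq> unitary_group" "\<delta> 0 = y" "\<delta> 1 = z"
    "hs_length \<delta> < riemann_dist y z + e / 2" by (rule riemann_dist_approx[OF y z e])
  have "(\<gamma> +++ \<delta>) t \<in> unitary_group" if "t \<in> {0..1}" for t
    using \<gamma>(2) \<delta>(2) that by (auto simp: joinpaths_def image_subset_iff)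
  then have "riemann_dist x z \<le> hs_length (\<gamma> +++ \<delta>)"
    using \<gamma> \<delta> by (intro riemann_dist_le_hs_length piecewise_smooth_curve_joinpaths)
      (auto simp: joinpaths_def)
  also have "\<dots> = hs_length \<gamma> + hs_length \<delta>" using \<gamma> \<delta> by (intro hs_length_joinpaths) auto
  finally show "riemann_dist x z \<le> riemann_dist x y + riemann_dist y z + e"
    using \<gamma>(5) \<delta>(5) by simp
qed

text \<open>Left translation by a unitary matrix is linear and norm preserving, so it takes
  admissible curves to admissible curves of the same length.\<close>

lemma riemann_dist_mult_left_le:
  fixes a b g :: "complex^'n^'n"
  assumes g: "g \<in> unitary_group" and a: "a \<in> unitary_group" and b: "b \<in> unitary_group"
  shows "riemann_dist (g ** a) (g ** b) \<le> riemann_dist a b"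
proof (rule field_le_epsilon)
  fix e :: real assume e: "0 < e"
  obtain \<gamma> where \<gamma>: "piecewise_smooth_curve \<gamma>" "\<gamma> ` {0..1} \<subseteq> unitary_group" "\<gamma> 0 = a" "\<gamma> 1 = b"
    "hs_length \<gamma> < riemann_dist a b + e" by (rule riemann_dist_approx[OF a b e])
  let ?\<delta> = "\<lambda>t. g ** \<gamma> t"
  have lin: "bounded_linear (\<lambda>a. g ** a)"
    by (rule bounded_bilinear.bounded_linear_right[OF bounded_bilinear_matrix_mult])
  have smooth: "smooth_curve_on ?\<delta> S" if S: "smooth_curve_on \<gamma> S" for S
  proof -
    obtain F where F: "\<forall>t\<in>S. F 0 t = \<gamma> t"
      "\<forall>k. \<forall>t\<in>S. (F k has_vector_derivative F (Suc k) t) (at t within S)"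
      using S unfolding smooth_curve_on_def by blast
    show ?thesis
      unfolding smooth_curve_on_def
      by (rule exI[of _ "\<lambda>k t. g ** F k t"])
        (use F in \<open>auto intro: bounded_linear.has_vector_derivative[OF lin]\<close>)
  qed
  have pw: "piecewise_smooth_curve ?\<delta>"
    using \<gamma>(1) smooth unfolding piecewise_smooth_curve_def by blast
  have sp: "has_speed \<gamma> (\<lambda>t. vector_derivative \<gamma> (at t)) 0 1"
    using \<gamma>(1) by (rule piecewise_smooth_curve_has_speed)
  then have "has_speed ?\<delta> (\<lambda>t. g ** vector_derivative \<gamma> (at t)) 0 1"
    unfolding has_speed_def norm_unitary_mult_left[OF g]
    by (auto intro!: bounded_linear.continuous_on[OF lin] intro: bounded_linear.has_vector_derivative[OF lin])
  then have len: "hs_length ?\<delta> = hs_length \<gamma>"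
    using has_speed_hs_length[OF sp] by (simp add: has_speed_hs_length norm_unitary_mult_left[OF g])
  have "riemann_dist (g ** a) (g ** b) \<le> hs_length ?\<delta>"
    using \<gamma> g by (intro riemann_dist_le_hs_length pw) (auto intro: unitary_group_mult)
  then show "riemann_dist (g ** a) (g ** b) \<le> riemann_dist a b + e"
    using \<gamma>(5) len by simp
qed

text \<open>The inequality for \<open>g\<close> and for its inverse. It is the reason why moving
  both copies by one rotation leaves their distance unchanged.\<close>

lemma riemann_dist_mult_left:
  fixes a b g :: "complex^'n^'n"
  assumes g: "g \<in> unitary_group" and a: "a \<in> unitary_group" and b: "b \<in> unitary_group"
  shows "riemann_dist (g ** a) (g ** b) = riemann_dist a b"
  using riemann_dist_mult_left_le[OF g a b]
    riemann_dist_mult_left_le[OF unitary_group_conj_transpose[OF g] unitary_group_mult[OF g a]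
      unitary_group_mult[OF g b]]
  by (simp add: unitary_cancel_left g)

lemma riemann_dist_lipschitz:
  fixes x y x' y' :: "complex^'n^'n"
  assumes "x \<in> unitary_group" "y \<in> unitary_group" "x' \<in> unitary_group" "y' \<in> unitary_group"
  shows "\<bar>riemann_dist x y - riemann_dist x' y'\<bar> \<le> 5 * norm (x - x') + 5 * norm (y - y')"
proof -
  have "riemann_dist a b \<le> riemann_dist a' b' + 5 * norm (a - a') + 5 * norm (b - b')"
    if "a \<in> unitary_group" "b \<in> unitary_group" "a' \<in> unitary_group" "b' \<in> unitary_group"
    for a b a' b' :: "complex^'n^'n"
    using riemann_dist_triangle[of a a' b] riemann_dist_triangle[of a' b' b]
      riemann_dist_le_norm[of a a'] riemann_dist_le_norm[of b' b] that
    by (simp add: norm_minus_commute[of a' a])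
  from this[of x y x' y'] this[of x' y' x y] show ?thesis
    using assms by (auto simp: norm_minus_commute[of x' x] norm_minus_commute[of y' y])
qed

lemma continuous_on_riemann_dist:
  "continuous_on (unitary_group \<times> unitary_group)
     (\<lambda>z. riemann_dist (fst z) (snd z :: complex^'n^'n))"
proof -
  have "10-lipschitz_on (unitary_group \<times> unitary_group)
     (\<lambda>z. riemann_dist (fst z) (snd z :: complex^'n^'n))"
  proof (rule lipschitz_onI)
    fix z w :: "(complex^'n^'n) \<times> (complex^'n^'n)"
    assume zw: "z \<in> unitary_group \<times> unitary_group" "w \<in> unitary_group \<times> unitary_group"
    have "norm (fst z - fst w) \<le> dist z w" "norm (snd z - snd w) \<le> dist z w"
      using dist_fst_le[of z w] dist_snd_le[of z w] by (simp_all add: dist_norm)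
    then show "dist (riemann_dist (fst z) (snd z)) (riemann_dist (fst w) (snd w)) \<le> 10 * dist z w"
      using riemann_dist_lipschitz[of "fst z" "snd z" "fst w" "snd w"] zw
      unfolding dist_real_def by (auto simp: mem_Times_iff)
  qed simp
  then show ?thesis by (rule lipschitz_on_continuous_on)
qed

text \<open>On a fine subdivision of a nearly minimal curve the logarithms are hardly longer than the
  chords, and the chords are no longer than the curve; so it is not needed that geodesics
  minimise length.\<close>

lemma exp_chain:
  fixes x y :: "complex^'n^'n"
  assumes x: "x \<in> unitary_group" and y: "y \<in> unitary_group" and e: "e > 0"
  obtains m :: nat and X A E where "X 0 = x" "X m = y" "\<And>k. k \<le> m \<Longrightarrow> X k \<in> unitary_group"
    "\<And>k. k < m \<Longrightarrow> conj_transpose (A k) = - A k" "\<And>k. k < m \<Longrightarrow> one_param (A k) (E k)"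
    "\<And>k. k < m \<Longrightarrow> E k 1 ** X k = X (Suc k)" "(\<Sum>k<m. norm (A k)) \<le> riemann_dist x y + e"
proof -
  let ?D = "riemann_dist x y"
  have D0: "0 \<le> ?D" using x y by (rule riemann_dist_nonneg)
  obtain \<gamma> where \<gamma>: "piecewise_smooth_curve \<gamma>" "\<gamma> ` {0..1} \<subseteq> unitary_group" "\<gamma> 0 = x" "\<gamma> 1 = y"
    "hs_length \<gamma> < ?D + e / 2" using riemann_dist_approx[OF x y, of "e / 2"] e by auto
  define G where "G = (\<lambda>t. vector_derivative \<gamma> (at t))"
  have sp: "has_speed \<gamma> G 0 1"
    unfolding G_def using \<gamma>(1) by (rule piecewise_smooth_curve_has_speed)
  \<comment> \<open>Solves (1 + \<eta>) (D + e/2) = D + e, where D + e/2 bounds the length of the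
    curve: the relative excess that logarithms may have over chords.\<close>
  define \<eta> where "\<eta> = (e / 2) / (?D + e / 2)"
  have \<eta>: "\<eta> > 0" using D0 e by (simp add: \<eta>_def)
  have L: "(1 + \<eta>) * hs_length \<gamma> \<le> ?D + e"
  proof -
    have "\<eta> * hs_length \<gamma> \<le> \<eta> * (?D + e / 2)" using \<gamma>(5) \<eta> by (intro mult_left_mono) auto
    moreover have "?D + e / 2 \<noteq> 0" using D0 e by linarith
    then have "\<eta> * (?D + e / 2) = e / 2" by (rule nonzero_eq_divide_eq[THEN iffD1, OF _ \<eta>_def])
    ultimately show ?thesis using \<gamma>(5) by (simp add: distrib_right)
  qed
  \<comment> \<open>A mesh with chords shorter than sqrt \<eta> brings the factor 1 + chord^2 of the
    logarithm down to 1 + \<eta>.\<close>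
  have "uniformly_continuous_on {0..1} \<gamma>"
    using sp by (auto simp: has_speed_def intro: compact_uniformly_continuous)
  then obtain d where d: "d > 0"
    "\<And>s t. s \<in> {0..1} \<Longrightarrow> t \<in> {0..1} \<Longrightarrow> dist t s < d \<Longrightarrow> dist (\<gamma> t) (\<gamma> s) < sqrt \<eta>"
    unfolding uniformly_continuous_on_def using \<eta> by (metis real_sqrt_gt_zero)
  obtain m0 :: nat where m0: "inverse (real (Suc m0)) < d" using reals_Archimedean[OF d(1)] by blast
  define m where "m = Suc m0"
  have m: "m > 0" "1 / real m < d" using m0 by (simp_all add: m_def divide_inverse)
  define X where "X k = \<gamma> (real k / real m)" for k
  have in01: "real k / real m \<in> {0..1}" if "k \<le> m" for k using that m by simp
  have XU: "X k \<in> unitary_group" if "k \<le> m" for k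
    using \<gamma>(2) in01[OF that] by (auto simp: X_def)
  have sqX: "(norm (X (Suc k) - X k))\<^sup>2 \<le> \<eta>" if "k < m" for k
  proof -
    have "norm (X (Suc k) - X k) < sqrt \<eta>"
      using d(2)[of "real k / real m" "real (Suc k) / real m"] in01[of k] in01[of "Suc k"] that m
      by (simp add: X_def dist_norm diff_divide_distrib[symmetric])
    then have "(norm (X (Suc k) - X k))\<^sup>2 \<le> (sqrt \<eta>)\<^sup>2" by (intro power_mono) auto
    then show ?thesis using \<eta> by simp
  qed
  have "\<exists>ae. conj_transpose (fst ae) = - fst ae \<and> one_param (fst ae) (snd ae) \<and>
      snd ae 1 ** X k = X (Suc k) \<and> norm (fst ae) \<le> (1 + \<eta>) * norm (X (Suc k) - X k)" if "k < m" for k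
  proof -
    have "X k \<in> unitary_group" "X (Suc k) \<in> unitary_group" using that by (auto intro: XU)
    from unitary_log_between[OF this] obtain A E where ae: "conj_transpose A = - A" "one_param A E"
      "E 1 ** X k = X (Suc k)" "norm A \<le> norm (X (Suc k) - X k) * (1 + (norm (X (Suc k) - X k))\<^sup>2)"
      by metis
    note ae(4)
    also have "norm (X (Suc k) - X k) * (1 + (norm (X (Suc k) - X k))\<^sup>2) \<le> norm (X (Suc k) - X k) * (1 + \<eta>)"
      using sqX[OF that] by (intro mult_left_mono) auto
    finally show ?thesis using ae by (intro exI[of _ "(A, E)"]) (auto simp: mult.commute)
  qed
  then obtain ae where ae: "\<And>k. k < m \<Longrightarrow> conj_transpose (fst (ae k)) = - fst (ae k) \<and>
      one_param (fst (ae k)) (snd (ae k)) \<and> snd (ae k) 1 ** X k = X (Suc k) \<and>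
      norm (fst (ae k)) \<le> (1 + \<eta>) * norm (X (Suc k) - X k)"
    by metis
  have chord: "(\<Sum>k<i. norm (X (Suc k) - X k)) \<le> integral {0..real i / real m} (\<lambda>t. norm (G t))"
    if "i \<le> m" for i
    using that
  proof (induction i)
    case (Suc i)
    have le: "real i / real m \<le> real (Suc i) / real m" using m by (simp add: divide_right_mono)
    have "real (Suc i) / real m \<le> 1" "0 \<le> real i / real m" using in01[OF Suc.prems] by auto
    then have "norm (X (Suc i) - X i) \<le> integral {real i / real m..real (Suc i) / real m} (\<lambda>t. norm (G t))"
      unfolding X_def by (intro chord_le_length has_speed_subinterval[OF sp] le) auto
    moreover have "integral {0..real i / real m} (\<lambda>t. norm (G t)) +
        integral {real i / real m..real (Suc i) / real m} (\<lambda>t. norm (G t))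
        = integral {0..real (Suc i) / real m} (\<lambda>t. norm (G t))"
    proof (rule Henstock_Kurzweil_Integration.integral_combine)
      show "(\<lambda>t. norm (G t)) integrable_on {0..real (Suc i) / real m}"
        using has_speed_subinterval[OF sp, of 0 "real (Suc i) / real m"] in01[OF Suc.prems]
        by (auto simp: has_speed_def)
    qed (use le in auto)
    moreover have "(\<Sum>k<i. norm (X (Suc k) - X k)) \<le> integral {0..real i / real m} (\<lambda>t. norm (G t))"
      using Suc by simp
    ultimately show ?case by (simp only: sum.lessThan_Suc)
  qed simp
  have "(\<Sum>k<m. norm (fst (ae k))) \<le> (\<Sum>k<m. (1 + \<eta>) * norm (X (Suc k) - X k))"
    using ae by (intro sum_mono) auto
  also have "\<dots> = (1 + \<eta>) * (\<Sum>k<m. norm (X (Suc k) - X k))" by (simp add: sum_distrib_left)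
  also have "\<dots> \<le> (1 + \<eta>) * hs_length \<gamma>"
    using chord[of m] \<eta> m by (intro mult_left_mono) (auto simp: has_speed_hs_length[OF sp])
  also note L
  finally have len: "(\<Sum>k<m. norm (fst (ae k))) \<le> ?D + e" .
  have "X 0 = x" "X m = y" using m \<gamma> by (simp_all add: X_def)
  from that[of X m "\<lambda>k. fst (ae k)" "\<lambda>k. snd (ae k)", OF this XU _ _ _ len] ae show ?thesis by blast
qed

subsection \<open>Contraction by two-dimensional unitary blocks\<close>

abbreviation ordered_pairs :: "('n::{finite,linorder} \<times> 'n) set" where
  "ordered_pairs \<equiv> {(i, j). i < j}"

text \<open>For distinct i, j this is, on skew-Hermitian matrices, the orthogonal projection onto
  the Lie algebra of the copy of U(2) at (i, j).\<close>

definition block_part :: "'n \<Rightarrow> 'n \<Rightarrow> complex^'n^'n \<Rightarrow> complex^'n^'n" where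
  "block_part i j A = (\<chi> k l. if k \<in> {i, j} \<and> l \<in> {i, j} then A $ k $ l else 0)"

text \<open>For distinct i, j the unitary blocks are the copy of U(2) at (i, j). No isometry
  appears: changing it only conjugates inside that copy.\<close>

definition is_block :: "'n \<Rightarrow> 'n \<Rightarrow> complex^'n^'n \<Rightarrow> bool" where
  "is_block i j V \<longleftrightarrow> (\<forall>k l. k \<notin> {i, j} \<or> l \<notin> {i, j} \<longrightarrow> V $ k $ l = mat 1 $ k $ l)"

lemma is_block_mat_1: "is_block i j (mat 1)"
  by (simp add: is_block_def)

lemma mat_1_mult_sum:
  "(\<Sum>r\<in>UNIV. (mat 1 :: complex^'n^'n) $ k $ r * f r) = f k"
  "(\<Sum>r\<in>UNIV. f r * (mat 1 :: complex^'n^'n) $ r $ k) = f k"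
proof -
  have "(\<Sum>r\<in>UNIV. (mat 1 :: complex^'n^'n) $ k $ r * f r) = (\<Sum>r\<in>UNIV. if r = k then f r else 0)"
    by (rule sum.cong) (auto simp: mat_def)
  then show "(\<Sum>r\<in>UNIV. (mat 1 :: complex^'n^'n) $ k $ r * f r) = f k" by simp
  have "(\<Sum>r\<in>UNIV. f r * (mat 1 :: complex^'n^'n) $ r $ k) = (\<Sum>r\<in>UNIV. if r = k then f r else 0)"
    by (rule sum.cong) (auto simp: mat_def)
  then show "(\<Sum>r\<in>UNIV. f r * (mat 1 :: complex^'n^'n) $ r $ k) = f k" by simp
qed

lemma is_block_mult:
  fixes V W :: "complex^'n^'n"
  assumes "is_block i j V" "is_block i j W"
  shows "is_block i j (V ** W)"
  unfolding is_block_def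
proof (intro allI impI)
  fix k l :: 'n assume kl: "k \<notin> {i, j} \<or> l \<notin> {i, j}"
  show "(V ** W) $ k $ l = mat 1 $ k $ l"
  proof (cases "k \<notin> {i, j}")
    case True
    then have "(V ** W) $ k $ l = (\<Sum>r\<in>UNIV. (mat 1 :: complex^'n^'n) $ k $ r * W $ r $ l)"
      using assms(1) by (simp add: is_block_def matrix_matrix_mult_def)
    also have "\<dots> = mat 1 $ k $ l"
      using True assms(2) unfolding mat_1_mult_sum by (simp add: is_block_def)
    finally show ?thesis .
  next
    case False
    then have l: "l \<notin> {i, j}" using kl by simp
    then have "(V ** W) $ k $ l = (\<Sum>r\<in>UNIV. V $ k $ r * (mat 1 :: complex^'n^'n) $ r $ l)"
      using assms(2) by (simp add: is_block_def matrix_matrix_mult_def)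
    also have "\<dots> = mat 1 $ k $ l"
      using l assms(1) unfolding mat_1_mult_sum by (simp add: is_block_def)
    finally show ?thesis .
  qed
qed

lemma conj_transpose_block_part:
  "conj_transpose A = - A \<Longrightarrow> conj_transpose (block_part i j A) = - block_part i j A"
  by (auto simp: block_part_def vec_eq_iff)

text \<open>An entry outside the block has derivative 0: either its row in the generator vanishes,
  or, after commuting generator and group, its column does. So it keeps its value at the
  identity.\<close>

lemma is_block_one_param:
  fixes A :: "complex^'n^'n"
  assumes E: "one_param (- block_part i j A) E"
  shows "is_block i j (E s)"
  unfolding is_block_def
proof (intro allI impI)
  fix k l :: 'n assume kl: "k \<notin> {i, j} \<or> l \<notin> {i, j}"
  let ?B = "- block_part i j A"
  have zero: "(?B ** E t) $ k $ l = 0" for t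
  proof (cases "k \<notin> {i, j}")
    case True
    then show ?thesis by (simp add: matrix_matrix_mult_def block_part_def)
  next
    case False
    then have "l \<notin> {i, j}" using kl by simp
    moreover have "?B ** E t = E t ** ?B" using E by (simp add: one_param_def)
    ultimately show ?thesis by (simp add: matrix_matrix_mult_def block_part_def)
  qed
  have lin: "bounded_linear (\<lambda>a::complex^'n^'n. a $ k $ l)"
    by (intro bounded_linear_compose[OF bounded_linear_vec_nth] bounded_linear_vec_nth)
  have "((\<lambda>t. E t $ k $ l) has_vector_derivative 0) (at t within UNIV)" for t
  proof -
    have "(E has_vector_derivative ?B ** E t) (at t)" using E unfolding one_param_def by blast
    from bounded_linear.has_vector_derivative[OF lin this] show ?thesis by (simp only: zero)
  qed
  then obtain c where "\<And>t. E t $ k $ l = c"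
    using has_vector_derivative_zero_constant[of UNIV "\<lambda>t. E t $ k $ l"] by auto
  then have "E s $ k $ l = E 0 $ k $ l" by simp
  then show "E s $ k $ l = mat 1 $ k $ l" using E by (simp add: one_param_def)
qed

lemma norm_matrix_power2: "(norm (A :: complex^'n^'m))\<^sup>2 = (\<Sum>k\<in>UNIV. \<Sum>l\<in>UNIV. (norm (A $ k $ l))\<^sup>2)"
  by (simp add: norm_vec_def L2_set_def sum_nonneg)

text \<open>Pythagoras, as the block and the remainder have disjoint supports.\<close>

lemma norm_diff_block_part:
  "(norm (A - block_part i j A))\<^sup>2 = (norm A)\<^sup>2 - (norm (block_part i j A))\<^sup>2"
proof -
  have "(norm (A - block_part i j A))\<^sup>2 + (norm (block_part i j A))\<^sup>2 = (norm A)\<^sup>2"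
    unfolding norm_matrix_power2 sum.distrib[symmetric]
    by (intro sum.cong) (auto simp: block_part_def)
  then show ?thesis by simp
qed

text \<open>An off-diagonal entry lies in exactly one block and a diagonal entry in n - 1 of them,
  so each is counted at least once.\<close>

lemma norm_power2_le_sum_block_part:
  fixes A :: "complex^'n::{finite,linorder}^'n::{finite,linorder}"
  assumes n: "CARD('n) \<ge> 2"
  shows "(norm A)\<^sup>2 \<le> (\<Sum>(i, j)\<in>ordered_pairs. (norm (block_part i j A))\<^sup>2)"
proof -
  define g where "g p k l = (if k \<in> {fst p, snd p} \<and> l \<in> {fst p, snd p} then (norm (A $ k $ l))\<^sup>2 else 0)"
    for p :: "'n \<times> 'n" and k l
  have g: "(norm (A $ k $ l))\<^sup>2 \<le> (\<Sum>p\<in>ordered_pairs. g p k l)" for k l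
  proof -
    \<comment> \<open>A diagonal entry needs a second index to name a block containing it; this is
      where n >= 2 enters.\<close>
    obtain r where r: "r \<noteq> k"
      using n by (metis One_nat_def UNIV_I card_1_singleton_iff card_le_Suc0_iff_eq finite numeral_2_eq_2 not_less_eq_eq)
    define l' where "l' = (if k = l then r else l)"
    define p where "p = (min k l', max k l')"
    have p: "p \<in> ordered_pairs" "k \<in> {fst p, snd p}" "l \<in> {fst p, snd p}"
      using r by (auto simp: p_def l'_def min_def max_def)
    have "(norm (A $ k $ l))\<^sup>2 = g p k l" using p by (simp add: g_def)
    also have "\<dots> \<le> (\<Sum>p\<in>ordered_pairs. g p k l)"
      using p by (intro member_le_sum) (auto simp: g_def)
    finally show ?thesis .
  qed
  have "(norm A)\<^sup>2 \<le> (\<Sum>k\<in>UNIV. \<Sum>l\<in>UNIV. \<Sum>p\<in>ordered_pairs. g p k l)"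
    unfolding norm_matrix_power2 by (intro sum_mono g)
  also have "\<dots> = (\<Sum>k\<in>UNIV. \<Sum>p\<in>ordered_pairs. \<Sum>l\<in>UNIV. g p k l)"
    by (intro sum.cong refl sum.swap)
  also have "\<dots> = (\<Sum>p\<in>ordered_pairs. \<Sum>k\<in>UNIV. \<Sum>l\<in>UNIV. g p k l)"
    by (rule sum.swap)
  also have "\<dots> = (\<Sum>(i, j)\<in>ordered_pairs. (norm (block_part i j A))\<^sup>2)"
    unfolding norm_matrix_power2 split_def
    by (intro sum.cong) (auto simp: g_def block_part_def)
  finally show ?thesis .
qed

text \<open>Pythagoras summed over the N pairs; averaging over them yields the contraction factor 1
  - 1/N.\<close>

lemma sum_norm_diff_block_part_le:
  fixes A :: "complex^'n::{finite,linorder}^'n::{finite,linorder}"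
  assumes n: "CARD('n) \<ge> 2"
  shows "(\<Sum>(i, j)\<in>ordered_pairs. (norm (A - block_part i j A))\<^sup>2)
    \<le> (real (card (ordered_pairs :: ('n \<times> 'n) set)) - 1) * (norm A)\<^sup>2"
  using norm_power2_le_sum_block_part[OF n, of A]
  by (simp add: norm_diff_block_part split_def sum_subtractf left_diff_distrib)

lemma L2_set_sum_le: "L2_set (\<lambda>p. \<Sum>k<(m::nat). f k p) P \<le> (\<Sum>k<m. L2_set (f k) P)"
proof (induction m)
  case 0
  show ?case by (simp add: L2_set_def)
next
  case (Suc m)
  have "L2_set (\<lambda>p. \<Sum>k<Suc m. f k p) P \<le> L2_set (\<lambda>p. \<Sum>k<m. f k p) P + L2_set (f m) P"
    by (simp add: L2_set_triangle_ineq)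
  then show ?case using Suc by simp
qed

text \<open>Along a broken geodesic with velocities \<open>A\<^sub>k\<close> the block \<open>V i j\<close> undoes the
  \<open>(i, j)\<close>-part of every \<open>A\<^sub>k\<close>; the lengths for the different pairs are combined by
  Minkowski's inequality.\<close>

lemma block_contraction:
  fixes x y :: "complex^'n::{finite,linorder}^'n::{finite,linorder}"
  assumes n: "CARD('n) \<ge> 2" and x: "x \<in> unitary_group" and y: "y \<in> unitary_group" and e: "e > 0"
  obtains V where "\<And>i j. V i j \<in> unitary_group" "\<And>i j. is_block i j (V i j)"
    "(\<Sum>(i, j)\<in>ordered_pairs. (riemann_dist x (V i j ** y))\<^sup>2)
      \<le> (real (card (ordered_pairs :: ('n \<times> 'n) set)) - 1) * (riemann_dist x y + e)\<^sup>2"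
proof -
  let ?N = "real (card (ordered_pairs :: ('n \<times> 'n) set)) - 1"
  obtain m :: nat and X A E where X: "X 0 = x" "X m = y" "\<And>k. k \<le> m \<Longrightarrow> X k \<in> unitary_group"
    and A: "\<And>k. k < m \<Longrightarrow> conj_transpose (A k) = - A k" "\<And>k. k < m \<Longrightarrow> one_param (A k) (E k)"
    "\<And>k. k < m \<Longrightarrow> E k 1 ** X k = X (Suc k)"
    and len: "(\<Sum>k<m. norm (A k)) \<le> riemann_dist x y + e"
    using exp_chain[OF x y e] by metis
  \<comment> \<open>The correction grows on the right: passing from V and \<open>X l\<close> to V F
    and the next point moves the end point by the distance from \<open>X l\<close> to F
    \<open>X (Suc l)\<close>, because left translation by V is an isometry.\<close>
  have "\<exists>V. V \<in> unitary_group \<and> is_block i j V \<and>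
      riemann_dist x (V ** X l) \<le> (\<Sum>k<l. norm (A k - block_part i j (A k)))" if "l \<le> m" for i j l
    using that
  proof (induction l)
    case 0
    have "riemann_dist x x \<le> 0" using riemann_dist_le_norm[OF x x] by simp
    then show ?case by (intro exI[of _ "mat 1"]) (simp add: X is_block_mat_1)
  next
    case (Suc l)
    then obtain V where V: "V \<in> unitary_group" "is_block i j V"
      "riemann_dist x (V ** X l) \<le> (\<Sum>k<l. norm (A k - block_part i j (A k)))" by auto
    have l: "l < m" using Suc.prems by simp
    have "conj_transpose (- block_part i j (A l)) = - (- block_part i j (A l))"
      using conj_transpose_block_part[OF A(1)[OF l]] by (simp add: conj_transpose_minus)
    then obtain F where F: "one_param (- block_part i j (A l)) F" using skew_one_param by blast
    have F1: "F 1 \<in> unitary_group" using F by (simp add: one_param_def)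
    have U: "X l \<in> unitary_group" "X (Suc l) \<in> unitary_group" using X(3) Suc.prems by auto
    have "riemann_dist (V ** X l) (V ** (F 1 ** X (Suc l))) = riemann_dist (X l) (F 1 ** E l 1 ** X l)"
      using riemann_dist_mult_left[OF V(1) U(1) unitary_group_mult[OF F1 U(2)]] A(3)[OF l]
      by (simp add: matrix_mul_assoc[symmetric])
    also have "\<dots> \<le> norm (A l - block_part i j (A l))"
      using riemann_dist_exp_le[OF A(2)[OF l] F U(1)] by simp
    finally have "riemann_dist x (V ** (F 1 ** X (Suc l)))
        \<le> (\<Sum>k<Suc l. norm (A k - block_part i j (A k)))"
      using V(3) riemann_dist_triangle[OF x unitary_group_mult[OF V(1) U(1)]
          unitary_group_mult[OF V(1) unitary_group_mult[OF F1 U(2)]]] by simp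
    then show ?case
      using V F1 is_block_one_param[OF F]
      by (intro exI[of _ "V ** F 1"])
        (auto simp: matrix_mul_assoc[symmetric] intro: unitary_group_mult is_block_mult)
  qed
  from this[of m] have "\<forall>p. \<exists>V. V \<in> unitary_group \<and> is_block (fst p) (snd p) V \<and>
      riemann_dist x (V ** y) \<le> (\<Sum>k<m. norm (A k - block_part (fst p) (snd p) (A k)))"
    by (simp add: X)
  then obtain V' where V': "\<forall>p. V' p \<in> unitary_group \<and> is_block (fst p) (snd p) (V' p) \<and>
      riemann_dist x (V' p ** y) \<le> (\<Sum>k<m. norm (A k - block_part (fst p) (snd p) (A k)))"
    by (rule choice[THEN exE])
  define V where "V i j = V' (i, j)" for i j
  have V: "V i j \<in> unitary_group" "is_block i j (V i j)"
    "riemann_dist x (V i j ** y) \<le> (\<Sum>k<m. norm (A k - block_part i j (A k)))" for i j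
    using V'[rule_format, of "(i, j)"] by (simp_all add: V_def)
  define P where "P = (ordered_pairs :: ('n \<times> 'n) set)"
  have N: "0 \<le> ?N"
  proof -
    obtain a b :: 'n where "a \<noteq> b"
      using n by (metis One_nat_def UNIV_I card_le_Suc0_iff_eq finite numeral_2_eq_2 not_less_eq_eq)
    then have "(min a b, max a b) \<in> (ordered_pairs :: ('n \<times> 'n) set)" by (auto simp: min_def max_def)
    then have "card (ordered_pairs :: ('n \<times> 'n) set) \<noteq> 0" by (auto simp: card_eq_0_iff)
    then show ?thesis by linarith
  qed
  have "L2_set (\<lambda>p. riemann_dist x (V (fst p) (snd p) ** y)) P
      \<le> L2_set (\<lambda>p. \<Sum>k<m. norm (A k - block_part (fst p) (snd p) (A k))) P"
    using V x y by (intro L2_set_mono riemann_dist_nonneg unitary_group_mult)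
  also have "\<dots> \<le> (\<Sum>k<m. L2_set (\<lambda>p. norm (A k - block_part (fst p) (snd p) (A k))) P)"
    by (rule L2_set_sum_le)
  also have "\<dots> \<le> (\<Sum>k<m. sqrt ?N * norm (A k))"
  proof (rule sum_mono)
    fix k
    have "L2_set (\<lambda>p. norm (A k - block_part (fst p) (snd p) (A k))) P \<le> sqrt (?N * (norm (A k))\<^sup>2)"
      using sum_norm_diff_block_part_le[OF n, of "A k"]
      unfolding L2_set_def P_def by (simp add: split_def)
    then show "L2_set (\<lambda>p. norm (A k - block_part (fst p) (snd p) (A k))) P \<le> sqrt ?N * norm (A k)"
      by (simp add: real_sqrt_mult)
  qed
  also have "\<dots> \<le> sqrt ?N * (riemann_dist x y + e)"
    using len N by (simp add: sum_distrib_left[symmetric] mult_left_mono)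
  finally have "(L2_set (\<lambda>p. riemann_dist x (V (fst p) (snd p) ** y)) P)\<^sup>2
      \<le> (sqrt ?N * (riemann_dist x y + e))\<^sup>2"
    by (intro power_mono) auto
  then have "(\<Sum>(i, j)\<in>ordered_pairs. (riemann_dist x (V i j ** y))\<^sup>2) \<le> ?N * (riemann_dist x y + e)\<^sup>2"
    using N by (simp add: L2_set_def P_def power_mult_distrib split_def sum_nonneg)
  with V(1,2) show ?thesis using that by blast
qed

subsection \<open>Embedding of two-dimensional unitaries\<close>

text \<open>The matrix of u_ij for the isometry sending e_i, e_j to the standard basis; other
  isometries differ by a unitary change of basis of C^2.\<close>

definition block_embed :: "'n \<Rightarrow> 'n \<Rightarrow> complex^2^2 \<Rightarrow> complex^'n^'n" where
  "block_embed i j M = (\<chi> k l. if k \<in> {i, j} \<and> l \<in> {i, j}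
     then M $ (if k = i then 1 else 2) $ (if l = i then 1 else 2) else mat 1 $ k $ l)"

definition pair_coords :: "'n \<Rightarrow> 'n \<Rightarrow> complex^'n \<Rightarrow> complex^2" where
  "pair_coords i j v = (\<chi> r. if r = 1 then v $ i else v $ j)"

lemma is_block_block_embed: "is_block i j (block_embed i j M)"
  by (simp add: is_block_def block_embed_def)

lemma sum_block_row:
  assumes "i \<noteq> j" "\<And>l. l \<notin> {i, j} \<Longrightarrow> f l = (0::complex)"
  shows "(\<Sum>l\<in>UNIV. f (l::'n::finite)) = f i + f j"
proof -
  have "(\<Sum>l\<in>UNIV. f l) = (\<Sum>l\<in>{i, j}. f l)"
    by (rule sum.mono_neutral_right) (use assms(2) in auto)
  then show ?thesis using assms(1) by simp
qed

lemma is_block_eqI: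
  fixes V W :: "complex^'n^'n"
  assumes "is_block i j V" "is_block i j W"
    "\<And>k l. k \<in> {i, j} \<Longrightarrow> l \<in> {i, j} \<Longrightarrow> V $ k $ l = W $ k $ l"
  shows "V = W"
  unfolding vec_eq_iff
proof (intro allI)
  fix k l
  show "V $ k $ l = W $ k $ l"
    using assms by (cases "k \<in> {i, j} \<and> l \<in> {i, j}") (auto simp: is_block_def)
qed

lemma block_embed_mult:
  fixes i j :: "'n::finite"
  assumes "i \<noteq> j"
  shows "block_embed i j M ** block_embed i j N = block_embed i j (M ** N)"
proof (rule is_block_eqI[of i j])
  show "is_block i j (block_embed i j M ** block_embed i j N)"
    by (intro is_block_mult is_block_block_embed)
  show "is_block i j (block_embed i j (M ** N))" by (rule is_block_block_embed)
  fix k l assume kl: "k \<in> {i, j}" "l \<in> {i, j}"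
  have "(block_embed i j M ** block_embed i j N) $ k $ l =
      block_embed i j M $ k $ i * block_embed i j N $ i $ l +
      block_embed i j M $ k $ j * block_embed i j N $ j $ l"
    unfolding matrix_matrix_mult_def vec_lambda_beta
    by (rule sum_block_row[OF assms]) (use kl in \<open>auto simp: block_embed_def mat_def\<close>)
  also have "\<dots> = block_embed i j (M ** N) $ k $ l"
    using kl assms by (auto simp: block_embed_def matrix_matrix_mult_def sum_2)
  finally show "(block_embed i j M ** block_embed i j N) $ k $ l = block_embed i j (M ** N) $ k $ l" .
qed

lemma conj_transpose_block_embed: "conj_transpose (block_embed i j M) = block_embed i j (conj_transpose M)"
  by (auto simp: vec_eq_iff block_embed_def mat_def)

lemma block_embed_mat_1: "i \<noteq> j \<Longrightarrow> block_embed i j (mat 1) = mat 1"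
  by (auto simp: vec_eq_iff block_embed_def mat_def)

lemma block_embed_inject:
  assumes "i \<noteq> j" "block_embed i j M = block_embed i j N"
  shows "M = N"
proof -
  have "block_embed i j M $ k $ l = block_embed i j N $ k $ l" for k l using assms(2) by simp
  from this[of i i] this[of i j] this[of j i] this[of j j] show ?thesis
    using assms(1) by (auto simp: vec_eq_iff block_embed_def forall_2)
qed

lemma block_embed_unitary:
  assumes "i \<noteq> j"
  shows "block_embed i j M \<in> unitary_group \<longleftrightarrow> M \<in> unitary_group"
proof -
  have "block_embed i j M \<in> unitary_group \<longleftrightarrow>
      block_embed i j (conj_transpose M ** M) = block_embed i j (mat 1)"
    by (simp add: unitary_group_iff conj_transpose_block_embed block_embed_mult block_embed_mat_1 assms)
  then show ?thesis
    using block_embed_inject[OF assms] by (auto simp: unitary_group_iff)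
qed

lemma is_block_imp_block_embed:
  assumes "i \<noteq> j" "is_block i j V"
  shows "\<exists>M. V = block_embed i j M"
proof
  show "V = block_embed i j (\<chi> r s. V $ (if r = 1 then i else j) $ (if s = 1 then i else j))"
    by (rule is_block_eqI[OF assms(2) is_block_block_embed])
      (use assms(1) in \<open>auto simp: block_embed_def\<close>)
qed

lemma pair_coords_block_embed:
  fixes i j :: "'n::finite"
  assumes "i \<noteq> j"
  shows "pair_coords i j (block_embed i j M *v v) = M *v pair_coords i j v"
proof -
  have "(block_embed i j M *v v) $ k = block_embed i j M $ k $ i * v $ i + block_embed i j M $ k $ j * v $ j"
    if "k \<in> {i, j}" for k
    unfolding matrix_vector_mult_def vec_lambda_beta
    by (rule sum_block_row[OF assms]) (use that in \<open>auto simp: block_embed_def mat_def\<close>)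
  then have "(block_embed i j M *v v) $ i = M $ 1 $ 1 * v $ i + M $ 1 $ 2 * v $ j"
    "(block_embed i j M *v v) $ j = M $ 2 $ 1 * v $ i + M $ 2 $ 2 * v $ j"
    using assms by (auto simp: block_embed_def)
  then show ?thesis
    by (simp add: vec_eq_iff forall_2 pair_coords_def matrix_vector_mult_def sum_2)
qed

lemma block_embed_mult_vec_nth:
  assumes "k \<notin> {i, j}"
  shows "(block_embed i j M *v v) $ k = v $ k"
proof -
  have "(block_embed i j M *v v) $ k = (\<Sum>l\<in>UNIV. mat 1 $ k $ l * v $ l)"
    using assms by (simp add: matrix_vector_mult_def block_embed_def)
  then show ?thesis by (simp add: mat_1_mult_sum)
qed

lemma coord_span_iff: "v \<in> coord_span i j \<longleftrightarrow> (\<forall>k. k \<notin> {i, j} \<longrightarrow> v $ k = 0)"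
proof
  assume "v \<in> coord_span i j"
  then obtain a b where "v = a *s axis i 1 + b *s axis j 1"
    unfolding coord_span_def by (auto simp: vec.span_insert vec.span_singleton algebra_simps) 
  then show "\<forall>k. k \<notin> {i, j} \<longrightarrow> v $ k = 0" by (simp add: axis_def)
next
  assume r: "\<forall>k. k \<notin> {i, j} \<longrightarrow> v $ k = 0"
  have "v = v $ i *s axis i 1 + (if i = j then 0 else v $ j) *s axis j 1"
    using r by (auto simp: vec_eq_iff axis_def)
  also have "\<dots> \<in> coord_span i j"
    unfolding coord_span_def by (intro vec.span_add vec.span_scale vec.span_base) auto
  finally show "v \<in> coord_span i j" .
qed

lemma hermitian_complement_coord_span:
  "v \<in> hermitian_complement (coord_span i j) \<longleftrightarrow> v $ i = 0 \<and> v $ j = 0"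
proof
  assume v: "v \<in> hermitian_complement (coord_span i j)"
  have "v $ k = 0" if "k \<in> {i, j}" for k
  proof -
    have "axis k 1 \<in> coord_span i j" using that by (auto simp: coord_span_iff axis_def)
    then have "(\<Sum>l\<in>UNIV. v $ l * cnj (axis k 1 $ l)) = 0" using v by (simp add: hermitian_complement_def)
    moreover have "(\<Sum>l\<in>UNIV. v $ l * cnj (axis k 1 $ l)) = (\<Sum>l\<in>UNIV. if l = k then v $ l else 0)"
      by (rule sum.cong) (auto simp: axis_def)
    ultimately show ?thesis by simp
  qed
  then show "v $ i = 0 \<and> v $ j = 0" by simp
next
  assume v: "v $ i = 0 \<and> v $ j = 0"
  then have "v $ k * cnj (y $ k) = 0" if "y \<in> coord_span i j" for y k
    using that unfolding coord_span_iff by (cases "k \<in> {i, j}") auto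
  then show "v \<in> hermitian_complement (coord_span i j)"
    unfolding hermitian_complement_def by (intro CollectI ballI sum.neutral)
qed

text \<open>The columns of Q are J e_i and J e_j. The hypothesis preserves norms only, so
  orthogonality of the columns is recovered by polarisation.\<close>

lemma isometry_matrix:
  fixes J :: "complex^'n \<Rightarrow> complex^2"
  assumes "i \<noteq> j" and J: "complex_linear_isometry_on (coord_span i j) J"
  obtains Q where "Q \<in> unitary_group" "\<And>v. v \<in> coord_span i j \<Longrightarrow> J v = Q *v pair_coords i j v"
proof -
  define p where "p = J (axis i 1)"
  define q where "q = J (axis j 1)"
  have ax: "axis i 1 \<in> coord_span i j" "axis j 1 \<in> coord_span i j"
    by (auto simp: coord_span_iff axis_def)
  have sc: "c *s v \<in> coord_span i j" if "v \<in> coord_span i j" for c v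
    using that by (auto simp: coord_span_iff)
  have lin: "J (a *s axis i 1 + b *s axis j 1) = a *s p + b *s q" for a b
    using J ax sc unfolding complex_linear_isometry_on_def p_def q_def by metis
  have nrm: "(norm (a *s p + b *s q))\<^sup>2 = (norm a)\<^sup>2 + (norm b)\<^sup>2" for a b
  proof -
    let ?v = "a *s axis i 1 + b *s axis j 1 :: complex^'n"
    have "?v \<in> coord_span i j" by (auto simp: coord_span_iff axis_def)
    then have "norm (a *s p + b *s q) = norm ?v"
      using J unfolding lin[symmetric] complex_linear_isometry_on_def by blast
    moreover have "of_real ((norm ?v)\<^sup>2) = (of_real ((norm a)\<^sup>2 + (norm b)\<^sup>2) :: complex)"
    proof -
      have "of_real ((norm ?v)\<^sup>2) = herm ?v ?v" by (simp add: herm_self)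
      also have "\<dots> = ?v $ i * cnj (?v $ i) + ?v $ j * cnj (?v $ j)"
        unfolding herm_def by (rule sum_block_row[OF assms(1)]) (auto simp: axis_def)
      also have "\<dots> = a * cnj a + b * cnj b" using assms(1) by (simp add: axis_def)
      also have "\<dots> = of_real ((norm a)\<^sup>2 + (norm b)\<^sup>2)"
        by (simp only: of_real_add complex_norm_square)
      finally show ?thesis .
    qed
    ultimately show ?thesis by (simp only: of_real_eq_iff)
  qed
  have expand: "herm (a *s p + b *s q) (a *s p + b *s q) =
      a * cnj a * herm p p + b * cnj b * herm q q + a * cnj b * herm p q + cnj (a * cnj b * herm p q)" for a b
  proof -
    have "herm x (y + z) = herm x y + herm x z" for x y z :: "complex^2"
      by (simp add: herm_def sum.distrib algebra_simps)
    then show ?thesis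
      using herm_commute[of q p]
      by (simp add: herm_add_left herm_scale_left herm_scale_right algebra_simps)
  qed
  have hp: "herm p p = 1" "herm q q = 1"
    using nrm[of 1 0] nrm[of 0 1] by (simp_all add: herm_self)
  have "Re (a * cnj b * herm p q) = 0" for a b
  proof -
    have "Re (herm (a *s p + b *s q) (a *s p + b *s q)) = (norm a)\<^sup>2 + (norm b)\<^sup>2"
      using nrm[of a b] by (simp add: herm_self)
    moreover have "Re (a * cnj a) = (norm a)\<^sup>2" "Re (b * cnj b) = (norm b)\<^sup>2"
      by (simp_all flip: complex_norm_square)
    moreover have "Re (herm (a *s p + b *s q) (a *s p + b *s q)) =
        Re (a * cnj a) + Re (b * cnj b) + 2 * Re (a * cnj b * herm p q)"
      by (simp only: expand hp mult_1_right plus_complex.sel cnj.sel)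
    ultimately show ?thesis by linarith
  qed
  \<comment> \<open>The coefficients (1, 1) and (i, 1) test the real and the imaginary part of the
    inner product.\<close>
  from this[of 1 1] this[of \<i> 1] have hpq: "herm p q = 0" by (simp add: complex_eq_iff)
  define Q :: "complex^2^2" where "Q = (\<chi> r s. if s = 1 then p $ r else q $ r)"
  have "Q \<in> unitary_group"
    using hp hpq herm_commute[of q p] unfolding unitary_group_iff
    by (simp add: vec_eq_iff forall_2 matrix_matrix_mult_def Q_def mat_def herm_def mult.commute)
  moreover have "J v = Q *v pair_coords i j v" if "v \<in> coord_span i j" for v
  proof -
    have "v = v $ i *s axis i 1 + v $ j *s axis j 1"
      using that assms(1) by (auto simp: vec_eq_iff axis_def coord_span_iff)
    then have "J v = v $ i *s p + v $ j *s q" using lin by metis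
    then show ?thesis
      by (simp add: vec_eq_iff Q_def pair_coords_def matrix_vector_mult_def sum_2 mult.commute)
  qed
  ultimately show ?thesis using that by blast
qed

text \<open>In coordinates J is multiplication by Q, so conjugating u by J becomes conjugating it by
  Q. Uniqueness for the description operator holds because every basis vector lies in the span or in
  its complement.\<close>

lemma embed_unitary_eq:
  fixes i j :: "'n::finite"
  assumes ij: "i \<noteq> j" and Q: "Q \<in> unitary_group"
    and J: "\<And>v. v \<in> coord_span i j \<Longrightarrow> J v = Q *v pair_coords i j v"
  shows "embed_unitary J i j u = block_embed i j (conj_transpose Q ** u ** Q)"
  unfolding embed_unitary_def
proof (rule the_equality)
  let ?B = "block_embed i j (conj_transpose Q ** u ** Q)"
  have QQ: "Q ** conj_transpose Q = mat 1" "conj_transpose Q ** Q = mat 1"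
    using Q by (auto simp: unitary_group_def)
  have inj: "inj_on J (coord_span i j)"
  proof (rule inj_onI)
    fix v w assume vw: "v \<in> coord_span i j" "w \<in> coord_span i j" "J v = J w"
    then have "conj_transpose Q *v (Q *v pair_coords i j v) = conj_transpose Q *v (Q *v pair_coords i j w)"
      by (simp add: J)
    then have "pair_coords i j v = pair_coords i j w" by (simp add: matrix_vector_mul_assoc QQ)
    then have "pair_coords i j v $ r = pair_coords i j w $ r" for r by simp
    from this[of 1] this[of 2] have "v $ i = w $ i" "v $ j = w $ j" by (simp_all add: pair_coords_def)
    then show "v = w" using vw(1,2) unfolding coord_span_iff vec_eq_iff by (metis insert_iff singletonD)
  qed
  have span: "?B *v v = inv_into (coord_span i j) J (u *v J v)" if v: "v \<in> coord_span i j" for v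
  proof -
    have B: "?B *v v \<in> coord_span i j"
      unfolding coord_span_iff using v block_embed_mult_vec_nth[of _ i j _ v] by (auto simp: coord_span_iff)
    have "J (?B *v v) = Q *v ((conj_transpose Q ** u ** Q) *v pair_coords i j v)"
      by (simp add: J[OF B] pair_coords_block_embed[OF ij])
    also have "\<dots> = u *v J v"
      by (simp add: J[OF v] matrix_vector_mul_assoc matrix_mul_assoc QQ)
    finally show ?thesis using inv_into_f_f[OF inj B] by simp
  qed
  have perp: "?B *v v = v" if "v \<in> hermitian_complement (coord_span i j)" for v
  proof -
    have v: "pair_coords i j v = 0"
      using that unfolding hermitian_complement_coord_span by (simp add: pair_coords_def vec_eq_iff)
    have "pair_coords i j (?B *v v) = 0" unfolding pair_coords_block_embed[OF ij] v by simp
    then have "pair_coords i j (?B *v v) $ r = 0" for r by simp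
    from this[of 1] this[of 2] have "(?B *v v) $ i = 0" "(?B *v v) $ j = 0"
      by (simp_all add: pair_coords_def)
    moreover have "v $ i = 0" "v $ j = 0" using that unfolding hermitian_complement_coord_span by auto
    ultimately show ?thesis
      unfolding vec_eq_iff using block_embed_mult_vec_nth[of _ i j _ v] by (metis insert_iff singletonD)
  qed
  show "(\<forall>v\<in>coord_span i j. ?B *v v = inv_into (coord_span i j) J (u *v J v)) \<and>
      (\<forall>v\<in>hermitian_complement (coord_span i j). ?B *v v = v)"
    using span perp by blast
  fix a assume a: "(\<forall>v\<in>coord_span i j. a *v v = inv_into (coord_span i j) J (u *v J v)) \<and>
      (\<forall>v\<in>hermitian_complement (coord_span i j). a *v v = v)"
  have "a *v axis k 1 = ?B *v axis k 1" for k
  proof (cases "k \<in> {i, j}")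
    case True
    then have "axis k 1 \<in> coord_span i j" by (auto simp: coord_span_iff axis_def)
    then show ?thesis using a span by simp
  next
    case False
    then have "axis k 1 \<in> hermitian_complement (coord_span i j)"
      by (auto simp: hermitian_complement_coord_span axis_def)
    then show ?thesis using a perp by simp
  qed
  moreover have "(b *v axis k 1) $ r = b $ r $ k" for b :: "complex^'n^'n" and k r
  proof -
    have "(b *v axis k 1) $ r = (\<Sum>l\<in>UNIV. b $ r $ l * mat 1 $ l $ k)"
      by (simp add: matrix_vector_mult_def axis_def mat_def)
    then show ?thesis by (simp only: mat_1_mult_sum)
  qed
  ultimately show "a = ?B" unfolding vec_eq_iff by metis
qed

text \<open>From here on the isometries act only through these facts. Surjectivity onto the unitary
  blocks lets the Haar measure absorb a block; continuity gives measurability.\<close>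

lemma embed_unitary_properties:
  fixes i j :: "'n::finite"
  assumes ij: "i \<noteq> j" and J: "complex_linear_isometry_on (coord_span i j) J"
  shows embed_unitary_mem: "R \<in> unitary_group \<Longrightarrow> embed_unitary J i j R \<in> unitary_group"
    and embed_unitary_mult: "embed_unitary J i j (R ** S) = embed_unitary J i j R ** embed_unitary J i j S"
    and embed_unitary_surj: "V \<in> unitary_group \<Longrightarrow> is_block i j V \<Longrightarrow>
      \<exists>R\<in>unitary_group. embed_unitary J i j R = V"
    and continuous_on_embed_unitary: "continuous_on UNIV (embed_unitary J i j)"
proof -
  obtain Q where Q: "Q \<in> unitary_group"
    and "\<And>v. v \<in> coord_span i j \<Longrightarrow> J v = Q *v pair_coords i j v"
    by (rule isometry_matrix[OF ij J]) auto
  then have eq: "embed_unitary J i j u = block_embed i j (conj_transpose Q ** u ** Q)" for u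
    by (rule embed_unitary_eq[OF ij])
  show "embed_unitary J i j R \<in> unitary_group" if "R \<in> unitary_group"
    unfolding eq block_embed_unitary[OF ij]
    using that Q by (intro unitary_group_mult unitary_group_conj_transpose)
  have "(conj_transpose Q ** R ** Q) ** (conj_transpose Q ** S ** Q) = conj_transpose Q ** (R ** S) ** Q"
  proof -
    have "(conj_transpose Q ** R ** Q) ** (conj_transpose Q ** S ** Q) =
        conj_transpose Q ** (R ** (Q ** (conj_transpose Q ** (S ** Q))))" by (simp add: matrix_mul_assoc)
    then show ?thesis unfolding unitary_cancel_left(2)[OF Q] by (simp add: matrix_mul_assoc)
  qed
  then show "embed_unitary J i j (R ** S) = embed_unitary J i j R ** embed_unitary J i j S"
    unfolding eq block_embed_mult[OF ij] by simp
  show "\<exists>R\<in>unitary_group. embed_unitary J i j R = V" if V: "V \<in> unitary_group" "is_block i j V"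
  proof -
    obtain M where M: "V = block_embed i j M" using is_block_imp_block_embed[OF ij V(2)] by blast
    then have "M \<in> unitary_group" using V(1) block_embed_unitary[OF ij] by simp
    then have "Q ** M ** conj_transpose Q \<in> unitary_group"
      using Q by (intro unitary_group_mult unitary_group_conj_transpose)
    moreover have "conj_transpose Q ** (Q ** M ** conj_transpose Q) ** Q = M"
    proof -
      have "conj_transpose Q ** (Q ** M ** conj_transpose Q) ** Q =
          conj_transpose Q ** (Q ** (M ** conj_transpose Q ** Q))" by (simp add: matrix_mul_assoc)
      then show ?thesis unfolding unitary_cancel_left(1)[OF Q] unitary_cancel_right(2)[OF Q] .
    qed
    ultimately show ?thesis unfolding eq M by metis
  qed
  have be: "continuous_on UNIV (block_embed i j :: complex^2^2 \<Rightarrow> complex^'n^'n)"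
    unfolding block_embed_def
  proof (intro continuous_on_vec_lambda)
    fix k l :: 'n
    show "continuous_on UNIV (\<lambda>M::complex^2^2. if k \<in> {i, j} \<and> l \<in> {i, j}
        then M $ (if k = i then 1 else 2) $ (if l = i then 1 else 2) else mat 1 $ k $ l)"
    proof (cases "k \<in> {i, j} \<and> l \<in> {i, j}")
      case True
      then show ?thesis by (simp only: True simp_thms if_True) (intro continuous_on_component continuous_on_id)
    next
      case False
      then show ?thesis by (simp only: False if_False continuous_on_const)
    qed
  qed
  have "continuous_on UNIV (\<lambda>u. conj_transpose Q ** u ** Q)"
    by (intro continuous_on_matrix_mult continuous_on_const continuous_on_id)
  then show "continuous_on UNIV (embed_unitary J i j)"
    unfolding eq[abs_def] by (rule continuous_on_compose2[OF be]) simp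
qed

subsection \<open>The transition kernel\<close>

lemma space_unitary_borel [simp]: "space unitary_borel = unitary_group"
  by (simp add: space_restrict_space)

lemma measurable_unitary_borel_iff:
  "f \<in> measurable M unitary_borel \<longleftrightarrow> f \<in> borel_measurable M \<and> f \<in> space M \<rightarrow> unitary_group"
  by (rule measurable_restrict_space2_iff)

lemma measurable_unitary_mult:
  fixes f g :: "'a \<Rightarrow> complex^'n^'n"
  assumes "f \<in> measurable M unitary_borel" "g \<in> measurable M unitary_borel"
  shows "(\<lambda>x. f x ** g x) \<in> measurable M unitary_borel"
proof -
  have "continuous_on UNIV (\<lambda>z. fst z ** snd z :: complex^'n^'n)"
    by (intro continuous_on_matrix_mult continuous_on_fst continuous_on_snd continuous_on_id)
  with assms have "(\<lambda>x. f x ** g x) \<in> borel_measurable M"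
    unfolding measurable_unitary_borel_iff
    by (intro borel_measurable_continuous_Pair[where H = "(**)"]) simp_all
  then show ?thesis
    using assms unfolding measurable_unitary_borel_iff by (auto intro: unitary_group_mult)
qed

text \<open>Continuity of the distance is known on pairs of unitary matrices only, so the pair map
  is read as a map into the Borel space restricted to them.\<close>

lemma measurable_continuous_on_unitary_pair:
  fixes f g :: "'a \<Rightarrow> complex^'n^'n" and h :: "(complex^'n^'n) \<times> (complex^'n^'n) \<Rightarrow> 'b::topological_space"
  assumes "f \<in> measurable M unitary_borel" "g \<in> measurable M unitary_borel"
    and h: "continuous_on (unitary_group \<times> unitary_group) h"
  shows "(\<lambda>x. h (f x, g x)) \<in> borel_measurable M"
proof (rule measurable_compose[OF _ borel_measurable_continuous_on_restrict[OF h]])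
  have "(\<lambda>x. (f x, g x)) \<in> borel_measurable M"
    using assms unfolding measurable_unitary_borel_iff by (intro borel_measurable_Pair) auto
  then show "(\<lambda>x. (f x, g x)) \<in> M \<rightarrow>\<^sub>M restrict_space borel (unitary_group \<times> unitary_group)"
    using assms(1,2) unfolding measurable_restrict_space2_iff measurable_unitary_borel_iff by auto
qed

lemma borel_measurable_riemann_dist:
  fixes f g :: "'a \<Rightarrow> complex^'n^'n"
  assumes "f \<in> measurable M unitary_borel" "g \<in> measurable M unitary_borel"
  shows "(\<lambda>x. riemann_dist (f x) (g x)) \<in> borel_measurable M"
  using measurable_continuous_on_unitary_pair[OF assms continuous_on_riemann_dist] by simp

lemma card_ordered_pairs:
  "card (ordered_pairs :: ('n::{finite,linorder} \<times> 'n) set) = CARD('n) choose 2"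
proof -
  have "bij_betw (\<lambda>(i, j). {i, j}) (ordered_pairs :: ('n \<times> 'n) set) {S. S \<subseteq> UNIV \<and> card S = 2}"
    unfolding bij_betw_def
  proof
    show "inj_on (\<lambda>(i, j). {i, j}) (ordered_pairs :: ('n \<times> 'n) set)"
      by (auto simp: inj_on_def doubleton_eq_iff)
    have *: "\<exists>i j. i < j \<and> S = {i, j}" if S: "card S = 2" for S :: "'n set"
    proof -
      obtain a b where "S = {a, b}" "a \<noteq> b" using S by (auto simp: card_2_iff)
      then show ?thesis
        by (intro exI[of _ "min a b"] exI[of _ "max a b"]) (auto simp: min_def max_def)
    qed
    show "(\<lambda>(i, j). {i, j}) ` (ordered_pairs :: ('n \<times> 'n) set) = {S. S \<subseteq> UNIV \<and> card S = 2}"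
    proof (intro equalityI subsetI)
      fix S assume "S \<in> {S :: 'n set. S \<subseteq> UNIV \<and> card S = 2}"
      then obtain i j where "i < j" "S = {i, j}" using * by blast
      then show "S \<in> (\<lambda>(i, j). {i, j}) ` (ordered_pairs :: ('n \<times> 'n) set)"
        by (intro image_eqI[of _ _ "(i, j)"]) auto
    qed auto
  qed
  from bij_betw_same_card[OF this] show ?thesis using n_subsets[of "UNIV :: 'n set" 2] by simp
qed

section \<open>One step of the walk as multiplication by a random rotation\<close>

locale kac_walk =
  fixes I :: "'n::{finite,linorder} \<Rightarrow> 'n \<Rightarrow> complex^'n::{finite,linorder} \<Rightarrow> complex^2"
    and H :: "(complex^2^2) measure"
  assumes dim_ge_2: "CARD('n) \<ge> 2"
    and isometry: "\<And>i j. i < j \<Longrightarrow> complex_linear_isometry_on (coord_span i j) (I i j)"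
    and haar: "haar_prob H"
begin

abbreviation pairs :: "('n \<times> 'n) set" where "pairs \<equiv> ordered_pairs"
abbreviation UB :: "(complex^'n::{finite,linorder}^'n::{finite,linorder}) measure" where
  "UB \<equiv> unitary_borel"

definition rotation :: "('n \<times> 'n) \<times> (complex^2^2) \<Rightarrow> complex^'n::{finite,linorder}^'n::{finite,linorder}" where
  "rotation q = embed_unitary (I (fst (fst q)) (snd (fst q))) (fst (fst q)) (snd (fst q)) (snd q)"

text \<open>The randomness of one step, separated from the current state so that one sample can
  drive two copies of the chain.\<close>

definition rotation_law :: "(('n \<times> 'n) \<times> (complex^2^2)) measure" where
  "rotation_law = uniform_count_measure pairs \<Otimes>\<^sub>M H"

lemma card_pairs_ge_1: "real (card pairs) \<ge> 1"
proof -
  have "0 < CARD('n) choose 2" using dim_ge_2 by (simp add: zero_less_binomial_iff)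
  then show ?thesis unfolding card_ordered_pairs by linarith
qed

lemma pairs_nonempty: "pairs \<noteq> {}"
  using card_pairs_ge_1 by fastforce

lemma prob_space_H: "prob_space H" and sets_H: "sets H = sets unitary_borel"
  using haar by (auto simp: haar_prob_def borel_prob_on_unitary_def)

lemma prob_space_rotation_law: "prob_space rotation_law"
proof -
  interpret H: prob_space H by (rule prob_space_H)
  interpret P: prob_space "uniform_count_measure pairs"
    using pairs_nonempty by (intro prob_space_uniform_count_measure) auto
  interpret PH: pair_prob_space "uniform_count_measure pairs" H ..
  show ?thesis unfolding rotation_law_def by (rule PH.prob_space_axioms)
qed

lemma embed_measurable:
  assumes "p \<in> pairs"
  shows "(\<lambda>R. rotation (p, R)) \<in> measurable H UB"
proof -
  have p: "fst p \<noteq> snd p" "complex_linear_isometry_on (coord_span (fst p) (snd p)) (I (fst p) (snd p))"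
    using assms isometry by auto
  have "(\<lambda>R. rotation (p, R)) \<in> measurable unitary_borel UB"
    unfolding measurable_unitary_borel_iff rotation_def fst_conv snd_conv
    by (intro conjI borel_measurable_continuous_on_restrict
        continuous_on_subset[OF continuous_on_embed_unitary[OF p]])
      (auto intro: embed_unitary_mem[OF p])
  then show ?thesis by (simp cong: measurable_cong_sets add: sets_H)
qed

text \<open>There are finitely many pairs, so joint measurability reduces to that of each
  embedding.\<close>

lemma rotation_measurable: "rotation \<in> measurable rotation_law UB"
proof -
  have "rotation \<in> measurable (count_space pairs \<Otimes>\<^sub>M H) UB"
    by (rule measurable_pair_measure_countable1) (auto intro: embed_measurable countable_finite)
  moreover have "sets rotation_law = sets (count_space pairs \<Otimes>\<^sub>M H)"
    unfolding rotation_law_def by (rule sets_pair_measure_cong) (auto simp: sets_uniform_count_measure)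
  ultimately show ?thesis by (simp cong: measurable_cong_sets)
qed

lemma rotation_unitary: "q \<in> space rotation_law \<Longrightarrow> rotation q \<in> unitary_group"
  using measurable_space[OF rotation_measurable] by simp

lemma nn_integral_rotation_law:
  assumes "f \<in> borel_measurable rotation_law"
  shows "(\<integral>\<^sup>+q. f q \<partial>rotation_law) = (\<Sum>p\<in>pairs. \<integral>\<^sup>+R. f (p, R) \<partial>H) / of_nat (card pairs)"
proof -
  interpret H: prob_space H by (rule prob_space_H)
  have "(\<integral>\<^sup>+q. f q \<partial>rotation_law) = (\<integral>\<^sup>+p. \<integral>\<^sup>+R. f (p, R) \<partial>H \<partial>uniform_count_measure pairs)"
    using assms unfolding rotation_law_def by (rule H.nn_integral_fst[symmetric])
  also have "\<dots> = (\<Sum>p\<in>pairs. (\<integral>\<^sup>+R. f (p, R) \<partial>H) * ennreal (1 / real (card pairs)))"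
    unfolding uniform_count_measure_def by (subst nn_integral_point_measure_finite) (auto simp: mult.commute)
  also have "\<dots> = (\<Sum>p\<in>pairs. \<integral>\<^sup>+R. f (p, R) \<partial>H) / of_nat (card pairs)"
    unfolding sum_distrib_right[symmetric] divide_ennreal_def using card_pairs_ge_1
    by (simp add: inverse_ennreal[symmetric] ennreal_of_nat_eq_real_of_nat divide_inverse)
  finally show ?thesis .
qed

lemma rotate_measurable:
  assumes "f \<in> measurable M UB"
  shows "(\<lambda>(x, q). rotation q ** f x) \<in> measurable (M \<Otimes>\<^sub>M rotation_law) UB"
  unfolding split_def
  by (intro measurable_unitary_mult measurable_compose[OF measurable_snd rotation_measurable]
      measurable_compose[OF measurable_fst assms])

lemma rotate_measurable':
  assumes "x \<in> unitary_group"
  shows "(\<lambda>q. rotation q ** x) \<in> measurable rotation_law UB"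
  using assms by (intro measurable_unitary_mult rotation_measurable measurable_const) simp

text \<open>\<open>measure_of\<close> returns the given set function only if it is a measure;
  agreement with a push-forward on all Borel sets secures this.\<close>

lemma kac_kernel_eq_distr:
  assumes x: "x \<in> unitary_group"
  shows "kac_kernel I H x = distr rotation_law UB (\<lambda>q. rotation q ** x)"
proof -
  let ?D = "distr rotation_law UB (\<lambda>q. rotation q ** x)"
  have eq: "(\<Sum>(i, j)\<in>{(i, j). i < j}.
        \<integral>\<^sup>+R. emeasure (return unitary_borel (embed_unitary (I i j) i j R ** x)) S \<partial>H)
          / of_nat (CARD('n) choose 2) = emeasure ?D S" if S: "S \<in> sets UB" for S
  proof -
    have "emeasure ?D S = (\<integral>\<^sup>+z. indicator S z \<partial>?D)" using S by simp
    also have "\<dots> = (\<integral>\<^sup>+q. indicator S (rotation q ** x) \<partial>rotation_law)"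
      using S by (intro nn_integral_distr rotate_measurable'[OF x]) simp
    also have "\<dots> = (\<Sum>p\<in>pairs. \<integral>\<^sup>+R. indicator S (rotation (p, R) ** x) \<partial>H) / of_nat (card pairs)"
      using S by (intro nn_integral_rotation_law measurable_compose[OF rotate_measurable'[OF x]]) simp
    also have "(\<Sum>p\<in>pairs. \<integral>\<^sup>+R. indicator S (rotation (p, R) ** x) \<partial>H) =
        (\<Sum>(i, j)\<in>{(i, j). i < j}.
          \<integral>\<^sup>+R. emeasure (return unitary_borel (embed_unitary (I i j) i j R ** x)) S \<partial>H)"
      using S unfolding split_def by (intro sum.cong refl nn_integral_cong) (simp add: rotation_def)
    finally show ?thesis by (simp add: card_ordered_pairs)
  qed
  have sg: "sigma_sets unitary_group (sets UB) = sets UB"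
    using sets.sigma_sets_eq[of UB] by simp
  have "kac_kernel I H x = measure_of unitary_group (sets UB) (emeasure ?D)"
    unfolding kac_kernel_def
    by (rule measure_of_eq) (use sets.space_closed[of UB] eq in \<open>auto simp: sg\<close>)
  also have "\<dots> = measure_of (space ?D) (sets ?D) (emeasure ?D)" by simp
  also have "\<dots> = ?D" by (rule measure_of_of_measure)
  finally show ?thesis .
qed

text \<open>The condition under which the bind in \<open>kernel_iterate\<close> really integrates
  the kernel.\<close>

lemma kac_kernel_measurable: "kac_kernel I H \<in> measurable UB (subprob_algebra UB)"
proof -
  have "(\<lambda>x. distr rotation_law UB (\<lambda>q. rotation q ** x)) \<in> measurable UB (subprob_algebra UB)"
  proof (rule measurable_distr2)
    show "(\<lambda>(x, q). rotation q ** x) \<in> UB \<Otimes>\<^sub>M rotation_law \<rightarrow>\<^sub>M UB"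
      by (rule rotate_measurable) simp
    show "(\<lambda>x. rotation_law) \<in> UB \<rightarrow>\<^sub>M subprob_algebra rotation_law"
      using prob_space_rotation_law
      by (intro measurable_const) (simp add: space_subprob_algebra prob_space_imp_subprob_space)
  qed
  then show ?thesis
    by (subst measurable_cong[where g = "\<lambda>x. distr rotation_law UB (\<lambda>q. rotation q ** x)"])
      (simp_all add: kac_kernel_eq_distr)
qed

lemma emeasure_kac_kernel:
  assumes "x \<in> unitary_group" "S \<in> sets UB"
  shows "emeasure (kac_kernel I H x) S = (\<integral>\<^sup>+q. indicator S (rotation q ** x) \<partial>rotation_law)"
proof -
  have "emeasure (kac_kernel I H x) S = (\<integral>\<^sup>+z. indicator S z \<partial>kac_kernel I H x)"
    using assms by (simp add: kac_kernel_eq_distr)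
  then show ?thesis
    unfolding kac_kernel_eq_distr[OF assms(1)]
    using assms by (subst (asm) nn_integral_distr) (auto intro: rotate_measurable')
qed

lemma nn_integral_haar_right:
  assumes R0: "R0 \<in> unitary_group" and f: "f \<in> borel_measurable H"
  shows "(\<integral>\<^sup>+R. f (R ** R0) \<partial>H) = (\<integral>\<^sup>+R. f R \<partial>H)"
proof -
  have "(\<lambda>R. R ** R0) \<in> measurable unitary_borel unitary_borel"
    using R0 by (intro measurable_unitary_mult measurable_const) auto
  then have m: "(\<lambda>R. R ** R0) \<in> measurable H H" by (simp cong: measurable_cong_sets add: sets_H)
  have "distr H H (\<lambda>R. R ** R0) = H" using haar R0 by (simp add: haar_prob_def)
  then have "(\<integral>\<^sup>+R. f R \<partial>H) = (\<integral>\<^sup>+R. f R \<partial>distr H H (\<lambda>R. R ** R0))" by simp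
  also have "\<dots> = (\<integral>\<^sup>+R. f (R ** R0) \<partial>H)" using m f by (intro nn_integral_distr) simp_all
  finally show ?thesis by simp
qed

text \<open>Each \<open>V p\<close> is the embedding of some element of U(2), and right
  multiplication by that element preserves \<open>H\<close>. The block may vary with the pair but
  not with the rotation. This will restore the second marginal of the coupling.\<close>

lemma rotation_absorbs_block:
  assumes V: "\<And>p. p \<in> pairs \<Longrightarrow> V p \<in> unitary_group" "\<And>p. p \<in> pairs \<Longrightarrow> is_block (fst p) (snd p) (V p)"
    and x: "x \<in> unitary_group" and f: "f \<in> borel_measurable UB"
  shows "(\<integral>\<^sup>+q. f (rotation q ** (V (fst q) ** x)) \<partial>rotation_law)
    = (\<integral>\<^sup>+q. f (rotation q ** x) \<partial>rotation_law)"
proof -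
  have Vm: "(\<lambda>q. V (fst q)) \<in> measurable rotation_law UB"
    unfolding rotation_law_def
    by (rule measurable_compose[OF measurable_fst])
      (use V(1) in \<open>auto simp: measurable_def sets_uniform_count_measure space_uniform_count_measure\<close>)
  have "(\<lambda>q. rotation q ** (V (fst q) ** x)) \<in> measurable rotation_law UB"
    using x by (intro measurable_unitary_mult rotation_measurable Vm measurable_const) simp
  note m1 = measurable_compose[OF this f]
  note m2 = measurable_compose[OF rotate_measurable'[OF x] f]
  have "(\<integral>\<^sup>+R. f (rotation (p, R) ** (V p ** x)) \<partial>H) = (\<integral>\<^sup>+R. f (rotation (p, R) ** x) \<partial>H)"
    if p: "p \<in> pairs" for p
  proof -
    have ij: "fst p \<noteq> snd p" "complex_linear_isometry_on (coord_span (fst p) (snd p)) (I (fst p) (snd p))"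
      using p isometry by auto
    obtain R0 where R0: "R0 \<in> unitary_group" "embed_unitary (I (fst p) (snd p)) (fst p) (snd p) R0 = V p"
      using embed_unitary_surj[OF ij V(1,2)[OF p]] by blast
    have "rotation (p, R) ** (V p ** x) = rotation (p, R ** R0) ** x" for R
      by (simp add: rotation_def embed_unitary_mult[OF ij] R0(2) matrix_mul_assoc)
    moreover have "(\<lambda>R. f (rotation (p, R) ** x)) \<in> borel_measurable H"
      using x by (intro measurable_compose[OF _ f] measurable_unitary_mult embed_measurable[OF p]
          measurable_const) simp
    ultimately show ?thesis
      using nn_integral_haar_right[OF R0(1), of "\<lambda>R. f (rotation (p, R) ** x)"] by simp
  qed
  then show ?thesis
    unfolding nn_integral_rotation_law[OF m1] nn_integral_rotation_law[OF m2] by simp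
qed

lemma kac_step:
  assumes "borel_prob_on_unitary \<mu>"
  shows "borel_prob_on_unitary (\<mu> \<bind> kac_kernel I H)"
    and "S \<in> sets UB \<Longrightarrow> emeasure (\<mu> \<bind> kac_kernel I H) S =
      (\<integral>\<^sup>+x. \<integral>\<^sup>+q. indicator S (rotation q ** x) \<partial>rotation_law \<partial>\<mu>)"
proof -
  interpret \<mu>: prob_space \<mu> using assms by (simp add: borel_prob_on_unitary_def)
  interpret Q: prob_space rotation_law by (rule prob_space_rotation_law)
  have sets: "sets \<mu> = sets UB" using assms by (simp add: borel_prob_on_unitary_def)
  then have sp: "space \<mu> = unitary_group" using sets_eq_imp_space_eq[OF sets] by simp
  have m: "kac_kernel I H \<in> measurable \<mu> (subprob_algebra UB)"
    using kac_kernel_measurable by (simp cong: measurable_cong_sets add: sets)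
  have em: "emeasure (\<mu> \<bind> kac_kernel I H) S =
      (\<integral>\<^sup>+x. \<integral>\<^sup>+q. indicator S (rotation q ** x) \<partial>rotation_law \<partial>\<mu>)" if "S \<in> sets UB" for S
    unfolding emeasure_bind[OF \<mu>.not_empty m that]
    using that by (intro nn_integral_cong) (simp add: emeasure_kac_kernel sp)
  have s: "sets (\<mu> \<bind> kac_kernel I H) = sets UB"
    by (rule sets_bind_measurable[OF m \<mu>.not_empty])
  have "emeasure (\<mu> \<bind> kac_kernel I H) unitary_group = 1"
  proof -
    have "(\<integral>\<^sup>+x. \<integral>\<^sup>+q. indicator unitary_group (rotation q ** x) \<partial>rotation_law \<partial>\<mu>) =
        (\<integral>\<^sup>+x. \<integral>\<^sup>+q. 1 \<partial>rotation_law \<partial>\<mu>)"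
      by (intro nn_integral_cong) (simp add: sp unitary_group_mult rotation_unitary)
    also have "\<dots> = 1" by (simp add: Q.emeasure_space_1 \<mu>.emeasure_space_1)
    finally show ?thesis using em[of unitary_group] sets.top[of UB] by simp
  qed
  then have "prob_space (\<mu> \<bind> kac_kernel I H)"
    using sets_eq_imp_space_eq[OF s] by (intro prob_spaceI) simp
  with s show "borel_prob_on_unitary (\<mu> \<bind> kac_kernel I H)" by (simp add: borel_prob_on_unitary_def)
  show "emeasure (\<mu> \<bind> kac_kernel I H) S =
      (\<integral>\<^sup>+x. \<integral>\<^sup>+q. indicator S (rotation q ** x) \<partial>rotation_law \<partial>\<mu>)" if "S \<in> sets UB"
    using that by (rule em)
qed

text \<open>Fubini, then left invariance of \<H> for each fixed rotation. Stationarity keeps the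
  second marginal of the iterated coupling at \<H>.\<close>

lemma haar_invariant:
  assumes "haar_prob \<H>"
  shows "\<H> \<bind> kac_kernel I H = \<H>"
proof -
  have bp: "borel_prob_on_unitary \<H>" using assms by (simp add: haar_prob_def)
  then have sets: "sets \<H> = sets UB" by (simp add: borel_prob_on_unitary_def)
  interpret \<H>: prob_space \<H> using bp by (simp add: borel_prob_on_unitary_def)
  interpret Q: prob_space rotation_law by (rule prob_space_rotation_law)
  interpret HQ: pair_prob_space \<H> rotation_law ..
  note step = kac_step[OF bp]
  show ?thesis
  proof (rule measure_eqI)
    show "sets (\<H> \<bind> kac_kernel I H) = sets \<H>"
      using step(1) sets by (simp add: borel_prob_on_unitary_def)
    fix S assume "S \<in> sets (\<H> \<bind> kac_kernel I H)"
    then have S: "S \<in> sets UB" using step(1) by (simp add: borel_prob_on_unitary_def)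
    have id: "(\<lambda>x. x) \<in> measurable \<H> UB" by (simp cong: measurable_cong_sets add: sets)
    have "(\<lambda>z. indicator S ((\<lambda>(x, q). rotation q ** x) z)) \<in> borel_measurable (\<H> \<Otimes>\<^sub>M rotation_law)"
      using S by (intro measurable_compose[OF rotate_measurable[OF id]]) simp
    then have "(\<integral>\<^sup>+x. \<integral>\<^sup>+q. indicator S (rotation q ** x) \<partial>rotation_law \<partial>\<H>) =
        (\<integral>\<^sup>+q. \<integral>\<^sup>+x. indicator S (rotation q ** x) \<partial>\<H> \<partial>rotation_law)"
      by (intro HQ.Fubini'[symmetric]) (simp add: split_def)
    also have "\<dots> = (\<integral>\<^sup>+q. emeasure \<H> S \<partial>rotation_law)"
    proof (rule nn_integral_cong)
      fix q assume "q \<in> space rotation_law"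
      then have R: "rotation q \<in> unitary_group" by (rule rotation_unitary)
      have "(\<lambda>x. rotation q ** x) \<in> measurable UB UB"
        using R by (intro measurable_unitary_mult measurable_const) auto
      then have m: "(\<lambda>x. rotation q ** x) \<in> measurable \<H> \<H>"
        by (simp cong: measurable_cong_sets add: sets)
      have "emeasure \<H> S = emeasure (distr \<H> \<H> (\<lambda>x. rotation q ** x)) S"
        using assms R by (simp add: haar_prob_def)
      also have "\<dots> = (\<integral>\<^sup>+x. indicator S x \<partial>distr \<H> \<H> (\<lambda>x. rotation q ** x))"
        using S sets by simp
      also have "\<dots> = (\<integral>\<^sup>+x. indicator S (rotation q ** x) \<partial>\<H>)"
        using S sets by (intro nn_integral_distr m) simp
      finally show "(\<integral>\<^sup>+x. indicator S (rotation q ** x) \<partial>\<H>) = emeasure \<H> S" by simp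
    qed
    also have "\<dots> = emeasure \<H> S" by (simp add: Q.emeasure_space_1)
    finally show "emeasure (\<H> \<bind> kac_kernel I H) S = emeasure \<H> S" using step(2)[OF S] by simp
  qed
qed

end

subsection \<open>Contraction of the transportation cost\<close>

text \<open>Near an optimal choice of blocks at one point the same blocks remain almost optimal, so by
  compactness finitely many choices suffice; this avoids a measurable selection theorem.\<close>

lemma measurable_block_selection:
  fixes \<theta> :: real
  assumes n: "CARD('n) \<ge> 2" and \<theta>: "\<theta> > 0"
  obtains V :: "'n::{finite,linorder} \<times> 'n \<Rightarrow>
      (complex^'n::{finite,linorder}^'n::{finite,linorder}) \<times> (complex^'n::{finite,linorder}^'n::{finite,linorder})
      \<Rightarrow> complex^'n::{finite,linorder}^'n::{finite,linorder}"
  where "\<And>p. V p \<in> measurable (unitary_borel \<Otimes>\<^sub>M unitary_borel) unitary_borel"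
    "\<And>p z. is_block (fst p) (snd p) (V p z)"
    "\<And>x y. x \<in> unitary_group \<Longrightarrow> y \<in> unitary_group \<Longrightarrow>
      (\<Sum>p\<in>ordered_pairs. (riemann_dist x (V p (x, y) ** y))\<^sup>2)
      \<le> (real (card (ordered_pairs :: ('n \<times> 'n) set)) - 1) * (riemann_dist x y)\<^sup>2 + \<theta>"
proof -
  let ?U = "unitary_group :: (complex^'n::{finite,linorder}^'n::{finite,linorder}) set"
  let ?P = "ordered_pairs :: ('n \<times> 'n) set"
  let ?N = "real (card ?P) - 1"
  let ?B = "unitary_borel :: (complex^'n::{finite,linorder}^'n::{finite,linorder}) measure"
  \<comment> \<open>The excess of the summed cost with blocks W over the contracted cost, to be kept
    below \<theta>.\<close>
  define G where "G W z = (\<Sum>p\<in>?P. (riemann_dist (fst z) (W p ** snd z))\<^sup>2) - ?N * (riemann_dist (fst z) (snd z))\<^sup>2"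
    for W and z :: "(complex^'n::{finite,linorder}^'n::{finite,linorder}) \<times> (complex^'n::{finite,linorder}^'n::{finite,linorder})"
  have ex: "\<exists>W. (\<forall>p. W p \<in> ?U \<and> is_block (fst p) (snd p) (W p)) \<and> G W z < \<theta>"
    if z: "z \<in> ?U \<times> ?U" for z
  proof -
    let ?D = "riemann_dist (fst z) (snd z)"
    \<comment> \<open>The bound of \<open>block_contraction\<close> is continuous in its error e, so
      a small e gives a strict inequality with \<theta>.\<close>
    have "((\<lambda>e. ?N * (?D + e)\<^sup>2) \<longlongrightarrow> ?N * (?D + 0)\<^sup>2) (at_right 0)"
      by (intro tendsto_intros)
    then have "eventually (\<lambda>e. ?N * (?D + e)\<^sup>2 < ?N * ?D\<^sup>2 + \<theta>) (at_right 0)"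
      using \<theta> by (intro order_tendstoD(2)) auto
    then have "eventually (\<lambda>e::real. 0 < e \<and> ?N * (?D + e)\<^sup>2 < ?N * ?D\<^sup>2 + \<theta>) (at_right 0)"
      using eventually_at_right_less[of "0::real"] by eventually_elim auto
    then obtain e :: real where e: "e > 0" "?N * (?D + e)\<^sup>2 < ?N * ?D\<^sup>2 + \<theta>"
      using eventually_happens' trivial_limit_at_right_real by blast
    have z': "fst z \<in> ?U" "snd z \<in> ?U" using z by auto
    obtain V where V: "\<And>i j. V i j \<in> ?U" "\<And>i j. is_block i j (V i j)"
      "(\<Sum>(i, j)\<in>?P. (riemann_dist (fst z) (V i j ** snd z))\<^sup>2) \<le> ?N * (?D + e)\<^sup>2"
      by (rule block_contraction[OF n z' e(1)]) blast
    then show ?thesis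
      using e(2) by (intro exI[of _ "\<lambda>p. V (fst p) (snd p)"]) (auto simp: G_def split_def)
  qed
  define W where "W z = (SOME W. (\<forall>p. W p \<in> ?U \<and> is_block (fst p) (snd p) (W p)) \<and> G W z < \<theta>)" for z
  have W: "W z p \<in> ?U" "is_block (fst p) (snd p) (W z p)" "G (W z) z < \<theta>"
    if "z \<in> ?U \<times> ?U" for z p
    using someI_ex[OF ex[OF that]] unfolding W_def by blast+
  have Gcont: "continuous_on (?U \<times> ?U) (G (W z0))" if z0: "z0 \<in> ?U \<times> ?U" for z0
    unfolding G_def
  proof (intro continuous_intros)
    show "continuous_on (?U \<times> ?U) (\<lambda>z. riemann_dist (fst z) (snd z))"
      by (rule continuous_on_riemann_dist)
    fix p
    have "continuous_on (?U \<times> ?U) (\<lambda>z. (fst z, W z0 p ** snd z))"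
      by (intro continuous_on_Pair continuous_on_matrix_mult continuous_on_fst continuous_on_snd
          continuous_on_id continuous_on_const)
    moreover have "(\<lambda>z. (fst z, W z0 p ** snd z)) ` (?U \<times> ?U) \<subseteq> ?U \<times> ?U"
      using W(1)[OF z0, of p] by (auto intro: unitary_group_mult)
    ultimately show "continuous_on (?U \<times> ?U) (\<lambda>z. riemann_dist (fst z) (W z0 p ** snd z))"
      using continuous_on_compose2[OF continuous_on_riemann_dist] by fastforce
  qed
  have "compact (?U \<times> ?U)" by (intro compact_Times compact_unitary_group)
  define O' where "O' z0 = {z \<in> ?U \<times> ?U. G (W z0) z < \<theta>}" for z0
  have "openin (top_of_set (?U \<times> ?U)) (O' z0)" if z0: "z0 \<in> ?U \<times> ?U" for z0
  proof -
    have "O' z0 = (?U \<times> ?U) \<inter> G (W z0) -` {..<\<theta>}" by (auto simp: O'_def)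
    then show ?thesis using continuous_openin_preimage_gen[OF Gcont[OF z0]] by simp
  qed
  moreover have "?U \<times> ?U \<subseteq> \<Union>(O' ` (?U \<times> ?U))" using W(3) by (auto simp: O'_def)
  ultimately obtain D where D: "D \<subseteq> O' ` (?U \<times> ?U)" "finite D" "?U \<times> ?U \<subseteq> \<Union>D"
    using \<open>compact (?U \<times> ?U)\<close>[unfolded compact_eq_openin_cover, rule_format, of "O' ` (?U \<times> ?U)"]
    by blast
  obtain Z where Z: "Z \<subseteq> ?U \<times> ?U" "finite Z" "D = O' ` Z" using D(1,2) by (meson finite_subset_image)
  obtain zs where zs: "set zs = Z" using finite_list[OF Z(2)] by blast
  define Q where "Q k z \<longleftrightarrow> k < length zs \<and> G (W (zs ! k)) z < \<theta>" for k z
  \<comment> \<open>The first listed choice that works at z; a least index among measurable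
    conditions is measurable, and its values are discrete.\<close>
  define K where "K z = (LEAST k. Q k z)" for z
  \<comment> \<open>The default \<open>mat 1\<close> covers z outside the group, where the least
    index is unspecified, and keeps the block property for all z.\<close>
  define V where "V p z = (if K z < length zs then W (zs ! K z) p else mat 1)" for p z
  have zsU: "zs ! k \<in> ?U \<times> ?U" if "k < length zs" for k using that zs Z(1) nth_mem by blast
  have QK: "Q (K z) z" if "z \<in> ?U \<times> ?U" for z
  proof -
    have "z \<in> \<Union>(O' ` set zs)" using that D(3) Z(3) zs by auto
    then obtain z0 where "z0 \<in> set zs" "z \<in> O' z0" by blast
    then obtain k where "Q k z" by (auto simp: Q_def O'_def in_set_conv_nth)
    then show ?thesis unfolding K_def by (rule LeastI)
  qed
  have Qm: "Measurable.pred (?B \<Otimes>\<^sub>M ?B) (Q k)" for k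
  proof (cases "k < length zs")
    case True
    have "(\<lambda>z. G (W (zs ! k)) (fst z, snd z)) \<in> borel_measurable (?B \<Otimes>\<^sub>M ?B)"
      by (rule measurable_continuous_on_unitary_pair[OF _ _ Gcont[OF zsU[OF True]]])
        (rule measurable_fst, rule measurable_snd)
    then have "G (W (zs ! k)) \<in> borel_measurable (?B \<Otimes>\<^sub>M ?B)" by simp
    then have "{z \<in> space (?B \<Otimes>\<^sub>M ?B). G (W (zs ! k)) z < \<theta>} \<in> sets (?B \<Otimes>\<^sub>M ?B)" by measurable
    then show ?thesis using True unfolding Q_def by (simp add: pred_def)
  next
    case False
    then show ?thesis by (simp add: Q_def[abs_def])
  qed
  have Km: "K \<in> measurable (?B \<Otimes>\<^sub>M ?B) (count_space UNIV)"
    unfolding K_def[abs_def] by (rule measurable_Least[OF Qm])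
  show ?thesis
  proof (rule that)
    show "V p \<in> measurable (?B \<Otimes>\<^sub>M ?B) ?B" for p
      unfolding V_def
      by (rule measurable_compose[OF Km]) (use W(1)[OF zsU] in auto)
    show "is_block (fst p) (snd p) (V p z)" for p z
      using W(2)[OF zsU] by (auto simp: V_def is_block_mat_1)
    fix x y assume xy: "x \<in> ?U" "y \<in> ?U"
    then have "Q (K (x, y)) (x, y)" by (intro QK) auto
    then have "V p (x, y) = W (zs ! K (x, y)) p" "G (W (zs ! K (x, y))) (x, y) < \<theta>" for p
      by (auto simp: V_def Q_def)
    then show "(\<Sum>p\<in>?P. (riemann_dist x (V p (x, y) ** y))\<^sup>2) \<le> ?N * (riemann_dist x y)\<^sup>2 + \<theta>"
      by (simp add: G_def)
  qed
qed

text \<open>A nonnegative integral, so that integrability is settled only once, at the end, from the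
  finite bound.\<close>

definition transport_cost ::
    "((complex^'n^'n) \<times> (complex^'n^'n)) measure \<Rightarrow> ennreal" where
  "transport_cost \<eta> = (\<integral>\<^sup>+z. ennreal ((riemann_dist (fst z) (snd z))\<^sup>2) \<partial>\<eta>)"

text \<open>Unlike in \<open>couplings\<close> the target space is \<open>unitary_borel\<close>
  rather than the marginals, so measurability facts do not change with \<mu> and \<nu>.\<close>

definition coupling_of ::
    "((complex^'n^'n) \<times> (complex^'n^'n)) measure \<Rightarrow> (complex^'n^'n) measure \<Rightarrow> (complex^'n^'n) measure \<Rightarrow> bool"
  where "coupling_of \<eta> \<mu> \<nu> \<longleftrightarrow> prob_space \<eta> \<and> sets \<eta> = sets (unitary_borel \<Otimes>\<^sub>M unitary_borel) \<and>
     distr \<eta> unitary_borel fst = \<mu> \<and> distr \<eta> unitary_borel snd = \<nu>"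

context kac_walk
begin

text \<open>The first copy moves by R, the second by R V for the same pair and the same R, with V
  chosen from the pair and the coupled points. Absorption of V gives the second marginal; \<theta>
  pays for the approximate choice of V.\<close>

lemma kac_coupling_step:
  fixes \<theta> :: real
  assumes \<eta>: "coupling_of \<eta> \<mu> \<nu>" and \<mu>: "borel_prob_on_unitary \<mu>" and \<nu>: "borel_prob_on_unitary \<nu>"
    and \<theta>: "\<theta> > 0"
  obtains \<eta>' where "coupling_of \<eta>' (\<mu> \<bind> kac_kernel I H) (\<nu> \<bind> kac_kernel I H)"
    "transport_cost \<eta>' \<le> ennreal (1 - 1 / real (card pairs)) * transport_cost \<eta> + ennreal \<theta>"
proof -
  let ?N = "real (card pairs)"
  interpret \<eta>: prob_space \<eta> using \<eta> by (simp add: coupling_of_def)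
  interpret Q: prob_space rotation_law by (rule prob_space_rotation_law)
  interpret \<eta>Q: pair_prob_space \<eta> rotation_law ..
  have s\<eta>: "sets \<eta> = sets (UB \<Otimes>\<^sub>M UB)" using \<eta> by (simp add: coupling_of_def)
  have sp\<eta>: "space \<eta> = unitary_group \<times> unitary_group"
    using sets_eq_imp_space_eq[OF s\<eta>] by (simp add: space_pair_measure)
  obtain V where V: "\<And>p. V p \<in> measurable (UB \<Otimes>\<^sub>M UB) UB" "\<And>p z. is_block (fst p) (snd p) (V p z)"
    "\<And>x y. x \<in> unitary_group \<Longrightarrow> y \<in> unitary_group \<Longrightarrow>
      (\<Sum>p\<in>pairs. (riemann_dist x (V p (x, y) ** y))\<^sup>2) \<le> (?N - 1) * (riemann_dist x y)\<^sup>2 + \<theta>"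
    using measurable_block_selection[OF dim_ge_2 \<theta>] by blast
  have VU: "V p z \<in> unitary_group" if "z \<in> space \<eta>" for p z
    using measurable_space[OF V(1), of z p] that sp\<eta> by (simp add: space_pair_measure)
  have fst\<eta>: "fst \<in> measurable \<eta> UB" and snd\<eta>: "snd \<in> measurable \<eta> UB"
    by (simp_all cong: measurable_cong_sets add: s\<eta>)
  have fst_pairs: "(\<lambda>w. fst (snd w)) \<in> measurable (\<eta> \<Otimes>\<^sub>M rotation_law) (count_space pairs)"
  proof (rule measurable_compose[OF measurable_snd])
    have "fst \<in> measurable rotation_law (uniform_count_measure pairs)"
      unfolding rotation_law_def by (rule measurable_fst)
    moreover have "measurable rotation_law (uniform_count_measure pairs) = measurable rotation_law (count_space pairs)"
      by (rule measurable_cong_sets) (simp_all add: sets_uniform_count_measure)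
    ultimately show "fst \<in> measurable rotation_law (count_space pairs)" by simp
  qed
  \<comment> \<open>The pair takes finitely many values, so measurability of V for each fixed pair
    suffices.\<close>
  have Vm: "(\<lambda>w. V (fst (snd w)) (fst w)) \<in> measurable (\<eta> \<Otimes>\<^sub>M rotation_law) UB"
  proof (rule measurable_compose_countable'[OF _ fst_pairs])
    show "(\<lambda>w. V p (fst w)) \<in> measurable (\<eta> \<Otimes>\<^sub>M rotation_law) UB" for p
    proof (rule measurable_compose[OF measurable_fst])
      show "V p \<in> measurable \<eta> UB" using V(1)[of p] by (simp cong: measurable_cong_sets add: s\<eta>)
    qed
  qed (auto intro: countable_finite)
  define X where "X w = rotation (snd w) ** fst (fst w)"
    for w :: "((complex^'n::{finite,linorder}^'n::{finite,linorder}) \<times> (complex^'n::{finite,linorder}^'n::{finite,linorder}))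
      \<times> ('n \<times> 'n) \<times> (complex^2^2)"
  define Y where "Y w = rotation (snd w) ** (V (fst (snd w)) (fst w) ** snd (fst w))"
    for w :: "((complex^'n::{finite,linorder}^'n::{finite,linorder}) \<times> (complex^'n::{finite,linorder}^'n::{finite,linorder}))
      \<times> ('n \<times> 'n) \<times> (complex^2^2)"
  have rot: "(\<lambda>w. rotation (snd w)) \<in> measurable (\<eta> \<Otimes>\<^sub>M rotation_law) UB"
    by (rule measurable_compose[OF measurable_snd rotation_measurable])
  have Xm: "X \<in> measurable (\<eta> \<Otimes>\<^sub>M rotation_law) UB"
    unfolding X_def by (intro measurable_unitary_mult rot measurable_compose[OF measurable_fst fst\<eta>])
  have Ym: "Y \<in> measurable (\<eta> \<Otimes>\<^sub>M rotation_law) UB"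
    unfolding Y_def by (intro measurable_unitary_mult rot Vm measurable_compose[OF measurable_fst snd\<eta>])
  have XYm: "(\<lambda>w. (X w, Y w)) \<in> measurable (\<eta> \<Otimes>\<^sub>M rotation_law) (UB \<Otimes>\<^sub>M UB)"
    using Xm Ym by (rule measurable_Pair)
  have ind_m: "(\<lambda>x. \<integral>\<^sup>+q. indicator S (rotation q ** x) \<partial>rotation_law) \<in> borel_measurable UB"
    if S: "S \<in> sets UB" for S
  proof -
    have "(\<lambda>z. indicator S ((\<lambda>(x, q). rotation q ** x) z) :: ennreal) \<in> borel_measurable (UB \<Otimes>\<^sub>M rotation_law)"
      using S by (intro measurable_compose[OF rotate_measurable[of "\<lambda>x. x"]]) simp_all
    from Q.borel_measurable_nn_integral_fst[OF this] show ?thesis by simp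
  qed
  define \<eta>' where "\<eta>' = distr (\<eta> \<Otimes>\<^sub>M rotation_law) (UB \<Otimes>\<^sub>M UB) (\<lambda>w. (X w, Y w))"
  have "prob_space \<eta>'" unfolding \<eta>'_def by (rule \<eta>Q.prob_space_distr[OF XYm])
  moreover have "sets \<eta>' = sets (UB \<Otimes>\<^sub>M UB)" by (simp add: \<eta>'_def)
  moreover have "distr \<eta>' UB fst = \<mu> \<bind> kac_kernel I H"
  proof (rule measure_eqI)
    show "sets (distr \<eta>' UB fst) = sets (\<mu> \<bind> kac_kernel I H)"
      using kac_step(1)[OF \<mu>] by (simp add: borel_prob_on_unitary_def)
    fix S assume "S \<in> sets (distr \<eta>' UB fst)"
    then have S: "S \<in> sets UB" by simp
    have "distr \<eta>' UB fst = distr (\<eta> \<Otimes>\<^sub>M rotation_law) UB X"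
      unfolding \<eta>'_def by (subst distr_distr[OF measurable_fst XYm]) (simp add: o_def)
    then have "emeasure (distr \<eta>' UB fst) S = (\<integral>\<^sup>+z. indicator S z \<partial>distr (\<eta> \<Otimes>\<^sub>M rotation_law) UB X)"
      using S by simp
    also have "\<dots> = (\<integral>\<^sup>+w. indicator S (X w) \<partial>(\<eta> \<Otimes>\<^sub>M rotation_law))"
      using S by (intro nn_integral_distr Xm) simp
    also have "\<dots> = (\<integral>\<^sup>+z. \<integral>\<^sup>+q. indicator S (X (z, q)) \<partial>rotation_law \<partial>\<eta>)"
      using S by (intro Q.nn_integral_fst[symmetric] measurable_compose[OF Xm]) simp
    also have "\<dots> = (\<integral>\<^sup>+z. (\<integral>\<^sup>+q. indicator S (rotation q ** fst z) \<partial>rotation_law) \<partial>\<eta>)"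
      by (simp add: X_def)
    also have "\<dots> = (\<integral>\<^sup>+x. (\<integral>\<^sup>+q. indicator S (rotation q ** x) \<partial>rotation_law) \<partial>distr \<eta> UB fst)"
      by (rule nn_integral_distr[symmetric, OF fst\<eta>]) (use ind_m[OF S] in simp)
    also have "\<dots> = emeasure (\<mu> \<bind> kac_kernel I H) S"
      using \<eta> kac_step(2)[OF \<mu> S] by (simp add: coupling_of_def)
    finally show "emeasure (distr \<eta>' UB fst) S = emeasure (\<mu> \<bind> kac_kernel I H) S" .
  qed
  moreover have "distr \<eta>' UB snd = \<nu> \<bind> kac_kernel I H"
  proof (rule measure_eqI)
    show "sets (distr \<eta>' UB snd) = sets (\<nu> \<bind> kac_kernel I H)"
      using kac_step(1)[OF \<nu>] by (simp add: borel_prob_on_unitary_def)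
    fix S assume "S \<in> sets (distr \<eta>' UB snd)"
    then have S: "S \<in> sets UB" by simp
    have "distr \<eta>' UB snd = distr (\<eta> \<Otimes>\<^sub>M rotation_law) UB Y"
      unfolding \<eta>'_def by (subst distr_distr[OF measurable_snd XYm]) (simp add: o_def)
    then have "emeasure (distr \<eta>' UB snd) S = (\<integral>\<^sup>+z. indicator S z \<partial>distr (\<eta> \<Otimes>\<^sub>M rotation_law) UB Y)"
      using S by simp
    also have "\<dots> = (\<integral>\<^sup>+w. indicator S (Y w) \<partial>(\<eta> \<Otimes>\<^sub>M rotation_law))"
      using S by (intro nn_integral_distr Ym) simp
    also have "\<dots> = (\<integral>\<^sup>+z. \<integral>\<^sup>+q. indicator S (Y (z, q)) \<partial>rotation_law \<partial>\<eta>)"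
      using S by (intro Q.nn_integral_fst[symmetric] measurable_compose[OF Ym]) simp
    also have "\<dots> = (\<integral>\<^sup>+z. (\<integral>\<^sup>+q. indicator S (rotation q ** snd z) \<partial>rotation_law) \<partial>\<eta>)"
    proof (rule nn_integral_cong)
      fix z assume z: "z \<in> space \<eta>"
      have "(\<integral>\<^sup>+q. indicator S (rotation q ** (V (fst q) z ** snd z)) \<partial>rotation_law)
          = (\<integral>\<^sup>+q. indicator S (rotation q ** snd z) \<partial>rotation_law)"
        by (rule rotation_absorbs_block[of "\<lambda>p. V p z"])
          (use VU[OF z] V(2) z sp\<eta> S in auto)
      then show "(\<integral>\<^sup>+q. indicator S (Y (z, q)) \<partial>rotation_law)
          = (\<integral>\<^sup>+q. indicator S (rotation q ** snd z) \<partial>rotation_law)" by (simp add: Y_def)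
    qed
    also have "\<dots> = (\<integral>\<^sup>+x. (\<integral>\<^sup>+q. indicator S (rotation q ** x) \<partial>rotation_law) \<partial>distr \<eta> UB snd)"
      by (rule nn_integral_distr[symmetric, OF snd\<eta>]) (use ind_m[OF S] in simp)
    also have "\<dots> = emeasure (\<nu> \<bind> kac_kernel I H) S"
      using \<eta> kac_step(2)[OF \<nu> S] by (simp add: coupling_of_def)
    finally show "emeasure (distr \<eta>' UB snd) S = emeasure (\<nu> \<bind> kac_kernel I H) S" .
  qed
  ultimately have coupling: "coupling_of \<eta>' (\<mu> \<bind> kac_kernel I H) (\<nu> \<bind> kac_kernel I H)"
    by (simp add: coupling_of_def)
  have d2: "(\<lambda>w. ennreal ((riemann_dist (X w) (Y w))\<^sup>2)) \<in> borel_measurable (\<eta> \<Otimes>\<^sub>M rotation_law)"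
    by (intro measurable_compose[OF _ measurable_ennreal] borel_measurable_power
        borel_measurable_riemann_dist Xm Ym)
  have d2': "(\<lambda>z. ennreal ((riemann_dist (fst z) (snd z))\<^sup>2)) \<in> borel_measurable (UB \<Otimes>\<^sub>M UB)"
    by (intro measurable_compose[OF _ measurable_ennreal] borel_measurable_power
        borel_measurable_riemann_dist measurable_fst measurable_snd)
  then have d2\<eta>: "(\<lambda>z. ennreal ((riemann_dist (fst z) (snd z))\<^sup>2)) \<in> borel_measurable \<eta>"
    by (simp cong: measurable_cong_sets add: s\<eta>)
  \<comment> \<open>Left invariance removes the rotation from the distance, so the integrand depends
    on the pair alone and the integral is the average controlled by the choice of V.\<close>
  have inner: "(\<integral>\<^sup>+q. ennreal ((riemann_dist (X (z, q)) (Y (z, q)))\<^sup>2) \<partial>rotation_law)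
      \<le> ennreal (1 - 1 / ?N) * ennreal ((riemann_dist (fst z) (snd z))\<^sup>2) + ennreal \<theta>"
    if z: "z \<in> space \<eta>" for z
  proof -
    obtain x y where xy: "z = (x, y)" "x \<in> unitary_group" "y \<in> unitary_group" using z sp\<eta> by auto
    interpret H: prob_space H by (rule prob_space_H)
    define g where "g p = (riemann_dist x (V p z ** y))\<^sup>2" for p
    have "riemann_dist (X (z, q)) (Y (z, q)) = riemann_dist x (V (fst q) z ** y)"
      if "q \<in> space rotation_law" for q
      using riemann_dist_mult_left[OF rotation_unitary[OF that] xy(2) unitary_group_mult[OF VU[OF z] xy(3)]]
      by (simp add: X_def Y_def xy(1))
    then have "(\<integral>\<^sup>+q. ennreal ((riemann_dist (X (z, q)) (Y (z, q)))\<^sup>2) \<partial>rotation_law)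
        = (\<integral>\<^sup>+q. ennreal (g (fst q)) \<partial>rotation_law)"
      by (intro nn_integral_cong) (simp add: g_def)
    also have "\<dots> = (\<Sum>p\<in>pairs. \<integral>\<^sup>+R. ennreal (g (fst (p, R))) \<partial>H) / of_nat (card pairs)"
    proof (rule nn_integral_rotation_law)
      show "(\<lambda>q. ennreal (g (fst q))) \<in> borel_measurable rotation_law"
        unfolding rotation_law_def
        by (rule measurable_compose[OF measurable_fst])
          (simp add: measurable_def sets_uniform_count_measure space_uniform_count_measure)
    qed
    also have "\<dots> = ennreal (sum g pairs) / of_nat (card pairs)"
      by (simp add: H.emeasure_space_1 sum_ennreal g_def)
    also have "\<dots> = ennreal (sum g pairs / ?N)"
      using card_pairs_ge_1 by (simp add: divide_ennreal sum_nonneg g_def ennreal_of_nat_eq_real_of_nat)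
    also have "\<dots> \<le> ennreal ((1 - 1 / ?N) * (riemann_dist x y)\<^sup>2 + \<theta>)"
    proof (rule ennreal_leI)
      have "sum g pairs / ?N \<le> ((?N - 1) * (riemann_dist x y)\<^sup>2 + \<theta>) / ?N"
        using V(3)[OF xy(2,3)] card_pairs_ge_1 unfolding g_def xy(1) by (intro divide_right_mono) auto
      also have "\<dots> = (1 - 1 / ?N) * (riemann_dist x y)\<^sup>2 + \<theta> / ?N"
      proof -
        have "((N - 1) * D + \<theta>) / N = (1 - 1 / N) * D + \<theta> / N" if "N \<ge> 1" for N D :: real
          using that by (simp add: field_simps)
        then show ?thesis using card_pairs_ge_1 by blast
      qed
      also have "\<theta> / ?N \<le> \<theta>" using \<theta> card_pairs_ge_1 by (simp add: divide_le_eq)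
      finally show "sum g pairs / ?N \<le> (1 - 1 / ?N) * (riemann_dist x y)\<^sup>2 + \<theta>" by simp
    qed
    also have "\<dots> = ennreal (1 - 1 / ?N) * ennreal ((riemann_dist (fst z) (snd z))\<^sup>2) + ennreal \<theta>"
      using \<theta> card_pairs_ge_1 by (simp add: xy(1) ennreal_mult ennreal_plus)
    finally show ?thesis .
  qed
  have "transport_cost \<eta>' = (\<integral>\<^sup>+w. ennreal ((riemann_dist (X w) (Y w))\<^sup>2) \<partial>(\<eta> \<Otimes>\<^sub>M rotation_law))"
    unfolding transport_cost_def \<eta>'_def by (subst nn_integral_distr[OF XYm]) (use d2' in simp_all)
  also have "\<dots> = (\<integral>\<^sup>+z. \<integral>\<^sup>+q. ennreal ((riemann_dist (X (z, q)) (Y (z, q)))\<^sup>2) \<partial>rotation_law \<partial>\<eta>)"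
    by (rule Q.nn_integral_fst[symmetric, OF d2])
  also have "\<dots> \<le> (\<integral>\<^sup>+z. ennreal (1 - 1 / ?N) * ennreal ((riemann_dist (fst z) (snd z))\<^sup>2) + ennreal \<theta> \<partial>\<eta>)"
    by (intro nn_integral_mono inner)
  also have "\<dots> = ennreal (1 - 1 / ?N) * transport_cost \<eta> + ennreal \<theta>"
    unfolding transport_cost_def using d2\<eta>
    by (simp add: nn_integral_add nn_integral_cmult \<eta>.emeasure_space_1)
  finally show ?thesis using that[OF coupling] by blast
qed

text \<open>The slack \<delta> is universally quantified in the induction: half of it goes to the
  preceding steps and half to the new one, so the total error stays as small as desired.\<close>

lemma kernel_iterate_coupling:
  assumes \<mu>: "borel_prob_on_unitary \<mu>" and \<H>: "haar_prob \<H>" and "\<delta> > 0"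
  shows "borel_prob_on_unitary (kernel_iterate \<mu> (kac_kernel I H) t) \<and>
    (\<exists>\<eta>. coupling_of \<eta> (kernel_iterate \<mu> (kac_kernel I H) t) \<H> \<and>
      transport_cost \<eta> \<le> ennreal ((1 - 1 / real (card pairs)) ^ t * (pi\<^sup>2 * real CARD('n)) + \<delta>))"
  using assms(3)
proof (induction t arbitrary: \<delta>)
  case 0
  have \<H>': "borel_prob_on_unitary \<H>" using \<H> by (simp add: haar_prob_def)
  interpret \<mu>: prob_space \<mu> using \<mu> by (simp add: borel_prob_on_unitary_def)
  interpret \<H>: prob_space \<H> using \<H>' by (simp add: borel_prob_on_unitary_def)
  interpret P: pair_prob_space \<mu> \<H> ..
  have s: "sets \<mu> = sets UB" "sets \<H> = sets UB" using \<mu> \<H>' by (auto simp: borel_prob_on_unitary_def)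
  have sp: "space \<mu> = unitary_group" "space \<H> = unitary_group"
    using s[THEN sets_eq_imp_space_eq] by auto
  have "distr (\<mu> \<Otimes>\<^sub>M \<H>) UB fst = distr (\<mu> \<Otimes>\<^sub>M \<H>) \<mu> fst"
    by (rule distr_cong) (simp_all add: s)
  then have 1: "distr (\<mu> \<Otimes>\<^sub>M \<H>) UB fst = \<mu>" by (simp add: \<H>.distr_pair_fst)
  have 2: "distr (\<mu> \<Otimes>\<^sub>M \<H>) UB snd = \<H>"
  proof (rule measure_eqI)
    fix S assume "S \<in> sets (distr (\<mu> \<Otimes>\<^sub>M \<H>) UB snd)"
    then have S: "S \<in> sets \<H>" by (simp add: s)
    have m: "snd \<in> measurable (\<mu> \<Otimes>\<^sub>M \<H>) UB"
      using measurable_snd[of \<mu> \<H>] by (simp cong: measurable_cong_sets add: s)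
    have "snd -` S \<inter> space (\<mu> \<Otimes>\<^sub>M \<H>) = space \<mu> \<times> S"
      using sets.sets_into_space[OF S] by (auto simp: space_pair_measure)
    moreover have "emeasure (\<mu> \<Otimes>\<^sub>M \<H>) (space \<mu> \<times> S) = emeasure \<H> S"
      by (simp add: \<H>.emeasure_pair_measure_Times[OF sets.top S] \<mu>.emeasure_space_1)
    ultimately show "emeasure (distr (\<mu> \<Otimes>\<^sub>M \<H>) UB snd) S = emeasure \<H> S"
      using S by (simp add: emeasure_distr[OF m] s)
  qed (simp add: s)
  have "sets (\<mu> \<Otimes>\<^sub>M \<H>) = sets (UB \<Otimes>\<^sub>M UB)" using s by (rule sets_pair_measure_cong)
  then have c: "coupling_of (\<mu> \<Otimes>\<^sub>M \<H>) \<mu> \<H>"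
    using 1 2 P.prob_space_axioms by (simp add: coupling_of_def)
  let ?C = "pi\<^sup>2 * real CARD('n)"
  \<comment> \<open>The start is the product coupling, whose cost is at most the square of the
    diameter bound.\<close>
  have "transport_cost (\<mu> \<Otimes>\<^sub>M \<H>) \<le> (\<integral>\<^sup>+z. ennreal ?C \<partial>(\<mu> \<Otimes>\<^sub>M \<H>))"
    unfolding transport_cost_def
  proof (intro nn_integral_mono ennreal_leI)
    fix z assume "z \<in> space (\<mu> \<Otimes>\<^sub>M \<H>)"
    then have z: "fst z \<in> unitary_group" "snd z \<in> unitary_group" by (auto simp: space_pair_measure sp)
    have "(riemann_dist (fst z) (snd z))\<^sup>2 \<le> (pi * sqrt (real CARD('n)))\<^sup>2"
      using riemann_dist_le_diameter[OF z] riemann_dist_nonneg[OF z] by (intro power_mono)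
    then show "(riemann_dist (fst z) (snd z))\<^sup>2 \<le> ?C" by (simp add: power_mult_distrib)
  qed
  also have "\<dots> = ennreal ?C" by (simp add: P.emeasure_space_1)
  also have "\<dots> \<le> ennreal ((1 - 1 / real (card pairs)) ^ 0 * ?C + \<delta>)"
    using 0 by (intro ennreal_leI) simp
  finally show ?case using c \<mu> by (auto simp: kernel_iterate_def)
next
  case (Suc t)
  let ?\<kappa> = "1 - 1 / real (card pairs)"
  let ?C = "pi\<^sup>2 * real CARD('n)"
  let ?\<mu> = "kernel_iterate \<mu> (kac_kernel I H) t"
  have \<kappa>: "0 \<le> ?\<kappa>" "?\<kappa> \<le> 1" using card_pairs_ge_1 by auto
  have \<delta>: "\<delta> / 2 > 0" using Suc.prems by simp
  from Suc.IH[OF this] obtain \<eta> where IH: "borel_prob_on_unitary ?\<mu>" "coupling_of \<eta> ?\<mu> \<H>"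
    "transport_cost \<eta> \<le> ennreal (?\<kappa> ^ t * ?C + \<delta> / 2)" by blast
  have \<H>': "borel_prob_on_unitary \<H>" using \<H> by (simp add: haar_prob_def)
  obtain \<eta>' where \<eta>': "coupling_of \<eta>' (?\<mu> \<bind> kac_kernel I H) (\<H> \<bind> kac_kernel I H)"
    "transport_cost \<eta>' \<le> ennreal ?\<kappa> * transport_cost \<eta> + ennreal (\<delta> / 2)"
    by (rule kac_coupling_step[OF IH(2,1) \<H>' \<delta>])
  have Suc_eq: "kernel_iterate \<mu> (kac_kernel I H) (Suc t) = ?\<mu> \<bind> kac_kernel I H"
    by (simp add: kernel_iterate_def)
  note \<eta>'(2)
  also have "ennreal ?\<kappa> * transport_cost \<eta> + ennreal (\<delta> / 2)
      \<le> ennreal ?\<kappa> * ennreal (?\<kappa> ^ t * ?C + \<delta> / 2) + ennreal (\<delta> / 2)"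
    by (intro add_right_mono mult_left_mono IH(3)) simp
  also have "\<dots> = ennreal (?\<kappa> * (?\<kappa> ^ t * ?C + \<delta> / 2) + \<delta> / 2)"
    using \<kappa> \<delta> by (simp add: ennreal_mult ennreal_plus)
  also have "\<dots> \<le> ennreal (?\<kappa> ^ Suc t * ?C + \<delta>)"
  proof (rule ennreal_leI)
    have "?\<kappa> * (\<delta> / 2) \<le> 1 * (\<delta> / 2)" using \<kappa>(2) \<delta> by (intro mult_right_mono) auto
    then show "?\<kappa> * (?\<kappa> ^ t * ?C + \<delta> / 2) + \<delta> / 2 \<le> ?\<kappa> ^ Suc t * ?C + \<delta>"
      by (simp only: distrib_left power_Suc mult.assoc)
  qed
  finally show ?case
    using \<eta>'(1) kac_step(1)[OF IH(1)] haar_invariant[OF \<H>] by (auto simp: Suc_eq)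
qed

text \<open>The infimum over couplings absorbs the slack, and the finite cost supplies the
  integrability that \<open>wasserstein2\<close> demands.\<close>

lemma wasserstein2_kernel_iterate_le:
  assumes \<mu>: "borel_prob_on_unitary \<mu>" and \<H>: "haar_prob \<H>"
    and t: "(1 - 1 / real (card pairs)) ^ t * (pi\<^sup>2 * real CARD('n)) \<le> \<epsilon>\<^sup>2" and \<epsilon>: "\<epsilon> > 0"
  shows "wasserstein2 riemann_dist (kernel_iterate \<mu> (kac_kernel I H) t) \<H> \<le> \<epsilon>"
proof -
  let ?\<mu> = "kernel_iterate \<mu> (kac_kernel I H) t"
  let ?W = "wasserstein2 riemann_dist ?\<mu> \<H>"
  have bound: "?W \<le> sqrt (\<epsilon>\<^sup>2 + \<delta>)" if \<delta>: "\<delta> > 0" for \<delta>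
  proof -
    obtain \<eta> where \<mu>t: "borel_prob_on_unitary ?\<mu>" and \<eta>: "coupling_of \<eta> ?\<mu> \<H>"
      "transport_cost \<eta> \<le> ennreal ((1 - 1 / real (card pairs)) ^ t * (pi\<^sup>2 * real CARD('n)) + \<delta>)"
      using kernel_iterate_coupling[OF \<mu> \<H> \<delta>] by blast
    have s: "sets ?\<mu> = sets UB" "sets \<H> = sets UB"
      using \<mu>t \<H> by (auto simp: haar_prob_def borel_prob_on_unitary_def)
    have s\<eta>: "sets \<eta> = sets (UB \<Otimes>\<^sub>M UB)" using \<eta>(1) by (simp add: coupling_of_def)
    have "sets (?\<mu> \<Otimes>\<^sub>M \<H>) = sets (UB \<Otimes>\<^sub>M UB)" using s by (rule sets_pair_measure_cong)
    moreover have "distr \<eta> ?\<mu> fst = distr \<eta> UB fst" "distr \<eta> \<H> snd = distr \<eta> UB snd"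
      by (rule distr_cong; simp add: s)+
    ultimately have c: "\<eta> \<in> couplings ?\<mu> \<H>"
      using \<eta>(1) by (simp add: couplings_def coupling_of_def)
    have m: "(\<lambda>z. (riemann_dist (fst z) (snd z))\<^sup>2) \<in> borel_measurable \<eta>"
    proof -
      have "(\<lambda>z. (riemann_dist (fst z) (snd z))\<^sup>2) \<in> borel_measurable (UB \<Otimes>\<^sub>M UB)"
        by (intro borel_measurable_power borel_measurable_riemann_dist measurable_fst measurable_snd)
      then show ?thesis by (simp cong: measurable_cong_sets add: s\<eta>)
    qed
    have le: "(\<integral>\<^sup>+z. ennreal ((riemann_dist (fst z) (snd z))\<^sup>2) \<partial>\<eta>) \<le> ennreal (\<epsilon>\<^sup>2 + \<delta>)"
      using \<eta>(2) t unfolding transport_cost_def by (elim order_trans) (intro ennreal_leI, simp)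
    have int: "integrable \<eta> (\<lambda>z. (riemann_dist (fst z) (snd z))\<^sup>2)"
      using m le by (intro integrableI_bounded) (auto intro: le_less_trans)
    have "(\<integral>z. (riemann_dist (fst z) (snd z))\<^sup>2 \<partial>\<eta>) \<le> \<epsilon>\<^sup>2 + \<delta>"
      using le \<delta> by (intro integral_real_bounded) auto
    moreover have "?W \<le> sqrt (\<integral>z. (riemann_dist (fst z) (snd z))\<^sup>2 \<partial>\<eta>)"
      unfolding wasserstein2_def
    proof (rule cInf_lower)
      show "bdd_below {sqrt (\<integral>z. (riemann_dist (fst z) (snd z))\<^sup>2 \<partial>\<eta>) |\<eta>.
          \<eta> \<in> couplings ?\<mu> \<H> \<and> integrable \<eta> (\<lambda>z. (riemann_dist (fst z) (snd z))\<^sup>2)}"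
        by (auto intro!: bdd_belowI[of _ 0])
    qed (use c int in blast)
    ultimately show ?thesis by (meson order_trans real_sqrt_le_mono)
  qed
  \<comment> \<open>Slack d^2 in the squared cost amounts to slack at most d in the
    distance.\<close>
  have "?W \<le> \<epsilon> + d" if d: "d > 0" for d
  proof -
    have "\<epsilon>\<^sup>2 + d\<^sup>2 \<le> (\<epsilon> + d)\<^sup>2" using \<epsilon> d by (simp add: power2_sum)
    then have "sqrt (\<epsilon>\<^sup>2 + d\<^sup>2) \<le> \<epsilon> + d" using \<epsilon> d by (intro real_le_lsqrt) auto
    then show ?thesis using bound[of "d\<^sup>2"] d by simp
  qed
  then show ?thesis by (rule field_le_epsilon)
qed

end

section \<open>The numerical rate and the mixing time\<close>

text \<open>If l > 0, then 1 - 1/N <= exp (- 1/N), 2 N <= n^2 and t >= n^2 l bound the power by exp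
  (- 2 l), where exp l is the ratio of the diameter bound to \<epsilon>.\<close>

lemma contraction_rate:
  fixes n N :: nat and \<epsilon> :: real
  assumes n: "n \<ge> 2" and N: "N = n choose 2" and \<epsilon>: "\<epsilon> > 0"
    and t: "t = nat \<lceil>(real n)\<^sup>2 * ln (pi * sqrt (real n) / \<epsilon>)\<rceil>"
  shows "(1 - 1 / real N) ^ t * (pi\<^sup>2 * real n) \<le> \<epsilon>\<^sup>2"
proof -
  define l where "l = ln (pi * sqrt (real n) / \<epsilon>)"
  have pos: "pi * sqrt (real n) > 0" using n by simp
  have el: "exp l = pi * sqrt (real n) / \<epsilon>" unfolding l_def using pos \<epsilon> by simp
  have N2: "2 * real N = real n * (real n - 1)"
  proof -
    \<comment> \<open>The binomial coefficient is a natural-number quotient; it has to be exact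
      before passing to the reals.\<close>
    have "even (n * (n - 1))" by (cases "even n") auto
    then have "2 * N = n * (n - 1)" unfolding N choose_two by (rule dvd_mult_div_cancel)
    then have "real (2 * N) = real (n * (n - 1))" by (rule arg_cong)
    then show ?thesis using n by (simp add: of_nat_diff)
  qed
  have N1: "real N \<ge> 1"
  proof -
    have "2 * 1 \<le> real n * (real n - 1)" using n by (intro mult_mono) auto
    then show ?thesis using N2 by simp
  qed
  have C: "pi\<^sup>2 * real n = (pi * sqrt (real n))\<^sup>2" by (simp add: power_mult_distrib)
  have "(1 - 1 / real N) ^ t \<le> exp (- 2 * l)"
  \<comment> \<open>For l <= 0 the ceiling is at most 0 and \<open>nat\<close> makes t = 0, so the
    trivial bound 1 on the power is the right one.\<close>
  proof (cases "l \<le> 0")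
    case True
    have "(1 - 1 / real N) ^ t \<le> 1" using N1 by (intro power_le_one) auto
    also have "1 \<le> exp (- 2 * l)" using True by simp
    finally show ?thesis .
  next
    case False
    have "(1 - 1 / real N) ^ t \<le> exp (- (1 / real N)) ^ t"
      using N1 exp_ge_add_one_self[of "- (1 / real N)"] by (intro power_mono) auto
    also have "\<dots> = exp (- (real t / real N))" by (simp add: exp_of_nat_mult[symmetric])
    also have "\<dots> \<le> exp (- 2 * l)"
    proof -
      have "2 * real N * l \<le> (real n)\<^sup>2 * l"
        unfolding N2 using False by (intro mult_right_mono) (auto simp: power2_eq_square algebra_simps)
      also have "\<dots> \<le> real t" unfolding t l_def by (rule real_nat_ceiling_ge)
      finally show ?thesis using N1 by (simp add: field_simps)
    qed
    finally show ?thesis .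
  qed
  also have "exp (- 2 * l) = \<epsilon>\<^sup>2 / (pi * sqrt (real n))\<^sup>2"
  proof -
    have "- 2 * l = - (l + l)" by simp
    then have "exp (- 2 * l) = inverse ((exp l)\<^sup>2)"
      by (simp only: exp_minus exp_add power2_eq_square)
    then show ?thesis by (simp add: el power_divide)
  qed
  finally have "(1 - 1 / real N) ^ t * (pi * sqrt (real n))\<^sup>2 \<le> \<epsilon>\<^sup>2"
    by (simp only: pos_le_divide_eq[OF zero_less_power[OF pos]])
  then show ?thesis unfolding C .
qed

theorem theorem5:
  fixes I :: "'n::{finite,linorder} \<Rightarrow> 'n \<Rightarrow> complex^'n::{finite,linorder} \<Rightarrow> complex^2"
    and H :: "(complex^2^2) measure"
    and \<H> :: "(complex^'n::{finite,linorder}^'n::{finite,linorder}) measure"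
    and \<epsilon> :: real
  assumes "CARD('n) \<ge> 2"
    and "\<And>i j. i < j \<Longrightarrow> complex_linear_isometry_on (coord_span i j) (I i j)"
    and "haar_prob H"
    and "haar_prob \<H>"
    and "\<epsilon> > 0"
  shows "mixing_time I H \<H> \<epsilon> \<le>
    enat (nat \<lceil>(real CARD('n))\<^sup>2 * ln (pi * sqrt (real CARD('n)) / \<epsilon>)\<rceil>)"
proof -
  interpret kac_walk I H using assms(1-3) by unfold_locales
  show ?thesis
    unfolding mixing_time_def
    \<comment> \<open>One admissible time bounds the infimum; admissibility is checked for all
      initial laws at once.\<close>
    by (rule Inf_lower)
      (use wasserstein2_kernel_iterate_le[OF _ assms(4) _ assms(5)]
         contraction_rate[OF assms(1) card_ordered_pairs assms(5) refl] in blast)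
qed

end
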